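(* Let $\{X_t\}_{t\ge1}$ be a stationary Gaussian sequence with $\mathbb E X_t=0$, $\mathbb E X_t^2=1$ and covariance $\rho(h)=\mathbb E[X_tX_{t+h}]\sim c\,h^{-\alpha}L_0(h)$ as $h\to\infty$, where $c>0$, $0<\alpha<1$, and $L_0$ is slowly varying at infinity. Let $G\in L^2(\mathbb R,\phi)$ have Hermite rank $m=1$, and let $a_n=n^{-d}\ell_a(n)$, $n\ge1$, where $d\in\mathbb R$ and $\ell_a$ is slowly varying at infinity. Assume $2d+\alpha<1$. Let $S_n=\sum_{t=1}^n a_tG(X_t)$ and $A_n^2=\operatorname{Var}(S_n)$. Then almost surely $$\limsup_{n\to\infty}\frac{S_n}{A_n(2\log\log n)^{1/2}}=1,\qquad \liminf_{n\to\infty}\frac{S_n}{A_n(2\log\log n)^{1/2}}=-1.$$ Consequently, $\displaystyle\limsup_{n\to\infty}\frac{|S_n|}{A_n(2\log\log n)^{1/2}}=1$ almost surely.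
   Context: $\phi$ is the standard Gaussian measure on $\mathbb R$; $H_q(x)=(-1)^qe^{x^2/2}\frac{d^q}{dx^q}e^{-x^2/2}$ is the $q$-th Hermite polynomial. $G\in L^2(\mathbb R,\phi)$ has Hermite rank $m\ge1$ if $G=\sum_{q=m}^\infty\frac{J_q}{q!}H_q$ in $L^2(\mathbb R,\phi)$ with $J_q=\int_{\mathbb R}G H_q\,d\phi$ and $J_m\ne0$. Slowly varying functions $L$ are measurable, eventually positive, with $L(rx)/L(x)\to1$ as $x\to\infty$ for every $r>0$. $A_n\ge0$ is the square root of $\operatorname{Var}(S_n)$ (it is positive for all large $n$). *)

theory Defs
  imports "HOL-Probability.Probability" "HOL-Library.Landau_Symbols"
begin

definition slowly_varying :: "(real \<Rightarrow> real) \<Rightarrow> bool" where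
  "slowly_varying L \<longleftrightarrow>
     L \<in> borel_measurable (restrict_space borel {0<..}) \<and>
     (\<forall>\<^sub>F x in at_top. 0 < L x) \<and>
     (\<forall>r>0. ((\<lambda>x. L (r * x) / L x) \<longlongrightarrow> 1) at_top)"

definition hermite :: "nat \<Rightarrow> real \<Rightarrow> real" where
  "hermite q x = (-1) ^ q * exp (x\<^sup>2 / 2) * (deriv ^^ q) (\<lambda>y. exp (- y\<^sup>2 / 2)) x"

definition square_integrable_gaussian :: "(real \<Rightarrow> real) \<Rightarrow> bool" where
  "square_integrable_gaussian G \<longleftrightarrow>
     G \<in> borel_measurable borel \<and> integrable std_normal_distribution (\<lambda>x. (G x)\<^sup>2)"

definition hermite_coeff :: "(real \<Rightarrow> real) \<Rightarrow> nat \<Rightarrow> real" where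
  "hermite_coeff G q = (LINT x|std_normal_distribution. G x * hermite q x)"

definition has_hermite_rank :: "(real \<Rightarrow> real) \<Rightarrow> nat \<Rightarrow> bool" where
  "has_hermite_rank G m \<longleftrightarrow>
     1 \<le> m \<and>
     (\<lambda>N. \<integral>\<^sup>+ x. ennreal ((G x - (\<Sum>q=m..N. hermite_coeff G q / fact q * hermite q x)) ^ 2)
        \<partial>std_normal_distribution) \<longlonglongrightarrow> 0 \<and>
     hermite_coeff G m \<noteq> 0"

(* Degenerate (constant) variables count as Gaussian, so that singular covariance
   matrices are allowed in gaussian_sequence. *)
definition gaussian_rv :: "'w measure \<Rightarrow> ('w \<Rightarrow> real) \<Rightarrow> bool" where
  "gaussian_rv M Y \<longleftrightarrow>
     Y \<in> borel_measurable M \<and>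
     (\<exists>\<mu> \<sigma>. 0 \<le> \<sigma> \<and>
        distr M borel Y =
          (if \<sigma> = 0 then return borel \<mu> else density lborel (\<lambda>x. ennreal (normal_density \<mu> \<sigma> x))))"

(* Sequences are indexed by t >= 1; the value X 0 is never used. *)
definition gaussian_sequence :: "'w measure \<Rightarrow> (nat \<Rightarrow> 'w \<Rightarrow> real) \<Rightarrow> bool" where
  "gaussian_sequence M X \<longleftrightarrow>
     (\<forall>t\<ge>1. X t \<in> borel_measurable M) \<and>
     (\<forall>I b. finite I \<and> I \<subseteq> {1..} \<longrightarrow> gaussian_rv M (\<lambda>\<omega>. \<Sum>t\<in>I. b t * X t \<omega>))"

definition stationary_sequence :: "'w measure \<Rightarrow> (nat \<Rightarrow> 'w \<Rightarrow> real) \<Rightarrow> bool" where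
  "stationary_sequence M X \<longleftrightarrow>
     (\<forall>I h. finite I \<and> I \<subseteq> {1..} \<longrightarrow>
        distr M (\<Pi>\<^sub>M t\<in>I. borel) (\<lambda>\<omega>. \<lambda>t\<in>I. X (t + h) \<omega>) =
        distr M (\<Pi>\<^sub>M t\<in>I. borel) (\<lambda>\<omega>. \<lambda>t\<in>I. X t \<omega>))"

end

theory Submission
  imports Defs "HOL-Computational_Algebra.Polynomial" "HOL-Real_Asymp.Real_Asymp"
begin

text \<open>
  Split \<open>G x = J x + R x\<close> with \<open>J\<close> the first Hermite coefficient. Since \<open>R\<close> has Hermite rank at
  least two, \<open>\<bar>E (R (X s) R (X t))\<bar> \<le> \<rho> (t - s)\<^sup>2 \<parallel>R\<parallel>\<^sup>2\<close>, so the sums of \<open>a t R (X t)\<close> are smaller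
  than the standard deviation \<open>\<sigma> n\<close> of \<open>U n = (\<Sum>t\<le>n. a t X t)\<close> by a power of \<open>n\<close>; the logarithmic
  loss of the Rademacher--Menshov maximal inequality is affordable, and these sums are almost surely
  negligible. It remains to prove the law of the iterated logarithm for the Gaussian process \<open>U\<close>.

  The upper bound combines Gaussian tails on a fine subsequence, \<open>2 ^ j0\<close> points in each dyadic block,
  with dyadic chaining between its points; it needs only that increments of length \<open>l\<close> near \<open>n\<close> have
  variance of order at most \<open>l / n\<close> relative to \<open>(\<sigma> n)\<^sup>2\<close>. For the lower bound, the correlation of
  \<open>U m\<close> and \<open>U n\<close> decays like a power of \<open>m / n\<close>. For Lipschitz functions with values in \<open>[0, 1]\<close> of two
  standard Gaussian variables with correlation \<open>r\<close> the covariance is at most \<open>2 \<bar>r\<bar>\<close>, so Chebyshev's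
  inequality along \<open>(k!) ^ p\<close> replaces the second Borel--Cantelli lemma.
\<close>

section \<open>Slow variation and Potter bounds\<close>

text \<open>The sums are normalised by their own standard deviation, so the order of magnitude of
  \<open>(\<sigma> n)\<^sup>2\<close>, which is that of \<open>(n * a n)\<^sup>2 * \<rho> n\<close>,
  suffices; no limiting constant is computed, and power bounds up to constants carry the whole
  variance analysis. The hypothesis \<open>2 * d + \<alpha> < 1\<close> makes the index
  \<open>2 - 2 * d - \<alpha>\<close> of this quantity exceed 1. Together with
  \<open>0 < \<alpha> < 1\<close> it puts the indices of \<open>a n\<close>,
  \<open>(a n)\<^sup>2\<close> and \<open>a n * \<rho> n\<close> above -1, so that their sums are
  governed by their last terms. Finitely many early values of \<open>a\<close> and
  \<open>\<rho>\<close> may have any sign; they are handled by absolute values and by dropping an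
  initial segment. The power gained for the remainder comes from summing
  \<open>\<rho>\<^sup>2\<close> where the Gaussian part sums \<open>\<bar>\<rho>\<bar>\<close>. A
  constant has to be sharp only in the passage from a skeleton point to its neighbours, which is why
  the skeleton is refined as the tolerance shrinks.\<close>

lemma uniform_convergence_additive:
  fixes h :: "real \<Rightarrow> real"
  assumes [measurable]: "h \<in> borel_measurable borel"
    and lim: "\<And>u. ((\<lambda>x. h (x + u) - h x) \<longlongrightarrow> 0) at_top"
    and "0 < \<epsilon>"
  shows "\<forall>\<^sub>F x in at_top. \<forall>u\<in>{0..1}. \<bar>h (x + u) - h x\<bar> \<le> \<epsilon>"
proof (rule ccontr)
  assume "\<not> ?thesis"
  then have "\<exists>x u. real k \<le> x \<and> u \<in> {0..1} \<and> \<epsilon> < \<bar>h (x + u) - h x\<bar>" for k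
    unfolding eventually_at_top_linorder by (metis linorder_not_less)
  then obtain x u where x: "\<And>k. real k \<le> x k" and u: "\<And>k. u k \<in> {0..1}"
    and gt: "\<And>k. \<epsilon> < \<bar>h (x k + u k) - h (x k)\<bar>"
    by metis
  have xlim: "filterlim x at_top sequentially"
    by (rule filterlim_at_top_mono[OF filterlim_real_sequentially]) (simp add: x)
  have xulim: "filterlim (\<lambda>k. x k + u k) at_top sequentially"
    by (rule filterlim_at_top_mono[OF xlim]) (use u in auto)
  \<comment> \<open>By pointwise convergence these sets increase to the full intervals, so at a late
    \<open>n\<close> their measures exceed 3/2 and 1/2. Translating \<open>J n\<close> by
    \<open>u n\<close> keeps it inside \<open>{0..2}\<close>, which has no room for two disjoint
    sets of these sizes.\<close>
  define I where "I n = {y \<in> {0..2}. \<forall>m\<ge>n. \<bar>h (x m + y) - h (x m)\<bar> < \<epsilon> / 2}" for n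
  define J where "J n = {y \<in> {0..1}. \<forall>m\<ge>n. \<bar>h (x m + u m + y) - h (x m + u m)\<bar> < \<epsilon> / 2}" for n
  have Im[measurable]: "I n \<in> sets borel" and Jm[measurable]: "J n \<in> sets borel" for n
    unfolding I_def J_def by measurable
  have *: "\<exists>n. \<forall>m\<ge>n. \<bar>h (z m + y) - h (z m)\<bar> < \<epsilon> / 2" if "filterlim z at_top sequentially"
    for z :: "nat \<Rightarrow> real" and y
  proof -
    have "((\<lambda>m. h (z m + y) - h (z m)) \<longlonglongrightarrow> 0)"
      using filterlim_compose[OF lim that] .
    from tendstoD[OF this, of "\<epsilon> / 2"] \<open>0 < \<epsilon>\<close> show ?thesis
      by (simp add: eventually_sequentially dist_real_def)
  qed
  have UI: "(\<Union>n. I n) = {0..2}" and UJ: "(\<Union>n. J n) = {0..1}"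
    using *[OF xlim] *[OF xulim] by (auto simp: I_def J_def)
  have "(\<lambda>n. measure lborel (I n)) \<longlonglongrightarrow> measure lborel (\<Union>n. I n)"
  proof (rule Lim_measure_incseq)
    show "incseq I" unfolding incseq_def I_def by fastforce
  qed (auto simp: UI)
  moreover have "(\<lambda>n. measure lborel (J n)) \<longlonglongrightarrow> measure lborel (\<Union>n. J n)"
  proof (rule Lim_measure_incseq)
    show "incseq J" unfolding incseq_def J_def by fastforce
  qed (auto simp: UJ)
  ultimately have "\<forall>\<^sub>F n in sequentially. 3 / 2 < measure lborel (I n)"
    "\<forall>\<^sub>F n in sequentially. 1 / 2 < measure lborel (J n)"
    unfolding UI UJ by (auto dest: order_tendstoD(1)[of _ _ _ "3 / 2"] order_tendstoD(1)[of _ _ _ "1 / 2"])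
  then have "\<forall>\<^sub>F n in sequentially. 3 / 2 < measure lborel (I n) \<and> 1 / 2 < measure lborel (J n)"
    by (rule eventually_conj)
  then obtain n where n: "3 / 2 < measure lborel (I n)" "1 / 2 < measure lborel (J n)"
    unfolding eventually_sequentially by blast
  define K where "K = {y. y - u n \<in> J n}"
  have Km[measurable]: "K \<in> sets borel" unfolding K_def by measurable
  have "emeasure lborel (J n) = emeasure (distr lborel borel (\<lambda>y. - u n + y)) (J n)"
    by (subst lborel_distr_plus) simp
  also have "\<dots> = emeasure lborel K"
    by (subst emeasure_distr) (auto simp: K_def vimage_def)
  finally have K: "measure lborel K = measure lborel (J n)" by (simp add: measure_def)
  have K2: "K \<subseteq> {0..2}"
  proof
    fix y assume "y \<in> K"
    then have "y - u n \<in> {0..1}" by (simp add: K_def J_def)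
    then show "y \<in> {0..2}" using u[of n] by auto
  qed
  have I2: "I n \<subseteq> {0..2}" by (auto simp: I_def)
  have fm: "A \<in> fmeasurable lborel" if "A \<subseteq> {0..2::real}" "A \<in> sets borel" for A :: "real set"
    by (rule fmeasurableI2[of "{0..2::real}"]) (use that in \<open>auto simp: fmeasurable_def\<close>)
  \<comment> \<open>At a common point \<open>y\<close> the value \<open>h (x n + y)\<close> would be
    within \<epsilon>/2 of both \<open>h (x n)\<close> and \<open>h (x n + u n)\<close>, which
    differ by more than \<epsilon>.\<close>
  have "I n \<inter> K = {}"
  proof (rule ccontr)
    assume "I n \<inter> K \<noteq> {}"
    then obtain y where y: "y \<in> I n" "y - u n \<in> J n" by (auto simp: K_def)
    from y(1) have "\<bar>h (x n + y) - h (x n)\<bar> < \<epsilon> / 2" by (simp add: I_def)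
    moreover from y(2) have "\<bar>h (x n + u n + (y - u n)) - h (x n + u n)\<bar> < \<epsilon> / 2"
      unfolding J_def by blast
    moreover have "x n + u n + (y - u n) = x n + y" by simp
    ultimately show False using gt[of n] by (simp only:)
  qed
  moreover have "emeasure lborel (I n) \<noteq> \<infinity>" "emeasure lborel K \<noteq> \<infinity>"
    using fm[OF I2 Im] fm[OF K2 Km] by (auto simp: fmeasurable_def)
  ultimately have "measure lborel (I n \<union> K) = measure lborel (I n) + measure lborel K"
    by (intro measure_Union) auto
  moreover have "measure lborel (I n \<union> K) \<le> measure lborel {0..2::real}"
    by (intro measure_mono_fmeasurable) (use K2 I2 in \<open>auto simp: fmeasurable_def\<close>)
  ultimately show False using n K by simp
qed

text \<open>In logarithmic coordinates the increments of a slowly varying function tend to 0,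
  uniformly over unit steps. Adding up the steps along an interval of length \<open>u\<close> costs
  \<open>\<epsilon> * (1 + u)\<close>, where the 1 pays for the unfinished last step; exponentiated,
  it becomes the factor \<open>exp \<epsilon>\<close>.\<close>

lemma slowly_varying_potter:
  assumes "slowly_varying L" "0 < \<epsilon>"
  obtains x0 where "0 < x0" "\<And>x y. x0 \<le> x \<Longrightarrow> x \<le> y \<Longrightarrow>
      0 < L x \<and> L y \<le> exp \<epsilon> * (y / x) powr \<epsilon> * L x \<and> L x \<le> exp \<epsilon> * (y / x) powr \<epsilon> * L y"
proof -
  have L_meas: "L \<in> borel_measurable (restrict_space borel {0<..})"
    and Lpos: "\<forall>\<^sub>F x in at_top. 0 < L x"
    and Llim: "\<And>r. r > 0 \<Longrightarrow> ((\<lambda>x. L (r * x) / L x) \<longlongrightarrow> 1) at_top"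
    using assms(1) by (auto simp: slowly_varying_def)
  define h where "h x = ln (L (exp x))" for x
  have exp_meas: "exp \<in> measurable borel (restrict_space borel {0::real<..})"
    by (rule measurable_restrict_space2) auto
  have "(\<lambda>x. L (exp x)) \<in> borel_measurable borel"
    using measurable_compose[OF exp_meas L_meas] .
  then have hm: "h \<in> borel_measurable borel" unfolding h_def by measurable
  obtain x1 where x1: "\<And>x. x1 \<le> x \<Longrightarrow> 0 < L x"
    using Lpos unfolding eventually_at_top_linorder by blast
  have Lexp: "\<forall>\<^sub>F x in at_top. 0 < L (exp x)"
    using eventually_compose_filterlim[OF Lpos exp_at_top] .
  have hlim: "((\<lambda>x. h (x + u) - h x) \<longlongrightarrow> 0) at_top" for u
  proof -
    have "((\<lambda>x. L (exp u * exp x) / L (exp x)) \<longlongrightarrow> 1) at_top"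
      using filterlim_compose[OF Llim[of "exp u"] exp_at_top] by simp
    then have "((\<lambda>x. ln (L (exp u * exp x) / L (exp x))) \<longlongrightarrow> ln 1) at_top"
      by (rule tendsto_ln) simp
    moreover have "\<forall>\<^sub>F x in at_top. ln (L (exp u * exp x) / L (exp x)) = h (x + u) - h x"
    proof -
      have "\<forall>\<^sub>F x in at_top. 0 < L (exp (x + u))"
        using eventually_compose_filterlim[OF Lexp
            filterlim_tendsto_add_at_top[OF tendsto_const[of u] filterlim_ident]]
        by (simp add: add.commute)
      with Lexp show ?thesis
        by eventually_elim (simp add: h_def ln_div exp_add mult.commute)
    qed
    ultimately show ?thesis
      using tendsto_cong by force
  qed
  obtain x2 where x2: "\<And>x u. x2 \<le> x \<Longrightarrow> u \<in> {0..1} \<Longrightarrow> \<bar>h (x + u) - h x\<bar> \<le> \<epsilon>"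
    using uniform_convergence_additive[OF hm hlim assms(2)]
    unfolding eventually_at_top_linorder by blast
  have iter: "\<bar>h (x + u) - h x\<bar> \<le> \<epsilon> * real (Suc n)" if "x2 \<le> x" "real n \<le> u" "u \<le> real (Suc n)" for x u n
    using that
  proof (induction n arbitrary: x u)
    case 0
    then show ?case using x2[of x u] by auto
  next
    case (Suc n)
    have "\<bar>h ((x + 1) + (u - 1)) - h (x + 1)\<bar> \<le> \<epsilon> * real (Suc n)"
      using Suc.prems by (intro Suc.IH) auto
    moreover have "\<bar>h (x + 1) - h x\<bar> \<le> \<epsilon>"
      using x2[of x 1] Suc.prems by auto
    ultimately show ?case by (simp add: algebra_simps)
  qed
  have main: "\<bar>h (x + u) - h x\<bar> \<le> \<epsilon> * (1 + u)" if "x2 \<le> x" "0 \<le> u" for x u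
  proof -
    define n where "n = nat \<lfloor>u\<rfloor>"
    have n: "real n \<le> u" "u < real (Suc n)"
      using that(2) unfolding n_def by linarith+
    from iter[OF that(1) n(1)] n assms(2) have "\<bar>h (x + u) - h x\<bar> \<le> \<epsilon> * real (Suc n)" by simp
    also have "\<dots> \<le> \<epsilon> * (1 + u)" using n assms(2) by simp
    finally show ?thesis .
  qed
  define x0 where "x0 = max (max 1 x1) (exp x2)"
  show thesis
  proof (rule that)
    show "0 < x0" by (simp add: x0_def)
    fix x y assume xy: "x0 \<le> x" "x \<le> y"
    then have pos: "0 < x" "0 < y" "0 < L x" "0 < L y" "exp x2 \<le> x" using x1 by (auto simp: x0_def)
    then have "x2 \<le> ln x" by (metis ln_ge_iff)
    moreover have "0 \<le> ln y - ln x" using pos xy by simp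
    ultimately have "\<bar>h (ln x + (ln y - ln x)) - h (ln x)\<bar> \<le> \<epsilon> * (1 + (ln y - ln x))" by (rule main)
    then have b: "\<bar>ln (L y) - ln (L x)\<bar> \<le> \<epsilon> + \<epsilon> * ln (y / x)"
      using pos by (simp add: h_def ln_div algebra_simps)
    have e: "exp (\<epsilon> + \<epsilon> * ln (y / x)) = exp \<epsilon> * (y / x) powr \<epsilon>"
      using pos by (simp add: powr_def exp_add)
    have "L y = exp (ln (L y))" "L x = exp (ln (L x))" using pos by auto
    moreover have "exp (ln (L y)) \<le> exp (\<epsilon> + \<epsilon> * ln (y / x) + ln (L x))" using b by simp
    moreover have "exp (ln (L x)) \<le> exp (\<epsilon> + \<epsilon> * ln (y / x) + ln (L y))" using b by simp
    ultimately show "0 < L x \<and> L y \<le> exp \<epsilon> * (y / x) powr \<epsilon> * L x \<and> L x \<le> exp \<epsilon> * (y / x) powr \<epsilon> * L y"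
      using pos e by (simp add: exp_add)
  qed
qed

text \<open>
  Potter's two-sided bounds are all that is used of regular variation, and unlike the limit
  definition they are visibly stable under products.
\<close>

definition regvar :: "(nat \<Rightarrow> real) \<Rightarrow> real \<Rightarrow> bool" where
  "regvar u \<kappa> \<longleftrightarrow> (\<forall>\<epsilon>>0. \<exists>C. \<forall>\<^sub>F m in sequentially. \<forall>n\<ge>m. 0 < u m \<and>
     u n \<le> C * (real n / real m) powr (\<kappa> + \<epsilon>) * u m \<and>
     u m \<le> C * (real n / real m) powr (\<epsilon> - \<kappa>) * u n)"

lemma regvarE:
  assumes "regvar u \<kappa>" "0 < \<epsilon>"
  obtains C n0 where "0 < C" "1 \<le> n0" "\<And>m n. n0 \<le> m \<Longrightarrow> m \<le> n \<Longrightarrow> 0 < u m \<and>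
     u n \<le> C * (real n / real m) powr (\<kappa> + \<epsilon>) * u m \<and>
     u m \<le> C * (real n / real m) powr (\<epsilon> - \<kappa>) * u n"
proof -
  obtain C n1 where C: "\<And>m n. n1 \<le> m \<Longrightarrow> m \<le> n \<Longrightarrow> 0 < u m \<and>
     u n \<le> C * (real n / real m) powr (\<kappa> + \<epsilon>) * u m \<and>
     u m \<le> C * (real n / real m) powr (\<epsilon> - \<kappa>) * u n"
    using assms unfolding regvar_def eventually_sequentially by blast
  \<comment> \<open>With \<open>m = n\<close> the bound reads \<open>u m \<le> C * u m\<close> for a
    positive \<open>u m\<close>.\<close>
  have "0 < C" using C[of "max 1 n1" "max 1 n1"]
    by (smt (verit) divide_self_if max.cobounded2 mult_nonneg_nonneg mult_nonpos_nonneg powr_one_eq_one order_refl powr_ge_zero)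
  then show thesis using C by (intro that[of C "max 1 n1"]) auto
qed

lemma regvar_slowly_varying:
  assumes "slowly_varying L"
  shows "regvar (\<lambda>n. real n powr \<kappa> * L (real n)) \<kappa>"
  unfolding regvar_def
proof (intro allI impI)
  fix \<epsilon> :: real assume "0 < \<epsilon>"
  then obtain x0 where x0: "0 < x0" "\<And>x y. x0 \<le> x \<Longrightarrow> x \<le> y \<Longrightarrow>
      0 < L x \<and> L y \<le> exp \<epsilon> * (y / x) powr \<epsilon> * L x \<and> L x \<le> exp \<epsilon> * (y / x) powr \<epsilon> * L y"
    using slowly_varying_potter[OF assms] by blast
  have "\<forall>\<^sub>F m in sequentially. x0 \<le> real m"
    by real_asymp
  then have "\<forall>\<^sub>F m in sequentially. \<forall>n\<ge>m. 0 < real m powr \<kappa> * L (real m) \<and>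
     real n powr \<kappa> * L (real n) \<le> exp \<epsilon> * (real n / real m) powr (\<kappa> + \<epsilon>) * (real m powr \<kappa> * L (real m)) \<and>
     real m powr \<kappa> * L (real m) \<le> exp \<epsilon> * (real n / real m) powr (\<epsilon> - \<kappa>) * (real n powr \<kappa> * L (real n))"
  proof eventually_elim
    case (elim m)
    show ?case
    proof (intro allI impI)
      fix n assume "m \<le> n"
      then have pos: "0 < real m" "0 < real n" using x0(1) elim by auto
      have P: "0 < L (real m)" "L n \<le> exp \<epsilon> * (real n / m) powr \<epsilon> * L m" "L m \<le> exp \<epsilon> * (real n / m) powr \<epsilon> * L n"
        using x0(2)[of m n] elim \<open>m \<le> n\<close> by auto
      have e1: "(real n / m) powr (\<kappa> + \<epsilon>) * (real m powr \<kappa>) = real n powr \<kappa> * (real n / m) powr \<epsilon>"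
        using pos by (simp add: powr_add powr_divide)
      have e2: "(real n / m) powr (\<epsilon> - \<kappa>) * (real n powr \<kappa>) = real m powr \<kappa> * (real n / m) powr \<epsilon>"
        using pos by (simp add: powr_diff powr_divide)
      have "real n powr \<kappa> * L (real n) \<le> real n powr \<kappa> * (exp \<epsilon> * (real n / m) powr \<epsilon> * L m)"
        using P pos by (intro mult_left_mono) auto
      moreover have "real m powr \<kappa> * L (real m) \<le> real m powr \<kappa> * (exp \<epsilon> * (real n / m) powr \<epsilon> * L n)"
        using P pos by (intro mult_left_mono) auto
      moreover have "real n powr \<kappa> * (exp \<epsilon> * (real n / m) powr \<epsilon> * L m) = exp \<epsilon> * (real n / real m) powr (\<kappa> + \<epsilon>) * (real m powr \<kappa> * L (real m))"
        using e1 by (simp add: mult_ac)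
      moreover have "real m powr \<kappa> * (exp \<epsilon> * (real n / m) powr \<epsilon> * L n) = exp \<epsilon> * (real n / real m) powr (\<epsilon> - \<kappa>) * (real n powr \<kappa> * L (real n))"
        using e2 by (simp add: mult_ac)
      ultimately show "0 < real m powr \<kappa> * L (real m) \<and>
     real n powr \<kappa> * L (real n) \<le> exp \<epsilon> * (real n / real m) powr (\<kappa> + \<epsilon>) * (real m powr \<kappa> * L (real m)) \<and>
     real m powr \<kappa> * L (real m) \<le> exp \<epsilon> * (real n / real m) powr (\<epsilon> - \<kappa>) * (real n powr \<kappa> * L (real n))"
        using pos P by simp
    qed
  qed
  then show "\<exists>C. \<forall>\<^sub>F m in sequentially. \<forall>n\<ge>m. 0 < real m powr \<kappa> * L (real m) \<and>
     real n powr \<kappa> * L (real n) \<le> C * (real n / real m) powr (\<kappa> + \<epsilon>) * (real m powr \<kappa> * L (real m)) \<and>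
     real m powr \<kappa> * L (real m) \<le> C * (real n / real m) powr (\<epsilon> - \<kappa>) * (real n powr \<kappa> * L (real n))" by blast
qed

lemma regvar_powr: "regvar (\<lambda>n. real n powr \<kappa>) \<kappa>"
proof -
  have "slowly_varying (\<lambda>_. 1)" by (simp add: slowly_varying_def)
  from regvar_slowly_varying[OF this, of \<kappa>] show ?thesis by simp
qed

lemma regvar_mult:
  assumes "regvar u \<kappa>" "regvar v \<mu>"
  shows "regvar (\<lambda>n. u n * v n) (\<kappa> + \<mu>)"
  unfolding regvar_def
proof (intro allI impI)
  fix \<epsilon> :: real assume "0 < \<epsilon>"
  then have e: "0 < \<epsilon> / 2" by simp
  obtain C n0 where C: "0 < C" "1 \<le> n0" "\<And>m n. n0 \<le> m \<Longrightarrow> m \<le> n \<Longrightarrow> 0 < u m \<and>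
     u n \<le> C * (real n / real m) powr (\<kappa> + \<epsilon> / 2) * u m \<and>
     u m \<le> C * (real n / real m) powr (\<epsilon> / 2 - \<kappa>) * u n"
    using regvarE[OF assms(1) e] by metis
  obtain D n1 where D: "0 < D" "1 \<le> n1" "\<And>m n. n1 \<le> m \<Longrightarrow> m \<le> n \<Longrightarrow> 0 < v m \<and>
     v n \<le> D * (real n / real m) powr (\<mu> + \<epsilon> / 2) * v m \<and>
     v m \<le> D * (real n / real m) powr (\<epsilon> / 2 - \<mu>) * v n"
    using regvarE[OF assms(2) e] by metis
  have "0 < u m * v m \<and>
     u n * v n \<le> (C * D) * (real n / real m) powr (\<kappa> + \<mu> + \<epsilon>) * (u m * v m) \<and>
     u m * v m \<le> (C * D) * (real n / real m) powr (\<epsilon> - (\<kappa> + \<mu>)) * (u n * v n)"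
    if "max n0 n1 \<le> m" "m \<le> n" for m n
  proof -
    have pos: "0 < u m" "0 < u n" "0 < v m" "0 < v n" "0 < real n / real m"
      using that C(2) C(3)[of m m] C(3)[of n n] D(3)[of m m] D(3)[of n n] by auto
    have "u n * v n \<le> (C * (real n / real m) powr (\<kappa> + \<epsilon> / 2) * u m) * (D * (real n / real m) powr (\<mu> + \<epsilon> / 2) * v m)"
      by (rule mult_mono) (use that C(3)[of m n] D(3)[of m n] C(1) pos in auto)
    also have "\<dots> = (C * D) * ((real n / real m) powr (\<kappa> + \<epsilon> / 2) * (real n / real m) powr (\<mu> + \<epsilon> / 2)) * (u m * v m)"
      by simp
    also have "(real n / real m) powr (\<kappa> + \<epsilon> / 2) * (real n / real m) powr (\<mu> + \<epsilon> / 2) = (real n / real m) powr (\<kappa> + \<mu> + \<epsilon>)"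
      by (simp add: powr_add[symmetric] algebra_simps)
    finally have 1: "u n * v n \<le> (C * D) * (real n / real m) powr (\<kappa> + \<mu> + \<epsilon>) * (u m * v m)" .
    have "u m * v m \<le> (C * (real n / real m) powr (\<epsilon> / 2 - \<kappa>) * u n) * (D * (real n / real m) powr (\<epsilon> / 2 - \<mu>) * v n)"
      by (rule mult_mono) (use that C(3)[of m n] D(3)[of m n] C(1) pos in auto)
    also have "\<dots> = (C * D) * ((real n / real m) powr (\<epsilon> / 2 - \<kappa>) * (real n / real m) powr (\<epsilon> / 2 - \<mu>)) * (u n * v n)"
      by simp
    also have "(real n / real m) powr (\<epsilon> / 2 - \<kappa>) * (real n / real m) powr (\<epsilon> / 2 - \<mu>) = (real n / real m) powr (\<epsilon> - (\<kappa> + \<mu>))"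
      by (simp add: powr_add[symmetric] algebra_simps)
    finally show ?thesis using 1 pos by simp
  qed
  then show "\<exists>C. \<forall>\<^sub>F m in sequentially. \<forall>n\<ge>m. 0 < u m * v m \<and>
     u n * v n \<le> C * (real n / real m) powr (\<kappa> + \<mu> + \<epsilon>) * (u m * v m) \<and>
     u m * v m \<le> C * (real n / real m) powr (\<epsilon> - (\<kappa> + \<mu>)) * (u n * v n)"
    unfolding eventually_sequentially by (intro exI[of _ "C * D"] exI[of _ "max n0 n1"]) blast
qed

text \<open>Potter bounds see only orders of magnitude, so they survive bounded factors that strict
  regular variation would not. This is how \<open>\<rho>\<close> inherits the index of the
  expression to which it is asymptotically equivalent.\<close>

lemma regvar_cong_bounds:
  assumes "regvar u \<kappa>" "0 < b" "\<forall>\<^sub>F n in sequentially. b * u n \<le> v n \<and> v n \<le> B * u n"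
  shows "regvar v \<kappa>"
  unfolding regvar_def
proof (intro allI impI)
  fix \<epsilon> :: real assume "0 < \<epsilon>"
  obtain C n0 where C: "0 < C" "1 \<le> n0" "\<And>m n. n0 \<le> m \<Longrightarrow> m \<le> n \<Longrightarrow> 0 < u m \<and>
     u n \<le> C * (real n / real m) powr (\<kappa> + \<epsilon>) * u m \<and>
     u m \<le> C * (real n / real m) powr (\<epsilon> - \<kappa>) * u n"
    using regvarE[OF assms(1) \<open>0 < \<epsilon>\<close>] by metis
  obtain n1 where n1: "\<And>n. n1 \<le> n \<Longrightarrow> b * u n \<le> v n \<and> v n \<le> B * u n"
    using assms(3) unfolding eventually_sequentially by blast
  have "0 < v m \<and>
     v n \<le> (B * C / b) * (real n / real m) powr (\<kappa> + \<epsilon>) * v m \<and>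
     v m \<le> (B * C / b) * (real n / real m) powr (\<epsilon> - \<kappa>) * v n"
    if "max n0 n1 \<le> m" "m \<le> n" for m n
  proof -
    have u: "0 < u m" "0 < u n" using C(3)[of m m] C(3)[of n n] that by auto
    have v: "b * u m \<le> v m" "v m \<le> B * u m" "b * u n \<le> v n" "v n \<le> B * u n"
      using n1 that by auto
    have "0 < b * u m" using u assms(2) by simp
    then have vm: "0 < v m" using v by linarith
    have "0 < B * u m" using v \<open>0 < v m\<close> by linarith
    then have B: "0 < B" using u by (simp add: zero_less_mult_iff)
    have "v n \<le> B * (C * (real n / real m) powr (\<kappa> + \<epsilon>) * u m)"
      using v(4) B C(3)[of m n] that by (smt (verit) mult_left_mono max.bounded_iff)
    also have "\<dots> \<le> B * (C * (real n / real m) powr (\<kappa> + \<epsilon>) * (v m / b))"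
      using v(1) B C(1) assms(2) by (intro mult_left_mono) (auto simp: field_simps)
    finally have 1: "v n \<le> (B * C / b) * (real n / real m) powr (\<kappa> + \<epsilon>) * v m" by simp
    have "v m \<le> B * (C * (real n / real m) powr (\<epsilon> - \<kappa>) * u n)"
      using v(2) B C(3)[of m n] that by (smt (verit) mult_left_mono max.bounded_iff)
    also have "\<dots> \<le> B * (C * (real n / real m) powr (\<epsilon> - \<kappa>) * (v n / b))"
      using v(3) B C(1) assms(2) by (intro mult_left_mono) (auto simp: field_simps)
    finally have 2: "v m \<le> (B * C / b) * (real n / real m) powr (\<epsilon> - \<kappa>) * v n" by simp
    show ?thesis using vm 1 2 by blast
  qed
  then show "\<exists>C. \<forall>\<^sub>F m in sequentially. \<forall>n\<ge>m. 0 < v m \<and>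
     v n \<le> C * (real n / real m) powr (\<kappa> + \<epsilon>) * v m \<and>
     v m \<le> C * (real n / real m) powr (\<epsilon> - \<kappa>) * v n"
    unfolding eventually_sequentially by (intro exI[of _ "B * C / b"] exI[of _ "max n0 n1"]) blast
qed

lemma regvar_pos: "regvar u \<kappa> \<Longrightarrow> \<forall>\<^sub>F n in sequentially. 0 < u n"
  by (rule regvarE[of u \<kappa> 1]) (auto simp: eventually_sequentially)

lemma regvar_comparable:
  assumes "regvar u \<kappa>" "1 \<le> K"
  obtains C n0 where "0 < C" "1 \<le> n0" "\<And>m n. n0 \<le> m \<Longrightarrow> m \<le> n \<Longrightarrow> real n \<le> K * real m \<Longrightarrow>
    0 < u m \<and> 0 < u n \<and> u n \<le> C * u m \<and> u m \<le> C * u n"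
proof -
  obtain C n0 where C: "0 < C" "1 \<le> n0" "\<And>m n. n0 \<le> m \<Longrightarrow> m \<le> n \<Longrightarrow> 0 < u m \<and>
     u n \<le> C * (real n / real m) powr (\<kappa> + 1) * u m \<and>
     u m \<le> C * (real n / real m) powr (1 - \<kappa>) * u n"
    using regvarE[OF assms(1), of 1] by auto
  \<comment> \<open>A nonnegative exponent that dominates both Potter exponents, so that powers of a
    ratio in \<open>{1..K}\<close> stay below \<open>K powr e\<close> whatever the sign of
    \<kappa>.\<close>
  define e where "e = max 0 (max (\<kappa> + 1) (1 - \<kappa>))"
  have "0 < u m \<and> 0 < u n \<and> u n \<le> (C * K powr e) * u m \<and> u m \<le> (C * K powr e) * u n"
    if "n0 \<le> m" "m \<le> n" "real n \<le> K * real m" for m n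
  proof -
    have m: "1 \<le> real m" using C(2) that by simp
    then have r: "1 \<le> real n / real m" "real n / real m \<le> K"
      using that by (auto simp: field_simps)
    have P: "(real n / real m) powr x \<le> K powr e" if "x \<le> e" for x
    proof -
      have "(real n / real m) powr x \<le> (real n / real m) powr e"
        using r(1) that by (intro powr_mono) auto
      also have "\<dots> \<le> K powr e" using r assms(2) by (intro powr_mono2) (auto simp: e_def)
      finally show ?thesis .
    qed
    have u: "0 < u m" "0 < u n" using C(3)[of m m] C(3)[of n n] that by auto
    have "C * (real n / real m) powr (\<kappa> + 1) * u m \<le> C * K powr e * u m"
      using P[of "\<kappa> + 1"] C(1) u by (intro mult_right_mono mult_left_mono) (auto simp: e_def)
    moreover have "C * (real n / real m) powr (1 - \<kappa>) * u n \<le> C * K powr e * u n"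
      using P[of "1 - \<kappa>"] C(1) u by (intro mult_right_mono mult_left_mono) (auto simp: e_def)
    ultimately show ?thesis using C(3)[of m n] that u by linarith
  qed
  moreover have "0 < C * K powr e" using C(1) assms(2) by simp
  ultimately show thesis using C(2) that by blast
qed

text \<open>The Potter bound with \<open>m\<close> frozen at its threshold; the gap between the two
  indices serves as \<epsilon>.\<close>

lemma regvar_upper_powr:
  assumes "regvar u \<kappa>" "\<kappa> < \<mu>"
  obtains C where "0 < C" "\<forall>\<^sub>F n in sequentially. u n \<le> C * real n powr \<mu>"
proof -
  obtain C n0 where C: "0 < C" "1 \<le> n0" "\<And>m n. n0 \<le> m \<Longrightarrow> m \<le> n \<Longrightarrow> 0 < u m \<and>
     u n \<le> C * (real n / real m) powr (\<kappa> + (\<mu> - \<kappa>)) * u m \<and>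
     u m \<le> C * (real n / real m) powr ((\<mu> - \<kappa>) - \<kappa>) * u n"
    using regvarE[OF assms(1), of "\<mu> - \<kappa>"] assms(2) by auto
  have "u n \<le> (C * u n0 / real n0 powr \<mu>) * real n powr \<mu>" if "n0 \<le> n" for n
    using C(3)[of n0 n] that C(2) by (simp add: powr_divide mult_ac)
  moreover have "0 < C * u n0 / real n0 powr \<mu>" using C(1,2) C(3)[of n0 n0] by simp
  ultimately show thesis using that unfolding eventually_sequentially by blast
qed

lemma regvar_lower_powr:
  assumes "regvar u \<kappa>" "\<mu> < \<kappa>"
  obtains C where "0 < C" "\<forall>\<^sub>F n in sequentially. C * real n powr \<mu> \<le> u n"
proof -
  obtain C n0 where C: "0 < C" "1 \<le> n0" "\<And>m n. n0 \<le> m \<Longrightarrow> m \<le> n \<Longrightarrow> 0 < u m \<and>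
     u n \<le> C * (real n / real m) powr (\<kappa> + (\<kappa> - \<mu>)) * u m \<and>
     u m \<le> C * (real n / real m) powr ((\<kappa> - \<mu>) - \<kappa>) * u n"
    using regvarE[OF assms(1), of "\<kappa> - \<mu>"] assms(2) by auto
  have "(u n0 / (C * real n0 powr \<mu>)) * real n powr \<mu> \<le> u n" if "n0 \<le> n" for n
    using C(3)[of n0 n] that C(1,2) by (simp add: powr_divide powr_minus field_simps)
  moreover have "0 < u n0 / (C * real n0 powr \<mu>)" using C(1,2) C(3)[of n0 n0] by simp
  ultimately show thesis using that unfolding eventually_sequentially by blast
qed

lemma regvar_at_top:
  assumes "regvar u \<kappa>" "0 < \<kappa>"
  shows "filterlim u at_top sequentially"
proof -
  obtain C where C: "0 < C" "\<forall>\<^sub>F n in sequentially. C * real n powr (\<kappa> / 2) \<le> u n"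
    using regvar_lower_powr[OF assms(1), of "\<kappa> / 2"] assms(2) by auto
  have "filterlim (\<lambda>n. C * real n powr (\<kappa> / 2)) at_top sequentially"
    using assms(2) C(1) by real_asymp
  then show ?thesis using C(2) by (rule filterlim_at_top_mono)
qed

section \<open>Sums of regularly varying sequences, after Karamata\<close>

lemma sum_powr_le:
  fixes \<beta> :: real
  assumes "0 \<le> \<beta>" "\<beta> < 1"
  shows "(\<Sum>m=1..n. (real n / real m) powr \<beta>) \<le> real n / (1 - \<beta>)"
proof -
  have "(\<Sum>m=1..n. real m powr (-\<beta>)) \<le> real n powr (1 - \<beta>) / (1 - \<beta>)" for n
  proof (induction n)
    case (Suc n)
    \<comment> \<open>Integral comparison term by term: the mean value theorem for
      \<open>x powr (1 - \<beta>)\<close>, whose derivative is nonincreasing on positive reals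
      because \<beta> is nonnegative. The derivative may blow up at 0, hence the separate
      case.\<close>
    have "real (Suc n) powr (-\<beta>) * (1 - \<beta>) \<le> real (Suc n) powr (1 - \<beta>) - real n powr (1 - \<beta>)"
    proof (cases "n = 0")
      case True then show ?thesis using assms by simp
    next
      case False
      have "\<exists>z>real n. z < real (Suc n) \<and> real (Suc n) powr (1 - \<beta>) - real n powr (1 - \<beta>)
        = (real (Suc n) - real n) * ((1 - \<beta>) * z powr (1 - \<beta> - 1))"
        by (rule MVT2) (use False in \<open>auto intro!: derivative_eq_intros\<close>)
      then obtain z where z: "real n < z" "z < real (Suc n)" "real (Suc n) powr (1 - \<beta>) - real n powr (1 - \<beta>)
        = (1 - \<beta>) * z powr (-\<beta>)" by auto
      have "real (Suc n) powr (-\<beta>) \<le> z powr (-\<beta>)" using z assms by (intro powr_mono2') auto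
      then show ?thesis using z assms by (simp add: mult.commute mult_left_mono)
    qed
    then have "real (Suc n) powr (-\<beta>) \<le> (real (Suc n) powr (1 - \<beta>) - real n powr (1 - \<beta>)) / (1 - \<beta>)"
      using assms by (simp add: pos_le_divide_eq)
    then show ?case using Suc by (simp add: diff_divide_distrib)
  qed simp
  from this[of n] have "real n powr \<beta> * (\<Sum>m=1..n. real m powr (-\<beta>)) \<le> real n powr \<beta> * (real n powr (1 - \<beta>) / (1 - \<beta>))"
    by (intro mult_left_mono) auto
  moreover have "(\<Sum>m=1..n. (real n / real m) powr \<beta>) = real n powr \<beta> * (\<Sum>m=1..n. real m powr (-\<beta>))"
    unfolding sum_distrib_left by (intro sum.cong) (auto simp: powr_divide powr_minus_divide)
  moreover have "real n powr \<beta> * real n powr (1 - \<beta>) = real n"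
    by (cases "n = 0") (auto simp: powr_add[symmetric])
  ultimately show ?thesis by simp
qed

text \<open>Extends the lower Potter bound down to \<open>m = 1\<close>. Below the threshold
  \<open>u\<close> may vanish or be negative, hence the absolute value; \<open>D\<close> collects
  the finitely many early ratios, and the two bounds are chained at \<open>n0\<close>.\<close>

lemma regvar_bound_below:
  assumes "regvar u \<kappa>" "0 < \<epsilon>"
  obtains C n0 where "0 < C" "1 \<le> n0" "\<And>m n. n0 \<le> n \<Longrightarrow> 1 \<le> m \<Longrightarrow> m \<le> n \<Longrightarrow>
     0 < u n \<and> \<bar>u m\<bar> \<le> C * (real n / real m) powr (\<epsilon> - \<kappa>) * u n"
proof -
  obtain C n0 where C: "0 < C" "1 \<le> n0" "\<And>m n. n0 \<le> m \<Longrightarrow> m \<le> n \<Longrightarrow> 0 < u m \<and>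
     u n \<le> C * (real n / real m) powr (\<kappa> + \<epsilon>) * u m \<and>
     u m \<le> C * (real n / real m) powr (\<epsilon> - \<kappa>) * u n"
    using regvarE[OF assms] by metis
  define D where "D = (\<Sum>m=1..n0. \<bar>u m\<bar> * (real n0 / real m) powr (\<kappa> - \<epsilon>)) / u n0"
  have u0: "0 < u n0" using C(3)[of n0 n0] by simp
  have D0: "0 \<le> D" unfolding D_def using u0 by (intro divide_nonneg_pos sum_nonneg) auto
  have D: "\<bar>u m\<bar> \<le> D * (real n0 / real m) powr (\<epsilon> - \<kappa>) * u n0" if "1 \<le> m" "m \<le> n0" for m
  proof -
    have "\<bar>u m\<bar> * (real n0 / real m) powr (\<kappa> - \<epsilon>) \<le> D * u n0"
      using u0 that unfolding D_def by (auto intro!: member_le_sum)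
    then have "\<bar>u m\<bar> * (real n0 / real m) powr (\<kappa> - \<epsilon>) * (real n0 / real m) powr (\<epsilon> - \<kappa>)
      \<le> D * u n0 * (real n0 / real m) powr (\<epsilon> - \<kappa>)"
      by (intro mult_right_mono) auto
    moreover have "(real n0 / real m) powr (\<kappa> - \<epsilon>) * (real n0 / real m) powr (\<epsilon> - \<kappa>) = 1"
      using that C(2) by (simp add: powr_add[symmetric])
    ultimately show ?thesis by (simp add: mult_ac)
  qed
  have "0 < u n \<and> \<bar>u m\<bar> \<le> (C + D * C) * (real n / real m) powr (\<epsilon> - \<kappa>) * u n"
    if n: "n0 \<le> n" and m: "1 \<le> m" "m \<le> n" for m n
  proof (cases "n0 \<le> m")
    case True
    have un: "0 < u n" using C(3)[of n n] n by simp
    have "\<bar>u m\<bar> \<le> C * (real n / real m) powr (\<epsilon> - \<kappa>) * u n" using C(3)[of m n] True m by simp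
    moreover have "0 \<le> D * C * (real n / real m) powr (\<epsilon> - \<kappa>) * u n" using D0 C(1) un by simp
    ultimately show ?thesis using un by (simp add: algebra_simps)
  next
    case False
    have un: "0 < u n" using C(3)[of n n] n by simp
    have "\<bar>u m\<bar> \<le> D * (real n0 / real m) powr (\<epsilon> - \<kappa>) * u n0" using D False m by simp
    also have "\<dots> \<le> D * (real n0 / real m) powr (\<epsilon> - \<kappa>) * (C * (real n / real n0) powr (\<epsilon> - \<kappa>) * u n)"
      using C(3)[of n0 n] n D0 by (intro mult_left_mono) auto
    also have "\<dots> = D * C * ((real n0 / real m) powr (\<epsilon> - \<kappa>) * (real n / real n0) powr (\<epsilon> - \<kappa>)) * u n" by simp
    also have "(real n0 / real m) powr (\<epsilon> - \<kappa>) * (real n / real n0) powr (\<epsilon> - \<kappa>) = (real n / real m) powr (\<epsilon> - \<kappa>)"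
      using C(2) by (subst powr_mult[symmetric]) auto
    finally have "\<bar>u m\<bar> \<le> D * C * (real n / real m) powr (\<epsilon> - \<kappa>) * u n" .
    moreover have "0 \<le> C * (real n / real m) powr (\<epsilon> - \<kappa>) * u n" using C(1) un by simp
    ultimately show ?thesis using un by (simp add: algebra_simps)
  qed
  moreover have "0 < C + D * C" using C(1) D0 by (simp add: add_pos_nonneg)
  ultimately show thesis using C(2) that by blast
qed

lemma regvar_sum_abs_le:
  assumes "regvar u \<kappa>" "-1 < \<kappa>"
  obtains C where "0 < C" "\<forall>\<^sub>F n in sequentially. (\<Sum>m=1..n. \<bar>u m\<bar>) \<le> C * real n * u n"
proof -
  \<comment> \<open>Then \<open>\<epsilon> - \<kappa> = (1 - \<kappa>) / 2\<close> is below 1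
    exactly because \<kappa> exceeds -1. The later maximum with 0 serves the summation bound, which
    needs a nonnegative exponent.\<close>
  define \<epsilon> where "\<epsilon> = (1 + \<kappa>) / 2"
  have e: "0 < \<epsilon>" "\<epsilon> - \<kappa> < 1" using assms(2) by (auto simp: \<epsilon>_def)
  define \<beta> where "\<beta> = max 0 (\<epsilon> - \<kappa>)"
  have b: "0 \<le> \<beta>" "\<beta> < 1" "\<epsilon> - \<kappa> \<le> \<beta>" using e by (auto simp: \<beta>_def)
  obtain C n0 where C: "0 < C" "1 \<le> n0" "\<And>m n. n0 \<le> n \<Longrightarrow> 1 \<le> m \<Longrightarrow> m \<le> n \<Longrightarrow>
     0 < u n \<and> \<bar>u m\<bar> \<le> C * (real n / real m) powr (\<epsilon> - \<kappa>) * u n"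
    using regvar_bound_below[OF assms(1) e(1)] by metis
  have "(\<Sum>m=1..n. \<bar>u m\<bar>) \<le> (C / (1 - \<beta>)) * real n * u n" if "n0 \<le> n" for n
  proof -
    have un: "0 < u n" using C(3)[of n n] C(2) that by auto
    have "(\<Sum>m=1..n. \<bar>u m\<bar>) \<le> (\<Sum>m=1..n. (C * u n) * (real n / real m) powr \<beta>)"
    proof (rule sum_mono)
      fix m assume "m \<in> {1..n}"
      then have m: "1 \<le> m" "m \<le> n" by auto
      have "\<bar>u m\<bar> \<le> C * (real n / real m) powr (\<epsilon> - \<kappa>) * u n" using C(3)[of n m] that m by blast
      also have "\<dots> \<le> C * (real n / real m) powr \<beta> * u n"
        using m b C(1) un by (intro mult_left_mono mult_right_mono powr_mono) auto
      finally show "\<bar>u m\<bar> \<le> (C * u n) * (real n / real m) powr \<beta>" by (simp add: mult_ac)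
    qed
    also have "\<dots> \<le> (C * u n) * (real n / (1 - \<beta>))"
      unfolding sum_distrib_left[symmetric]
      using sum_powr_le[OF b(1,2), of n] C(1) un by (intro mult_left_mono) auto
    finally show ?thesis by (simp add: mult_ac)
  qed
  moreover have "0 < C / (1 - \<beta>)" using C(1) b by simp
  ultimately show thesis using that unfolding eventually_sequentially by blast
qed

section \<open>Square-integrable and Gaussian variables\<close>

definition L2_function :: "'w measure \<Rightarrow> ('w \<Rightarrow> real) \<Rightarrow> bool" where
  "L2_function M f \<longleftrightarrow> f \<in> borel_measurable M \<and> integrable M (\<lambda>x. (f x)\<^sup>2)"

definition l2norm :: "'w measure \<Rightarrow> ('w \<Rightarrow> real) \<Rightarrow> real" where
  "l2norm M f = sqrt (LINT x|M. (f x)\<^sup>2)"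

lemma l2norm_nonneg [simp]: "0 \<le> l2norm M f"
  by (simp add: l2norm_def)

lemma l2norm_power2: "(l2norm M f)\<^sup>2 = (LINT x|M. (f x)\<^sup>2)"
  by (simp add: l2norm_def)

lemma L2_functionD [dest]:
  assumes "L2_function M f"
  shows "f \<in> borel_measurable M" "integrable M (\<lambda>x. (f x)\<^sup>2)"
  using assms by (auto simp: L2_function_def)

lemma L2_mult_integrable:
  assumes f: "L2_function M f" and g: "L2_function M g"
  shows "integrable M (\<lambda>x. f x * g x)"
proof (rule Bochner_Integration.integrable_bound)
  show "integrable M (\<lambda>x. (f x)\<^sup>2 + (g x)\<^sup>2)"
    using f g by (intro Bochner_Integration.integrable_add) auto
  show "(\<lambda>x. f x * g x) \<in> borel_measurable M" using f g by (intro borel_measurable_times) auto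
  have "\<bar>p * q\<bar> \<le> p\<^sup>2 + q\<^sup>2" for p q :: real
  proof -
    have "0 \<le> (\<bar>p\<bar> - \<bar>q\<bar>)\<^sup>2" by simp
    then have "2 * (\<bar>p\<bar> * \<bar>q\<bar>) \<le> p\<^sup>2 + q\<^sup>2" by (simp add: power2_diff)
    moreover have "0 \<le> \<bar>p\<bar> * \<bar>q\<bar>" by simp
    ultimately show ?thesis unfolding abs_mult by linarith
  qed
  then show "AE x in M. norm (f x * g x) \<le> norm ((f x)\<^sup>2 + (g x)\<^sup>2)" by auto
qed

lemma L2_function_add:
  assumes f: "L2_function M f" and g: "L2_function M g"
  shows "L2_function M (\<lambda>x. f x + g x)"
proof -
  have "integrable M (\<lambda>x. (f x)\<^sup>2 + (g x)\<^sup>2 + 2 * (f x * g x))"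
    using L2_mult_integrable[OF f g] f g by (intro Bochner_Integration.integrable_add integrable_mult_right) auto
  moreover have "(\<lambda>x. (f x + g x)\<^sup>2) = (\<lambda>x. (f x)\<^sup>2 + (g x)\<^sup>2 + 2 * (f x * g x))"
    by (auto simp: power2_sum)
  ultimately show ?thesis using f g by (auto simp: L2_function_def)
qed

lemma L2_function_cmult:
  assumes f: "L2_function M f"
  shows "L2_function M (\<lambda>x. c * f x)"
  using f by (auto simp: L2_function_def power_mult_distrib)

lemma L2_function_diff:
  assumes f: "L2_function M f" and g: "L2_function M g"
  shows "L2_function M (\<lambda>x. f x - g x)"
  using L2_function_add[OF f L2_function_cmult[OF g, of "-1"]] by simp

lemma L2_function_sum:
  assumes "\<And>i. i \<in> I \<Longrightarrow> L2_function M (f i)"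
  shows "L2_function M (\<lambda>x. \<Sum>i\<in>I. f i x)"
proof (cases "finite I")
  case True
  then show ?thesis using assms
  proof (induction I)
    case empty then show ?case by (simp add: L2_function_def)
  next
    case (insert i I) then show ?case by (simp add: L2_function_add)
  qed
qed (simp add: L2_function_def)

lemma L2_Cauchy_Schwarz:
  assumes f: "L2_function M f" and g: "L2_function M g"
  shows "\<bar>LINT x|M. f x * g x\<bar> \<le> l2norm M f * l2norm M g"
proof -
  let ?F = "LINT x|M. (f x)\<^sup>2" and ?G = "LINT x|M. (g x)\<^sup>2" and ?P = "LINT x|M. f x * g x"
  have quad: "0 \<le> s\<^sup>2 * ?F + 2 * s * t * ?P + t\<^sup>2 * ?G" for s t
  proof -
    have "0 \<le> (LINT x|M. (s * f x + t * g x)\<^sup>2)" by simp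
    also have "(\<lambda>x. (s * f x + t * g x)\<^sup>2) = (\<lambda>x. s\<^sup>2 * (f x)\<^sup>2 + 2 * s * t * (f x * g x) + t\<^sup>2 * (g x)\<^sup>2)"
      by (auto simp: power2_sum power_mult_distrib algebra_simps)
    also have "(LINT x|M. s\<^sup>2 * (f x)\<^sup>2 + 2 * s * t * (f x * g x) + t\<^sup>2 * (g x)\<^sup>2) = s\<^sup>2 * ?F + 2 * s * t * ?P + t\<^sup>2 * ?G"
      using f g L2_mult_integrable[OF f g] by (subst Bochner_Integration.integral_add, auto)+
    finally show ?thesis .
  qed
  have "?P\<^sup>2 \<le> ?F * ?G"
  proof (cases "?G = 0")
    case True
    have "?P = 0"
    proof (rule ccontr)
      assume "?P \<noteq> 0"
      \<comment> \<open>With \<open>?G = 0\<close> the quadratic form is affine in \<open>t\<close>;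
        this choice would give it the negative value \<open>- ?F - 2\<close>.\<close>
      define z where "z = - (?F + 1) / ?P"
      have z: "z * ?P = - (?F + 1)" using \<open>?P \<noteq> 0\<close> by (simp add: z_def)
      have "0 \<le> ?F + 2 * (z * ?P)" using quad[of 1 z] True by (simp add: mult.assoc)
      then have "0 \<le> ?F - 2 * (?F + 1)" unfolding z by simp
      moreover have "0 \<le> ?F" by simp
      moreover have "0 \<le> s - 2 * (s + 1) \<Longrightarrow> 0 \<le> s \<Longrightarrow> False" for s :: real by (smt (verit))
      ultimately show False by blast
    qed
    then show ?thesis using True by simp
  next
    case False
    then have G: "0 < ?G" by (simp add: order_less_le)
    \<comment> \<open>The direction \<open>(s, t) = (?G, - ?P)\<close> is the one that minimises the
      form up to scaling.\<close>
    have "0 \<le> ?G\<^sup>2 * ?F + 2 * ?G * (- ?P) * ?P + (- ?P)\<^sup>2 * ?G" by (rule quad)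
    also have "\<dots> = ?G * (?F * ?G - ?P\<^sup>2)" by (simp add: algebra_simps power2_eq_square)
    finally show ?thesis using G by (simp add: zero_le_mult_iff)
  qed
  then have "\<bar>?P\<bar> \<le> sqrt (?F * ?G)" by (metis real_sqrt_abs real_sqrt_le_iff)
  then show ?thesis by (simp add: l2norm_def real_sqrt_mult)
qed

lemma l2norm_triangle:
  assumes f: "L2_function M f" and g: "L2_function M g"
  shows "l2norm M (\<lambda>x. f x + g x) \<le> l2norm M f + l2norm M g"
proof -
  have "(LINT x|M. (f x + g x)\<^sup>2) = (LINT x|M. (f x)\<^sup>2 + (g x)\<^sup>2 + 2 * (f x * g x))"
    by (simp add: power2_sum mult_ac)
  also have "\<dots> = (LINT x|M. (f x)\<^sup>2) + (LINT x|M. (g x)\<^sup>2) + 2 * (LINT x|M. f x * g x)"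
    using f g L2_mult_integrable[OF f g] by (subst Bochner_Integration.integral_add, auto)+
  also have "\<dots> \<le> (l2norm M f)\<^sup>2 + (l2norm M g)\<^sup>2 + 2 * (l2norm M f * l2norm M g)"
    using L2_Cauchy_Schwarz[OF f g] by (simp add: l2norm_power2)
  also have "\<dots> = (l2norm M f + l2norm M g)\<^sup>2" by (simp add: power2_sum)
  finally have "(l2norm M (\<lambda>x. f x + g x))\<^sup>2 \<le> (l2norm M f + l2norm M g)\<^sup>2" by (simp add: l2norm_power2)
  then show ?thesis by (rule power2_le_imp_le) simp
qed

lemma l2norm_cmult: "l2norm M (\<lambda>x. c * f x) = \<bar>c\<bar> * l2norm M f"
  by (simp add: l2norm_def power_mult_distrib real_sqrt_mult)

lemma l2norm_minus_commute: "l2norm M (\<lambda>x. f x - g x) = l2norm M (\<lambda>x. g x - f x)"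
  by (simp add: l2norm_def power2_commute)

lemma l2norm_triangle_diff:
  assumes f: "L2_function M f" and g: "L2_function M g"
  shows "\<bar>l2norm M f - l2norm M g\<bar> \<le> l2norm M (\<lambda>x. f x - g x)"
  using l2norm_triangle[OF L2_function_diff[OF f g] g] l2norm_triangle[OF L2_function_diff[OF g f] f]
    l2norm_minus_commute[of M f g] by simp

lemma (in prob_space) L2_integrable:
  assumes "L2_function M f"
  shows "integrable M f"
  using L2_mult_integrable[OF assms, of "\<lambda>_. 1"] by (simp add: L2_function_def)

lemma (in prob_space) abs_expectation_le_l2norm:
  assumes "L2_function M f"
  shows "\<bar>expectation f\<bar> \<le> l2norm M f"
  using L2_Cauchy_Schwarz[OF assms, of "\<lambda>_. 1"]
  by (simp add: L2_function_def l2norm_def prob_space)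

text \<open>Writing the law as that of a standard normal variable times the norm absorbs the
  degenerate case, so no later argument has to separate vanishing variances.\<close>

lemma (in prob_space) gaussian_rv_distr:
  assumes "gaussian_rv M Y" and E0: "expectation Y = 0"
  shows "distr M borel Y = distr std_normal_distribution borel (\<lambda>x. l2norm M Y * x)"
proof -
  obtain \<mu> \<sigma> where Ym[measurable]: "Y \<in> borel_measurable M" and s0: "0 \<le> \<sigma>"
    and D: "distr M borel Y = (if \<sigma> = 0 then return borel \<mu>
      else density lborel (\<lambda>x. ennreal (normal_density \<mu> \<sigma> x)))"
    using assms(1) unfolding gaussian_rv_def by blast
  interpret N: prob_space std_normal_distribution
    using prob_space_normal_density[of 1 0] by simp
  show ?thesis
  proof (cases "\<sigma> = 0")
    case True
    then have D': "distr M borel Y = return borel \<mu>" using D by simp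
    have "expectation Y = (LINT x|distr M borel Y. x)" by (simp add: integral_distr)
    then have mu: "\<mu> = 0" using E0 unfolding D' by (simp add: integral_return)
    have "expectation (\<lambda>x. (Y x)\<^sup>2) = (LINT x|distr M borel Y. x\<^sup>2)" by (simp add: integral_distr)
    then have "l2norm M Y = 0" unfolding D' mu l2norm_def by (simp add: integral_return)
    then show ?thesis unfolding D' mu by (simp add: N.distr_const)
  next
    case False
    then have s: "0 < \<sigma>" using s0 by simp
    have D': "distributed M lborel Y (normal_density \<mu> \<sigma>)"
      using D False by (auto simp: distributed_def cong: distr_cong)
    have mu: "\<mu> = 0" using normal_distributed_expectation[OF s D'] E0 by simp
    have "expectation (\<lambda>x. (Y x)\<^sup>2) = \<sigma>\<^sup>2"
      using normal_distributed_variance[OF s D'] E0 by simp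
    then have n: "l2norm M Y = \<sigma>" using s by (simp add: l2norm_def)
    have "distributed M lborel (\<lambda>x. (Y x - \<mu>) / \<sigma>) std_normal_density"
      using D' normal_standard_normal_convert[OF s] by blast
    then have *: "distr M lborel (\<lambda>x. Y x / \<sigma>) = std_normal_distribution"
      unfolding mu by (simp add: distributed_def)
    have "distr (distr M lborel (\<lambda>x. Y x / \<sigma>)) borel (\<lambda>x. \<sigma> * x) = distr M borel Y"
      using s by (subst distr_distr) (auto simp: comp_def)
    then show ?thesis unfolding * n by simp
  qed
qed

lemma (in prob_space) gaussian_rv_integral:
  fixes f :: "real \<Rightarrow> 'b::{banach, second_countable_topology}"
  assumes "gaussian_rv M Y" "expectation Y = 0" and [measurable]: "f \<in> borel_measurable borel"
  shows "(LINT \<omega>|M. f (Y \<omega>)) = (LINT x|std_normal_distribution. f (l2norm M Y * x))"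
    and "integrable M (\<lambda>\<omega>. f (Y \<omega>)) \<longleftrightarrow> integrable std_normal_distribution (\<lambda>x. f (l2norm M Y * x))"
proof -
  have [measurable]: "Y \<in> borel_measurable M" using assms(1) by (simp add: gaussian_rv_def)
  have "(LINT \<omega>|M. f (Y \<omega>)) = (LINT x|distr M borel Y. f x)" by (simp add: integral_distr)
  also have "\<dots> = (LINT x|std_normal_distribution. f (l2norm M Y * x))"
    unfolding gaussian_rv_distr[OF assms(1,2)] by (subst integral_distr) auto
  finally show "(LINT \<omega>|M. f (Y \<omega>)) = (LINT x|std_normal_distribution. f (l2norm M Y * x))" .
  have "integrable M (\<lambda>\<omega>. f (Y \<omega>)) \<longleftrightarrow> integrable (distr M borel Y) f" by (simp add: integrable_distr_eq)
  also have "\<dots> \<longleftrightarrow> integrable std_normal_distribution (\<lambda>x. f (l2norm M Y * x))"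
    unfolding gaussian_rv_distr[OF assms(1,2)] by (subst integrable_distr_eq) auto
  finally show "integrable M (\<lambda>\<omega>. f (Y \<omega>)) \<longleftrightarrow> integrable std_normal_distribution (\<lambda>x. f (l2norm M Y * x))" .
qed

lemma (in prob_space) gaussian_rv_integrable_power:
  assumes "gaussian_rv M Y" "expectation Y = 0"
  shows "integrable M (\<lambda>\<omega>. Y \<omega> ^ k)"
proof -
  have "integrable std_normal_distribution (\<lambda>x. (l2norm M Y) ^ k * x ^ k)"
    by (intro integrable_mult_right integrable_std_normal_distribution_moment)
  then show ?thesis
    using gaussian_rv_integral(2)[OF assms, of "\<lambda>x. x ^ k"] by (simp add: power_mult_distrib)
qed

lemma (in prob_space) gaussian_rv_L2:
  assumes "gaussian_rv M Y" "expectation Y = 0"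
  shows "L2_function M Y"
  using assms gaussian_rv_integrable_power[OF assms, of 2] by (simp add: L2_function_def gaussian_rv_def)

lemma (in prob_space) gaussian_rv_iexp:
  assumes "gaussian_rv M Y" "expectation Y = 0"
  shows "(CLINT \<omega>|M. iexp (Y \<omega>)) = of_real (exp (- (l2norm M Y)\<^sup>2 / 2))"
proof -
  have "(CLINT \<omega>|M. iexp (Y \<omega>)) = (CLINT x|std_normal_distribution. iexp (l2norm M Y * x))"
    by (rule gaussian_rv_integral(1)[OF assms]) simp
  also have "\<dots> = char std_normal_distribution (l2norm M Y)"
    by (simp add: char_def)
  finally show ?thesis by (simp add: char_std_normal_distribution)
qed

section \<open>Independence from factorising characteristic functions\<close>

lemma (in prob_space) weighted_measure_eq:
  assumes [measurable]: "X \<in> borel_measurable M" "g \<in> borel_measurable M" "B \<in> sets borel"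
    and bd: "\<And>\<omega>. 0 \<le> g \<omega>" "\<And>\<omega>. g \<omega> \<le> K" and pos: "0 < expectation g"
    and eq: "\<And>u. (CLINT \<omega>|M. of_real (g \<omega>) * iexp (u * X \<omega>)) = of_real (expectation g) * (CLINT \<omega>|M. iexp (u * X \<omega>))"
  shows "expectation (\<lambda>\<omega>. g \<omega> * indicator B (X \<omega>)) = expectation g * expectation (\<lambda>\<omega>. indicator B (X \<omega>))"
proof -
  let ?c = "expectation g"
  have gi: "integrable M g"
    by (rule integrable_const_bound[of _ K]) (use bd in auto)
  \<comment> \<open>Change of measure with density proportional to \<open>g\<close>. The assumption
    on the weighted integrals says that \<open>X\<close> has the same characteristic function under
    both measures, hence the same law.\<close>
  define N where "N = density M (\<lambda>\<omega>. ennreal (g \<omega> / ?c))"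
  have Ns[measurable_cong, simp]: "sets N = sets M" by (simp add: N_def)
  have "emeasure N (space N) = (\<integral>\<^sup>+\<omega>. ennreal (g \<omega> / ?c) \<partial>M)"
    by (simp add: N_def emeasure_density cong: nn_integral_cong)
  also have "\<dots> = ennreal (expectation (\<lambda>\<omega>. g \<omega> / ?c))"
    using gi bd pos by (intro nn_integral_eq_integral) auto
  also have "\<dots> = 1" using pos by simp
  finally interpret N: prob_space N by (rule prob_spaceI)
  have Nint: "(LINT \<omega>|N. f \<omega>) = (LINT \<omega>|M. (g \<omega> / ?c) *\<^sub>R f \<omega>)" if "f \<in> borel_measurable M"
    for f :: "'a \<Rightarrow> 'b::{banach, second_countable_topology}"
    unfolding N_def using that bd pos by (intro integral_density) auto
  have XN: "X \<in> borel_measurable N" by simp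
  have "distr N borel X = distr M borel X"
  proof (rule Levy_uniqueness)
    show "real_distribution (distr N borel X)" using XN by (intro N.real_distribution_distr)
    show "real_distribution (distr M borel X)" by simp
    show "char (distr N borel X) = char (distr M borel X)"
    proof
      fix u
      have "char (distr N borel X) u = (CLINT \<omega>|N. iexp (u * X \<omega>))"
        by (simp add: char_def integral_distr)
      also have "\<dots> = (CLINT \<omega>|M. (g \<omega> / ?c) *\<^sub>R iexp (u * X \<omega>))" by (rule Nint) simp
      also have "\<dots> = (CLINT \<omega>|M. of_real (1 / ?c) * (of_real (g \<omega>) * iexp (u * X \<omega>)))"
        by (simp add: scaleR_conv_of_real)
      also have "\<dots> = of_real (1 / ?c) * (of_real ?c * (CLINT \<omega>|M. iexp (u * X \<omega>)))"
        by (simp only: integral_mult_right_zero eq)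
      also have "\<dots> = (CLINT \<omega>|M. iexp (u * X \<omega>))" using pos by simp
      also have "\<dots> = char (distr M borel X) u" by (simp add: char_def integral_distr)
      finally show "char (distr N borel X) u = char (distr M borel X) u" .
    qed
  qed
  then have "(LINT x|distr N borel X. indicator B x) = (LINT x|distr M borel X. indicator B x :: real)" by simp
  moreover have "(LINT x|distr N borel X. indicator B x) = (LINT \<omega>|N. indicator B (X \<omega>) :: real)"
    by (rule integral_distr) auto
  moreover have "(LINT x|distr M borel X. indicator B x) = (LINT \<omega>|M. indicator B (X \<omega>) :: real)"
    by (rule integral_distr) auto
  moreover have "(LINT \<omega>|N. indicator B (X \<omega>)) = (LINT \<omega>|M. (g \<omega> / ?c) *\<^sub>R (indicator B (X \<omega>) :: real))"
    by (rule Nint) simp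
  moreover have "(LINT \<omega>|M. (g \<omega> / ?c) *\<^sub>R (indicator B (X \<omega>) :: real)) = (LINT \<omega>|M. g \<omega> * indicator B (X \<omega>)) / ?c"
    by simp
  ultimately show ?thesis using pos by (simp add: field_simps)
qed

lemma iexp_cos_sin: "iexp x = of_real (cos x) + \<i> * of_real (sin x)"
  by (simp add: cis_conv_exp[symmetric] complex_eq_iff)

text \<open>
  The bivariate statement is reduced to the one-dimensional uniqueness theorem by using it
  twice: first for the law of \<open>X\<close> weighted with \<open>2 + cos (v W + \<theta>)\<close>, which is positive, and
  then for the law of \<open>W\<close> conditioned on an event of \<open>X\<close>.
\<close>

lemma (in prob_space) indep_var_char:
  assumes [measurable]: "X \<in> borel_measurable M" "W \<in> borel_measurable M"
    and fact: "\<And>u v. (CLINT \<omega>|M. iexp (u * X \<omega> + v * W \<omega>))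
      = (CLINT \<omega>|M. iexp (u * X \<omega>)) * (CLINT \<omega>|M. iexp (v * W \<omega>))"
  shows "indep_var borel X borel W"
proof -
  have ic: "integrable M (\<lambda>\<omega>. iexp (u * X \<omega> + v * W \<omega>))" for u v by (rule integrable_iexp) simp_all
  have ix: "integrable M (\<lambda>\<omega>. iexp (u * X \<omega>))" for u by (rule integrable_iexp) simp_all
  have iw: "integrable M (\<lambda>\<omega>. iexp (v * W \<omega>))" for v by (rule integrable_iexp) simp_all
  have icos: "integrable M (\<lambda>\<omega>. cos (v * W \<omega>))" for v
    by (rule integrable_const_bound[of _ 1]) auto
  have isin: "integrable M (\<lambda>\<omega>. sin (v * W \<omega>))" for v
    by (rule integrable_const_bound[of _ 1]) auto
  have iwc: "(CLINT \<omega>|M. iexp (v * W \<omega>)) = of_real (expectation (\<lambda>\<omega>. cos (v * W \<omega>))) + \<i> * of_real (expectation (\<lambda>\<omega>. sin (v * W \<omega>)))" for v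
  proof -
    have "(CLINT \<omega>|M. iexp (v * W \<omega>)) = (CLINT \<omega>|M. of_real (cos (v * W \<omega>)) + \<i> * of_real (sin (v * W \<omega>)))"
      by (simp only: iexp_cos_sin)
    also have "\<dots> = (CLINT \<omega>|M. of_real (cos (v * W \<omega>))) + (CLINT \<omega>|M. \<i> * of_real (sin (v * W \<omega>)))"
      using icos isin by (intro Bochner_Integration.integral_add integrable_mult_right integrable_of_real) auto
    finally show ?thesis by simp
  qed
  \<comment> \<open>A cosine is an average of two exponentials, so this follows from the
    factorisation at \<open>v\<close> and at \<open>- v\<close>. The phase covers both cases of
    interest: \<theta> = 0 gives the cosine, and \<theta> = - pi / 2 gives the sine.\<close>
  have cosX: "(CLINT \<omega>|M. of_real (cos (v * W \<omega> + \<theta>)) * iexp (u * X \<omega>))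
      = of_real (expectation (\<lambda>\<omega>. cos (v * W \<omega> + \<theta>))) * (CLINT \<omega>|M. iexp (u * X \<omega>))" for u v \<theta>
  proof -
    have c2: "complex_of_real (cos (x + \<theta>)) = (iexp \<theta> * iexp x + iexp (- \<theta>) * iexp (- x)) / 2" for x
      by (simp only: iexp_cos_sin) (simp add: cos_add complex_eq_iff)
    have split: "of_real (cos (v * W \<omega> + \<theta>)) * iexp (u * X \<omega>)
        = (iexp \<theta> * iexp (u * X \<omega> + v * W \<omega>) + iexp (- \<theta>) * iexp (u * X \<omega> + (-v) * W \<omega>)) / 2" for \<omega>
    proof -
      have "iexp (u * X \<omega> + v * W \<omega>) = iexp (u * X \<omega>) * iexp (v * W \<omega>)"
        "iexp (u * X \<omega> + (-v) * W \<omega>) = iexp (u * X \<omega>) * iexp (- (v * W \<omega>))"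
        by (simp_all add: ring_distribs flip: exp_add)
      then show ?thesis unfolding c2 by (simp only: distrib_left add_divide_distrib times_divide_eq_left times_divide_eq_right mult_ac)
    qed
    have i2: "integrable M (\<lambda>\<omega>. z * iexp (u * X \<omega> + w * W \<omega>))" for z w by (rule integrable_mult_right[OF ic])
    have int: "(CLINT \<omega>|M. of_real (cos (v * W \<omega> + \<theta>)) * iexp (u * X \<omega>))
       = (iexp \<theta> * (CLINT \<omega>|M. iexp (u * X \<omega> + v * W \<omega>)) + iexp (- \<theta>) * (CLINT \<omega>|M. iexp (u * X \<omega> + (-v) * W \<omega>))) / 2"
      unfolding split integral_divide_zero Bochner_Integration.integral_add[OF i2 i2] integral_mult_right_zero ..
    have iW: "integrable M (\<lambda>\<omega>. z * iexp (w * W \<omega>))" for z w by (rule integrable_mult_right[OF iw])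
    have "of_real (expectation (\<lambda>\<omega>. cos (v * W \<omega> + \<theta>))) = (CLINT \<omega>|M. (iexp \<theta> * iexp (v * W \<omega>) + iexp (- \<theta>) * iexp ((-v) * W \<omega>)) / 2)"
      unfolding integral_complex_of_real[symmetric] c2 by simp
    also have "\<dots> = (iexp \<theta> * (CLINT \<omega>|M. iexp (v * W \<omega>)) + iexp (- \<theta>) * (CLINT \<omega>|M. iexp ((-v) * W \<omega>))) / 2"
      unfolding integral_divide_zero Bochner_Integration.integral_add[OF iW iW] integral_mult_right_zero ..
    finally show ?thesis unfolding int fact
      by (simp only: distrib_left distrib_right add_divide_distrib times_divide_eq_left times_divide_eq_right mult_ac)
  qed
  have cos_shift: "cos (x + - pi / 2) = sin x" for x by (simp add: cos_diff)
  have shift: "expectation (\<lambda>\<omega>. f \<omega> * indicator B (X \<omega>)) = expectation f * expectation (\<lambda>\<omega>. indicator B (X \<omega>))"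
    if [measurable]: "f \<in> borel_measurable M" and f1: "\<And>\<omega>. \<bar>f \<omega>\<bar> \<le> 1" and [measurable]: "B \<in> sets borel"
      and feq: "\<And>u. (CLINT \<omega>|M. of_real (f \<omega>) * iexp (u * X \<omega>)) = of_real (expectation f) * (CLINT \<omega>|M. iexp (u * X \<omega>))"
    for f B
  proof -
    have fi: "integrable M f" by (rule integrable_const_bound[of _ 1]) (use f1 in auto)
    have fB: "integrable M (\<lambda>\<omega>. f \<omega> * indicator B (X \<omega>))"
      by (rule integrable_const_bound[of _ 1]) (use f1 in \<open>auto simp: indicator_def\<close>)
    have iB: "integrable M (\<lambda>\<omega>. indicator B (X \<omega>) :: real)"
      by (rule integrable_const_bound[of _ 1]) auto
    have fX: "integrable M (\<lambda>\<omega>. of_real (f \<omega>) * iexp (u * X \<omega>))" for u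
      by (rule integrable_const_bound[of _ 1]) (use f1 in \<open>auto simp: norm_mult\<close>)
    have E: "expectation (\<lambda>\<omega>. 2 + f \<omega>) = 2 + expectation f"
      using fi by (simp add: prob_space)
    have "\<bar>expectation f\<bar> \<le> 1"
    proof -
      have "\<bar>expectation f\<bar> \<le> expectation (\<lambda>\<omega>. \<bar>f \<omega>\<bar>)" by (rule integral_abs_bound)
      also have "\<dots> \<le> expectation (\<lambda>\<omega>. 1)" using f1 fi by (intro integral_mono) auto
      finally show ?thesis by (simp add: prob_space)
    qed
    then have pos: "0 < expectation (\<lambda>\<omega>. 2 + f \<omega>)" unfolding E by linarith
    have "expectation (\<lambda>\<omega>. (2 + f \<omega>) * indicator B (X \<omega>)) = expectation (\<lambda>\<omega>. 2 + f \<omega>) * expectation (\<lambda>\<omega>. indicator B (X \<omega>))"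
    proof (rule weighted_measure_eq[where K=3])
      show "0 \<le> 2 + f \<omega>" "2 + f \<omega> \<le> 3" for \<omega> using f1[of \<omega>] by auto
      show "(CLINT \<omega>|M. of_real (2 + f \<omega>) * iexp (u * X \<omega>)) = of_real (expectation (\<lambda>\<omega>. 2 + f \<omega>)) * (CLINT \<omega>|M. iexp (u * X \<omega>))" for u
        unfolding E using fX ix feq by (simp add: ring_distribs)
    qed (use pos in auto)
    then show ?thesis unfolding E using fB iB by (simp add: ring_distribs)
  qed
  have BW: "(CLINT \<omega>|M. of_real (indicator B (X \<omega>)) * iexp (v * W \<omega>)) = of_real (expectation (\<lambda>\<omega>. indicator B (X \<omega>))) * (CLINT \<omega>|M. iexp (v * W \<omega>))"
    if [measurable]: "B \<in> sets borel" for B v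
  proof -
    have c: "expectation (\<lambda>\<omega>. cos (v * W \<omega>) * indicator B (X \<omega>)) = expectation (\<lambda>\<omega>. cos (v * W \<omega>)) * expectation (\<lambda>\<omega>. indicator B (X \<omega>))"
      by (rule shift) (use cosX[of v 0] in auto)
    have s: "expectation (\<lambda>\<omega>. sin (v * W \<omega>) * indicator B (X \<omega>)) = expectation (\<lambda>\<omega>. sin (v * W \<omega>)) * expectation (\<lambda>\<omega>. indicator B (X \<omega>))"
      by (rule shift) (use cosX[of v "- pi / 2", unfolded cos_shift] in auto)
    have i1: "integrable M (\<lambda>\<omega>. cos (v * W \<omega>) * indicator B (X \<omega>))"
      by (rule integrable_const_bound[of _ 1]) (auto simp: indicator_def)
    have i2: "integrable M (\<lambda>\<omega>. sin (v * W \<omega>) * indicator B (X \<omega>))"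
      by (rule integrable_const_bound[of _ 1]) (auto simp: indicator_def)
    have "(\<lambda>\<omega>. of_real (indicator B (X \<omega>)) * iexp (v * W \<omega>)) = (\<lambda>\<omega>. of_real (cos (v * W \<omega>) * indicator B (X \<omega>)) + \<i> * of_real (sin (v * W \<omega>) * indicator B (X \<omega>)))"
      by (simp only: iexp_cos_sin) (auto simp: fun_eq_iff indicator_def)
    then have "(CLINT \<omega>|M. of_real (indicator B (X \<omega>)) * iexp (v * W \<omega>)) =
      (CLINT \<omega>|M. of_real (cos (v * W \<omega>) * indicator B (X \<omega>))) + (CLINT \<omega>|M. \<i> * of_real (sin (v * W \<omega>) * indicator B (X \<omega>)))"
      using i1 i2 by (simp only:) (intro Bochner_Integration.integral_add integrable_mult_right integrable_of_real, auto)
    also have "\<dots> = of_real (expectation (\<lambda>\<omega>. cos (v * W \<omega>) * indicator B (X \<omega>))) + \<i> * of_real (expectation (\<lambda>\<omega>. sin (v * W \<omega>) * indicator B (X \<omega>)))"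
      by (simp only: integral_mult_right_zero integral_complex_of_real)
    finally show ?thesis unfolding c s iwc by (simp add: ring_distribs)
  qed
  have prod: "expectation (\<lambda>\<omega>. indicator B (X \<omega>) * indicator C (W \<omega>)) = expectation (\<lambda>\<omega>. indicator B (X \<omega>)) * expectation (\<lambda>\<omega>. indicator C (W \<omega>) :: real)"
    if [measurable]: "B \<in> sets borel" "C \<in> sets borel" for B C
  \<comment> \<open>Conditioning on the event that \<open>X\<close> lies in \<open>B\<close> needs
    positive probability; otherwise both sides vanish.\<close>
  proof (cases "expectation (\<lambda>\<omega>. indicator B (X \<omega>) :: real) = 0")
    case False
    then have pos: "0 < expectation (\<lambda>\<omega>. indicator B (X \<omega>) :: real)"
      by (simp add: order_less_le)
    show ?thesis
      by (rule weighted_measure_eq[where K=1]) (use BW pos in \<open>auto simp: indicator_def\<close>)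
  next
    case True
    have "expectation (\<lambda>\<omega>. indicator B (X \<omega>) * indicator C (W \<omega>)) \<le> expectation (\<lambda>\<omega>. indicator B (X \<omega>) :: real)"
    proof (rule integral_mono)
      show "integrable M (\<lambda>\<omega>. indicator B (X \<omega>) * indicator C (W \<omega>) :: real)"
        by (rule integrable_const_bound[of _ 1]) (auto simp: indicator_def)
      show "integrable M (\<lambda>\<omega>. indicator B (X \<omega>) :: real)"
        by (rule integrable_const_bound[of _ 1]) auto
    qed (auto simp: indicator_def)
    moreover have "0 \<le> expectation (\<lambda>\<omega>. indicator B (X \<omega>) * indicator C (W \<omega>) :: real)" by simp
    ultimately show ?thesis using True by simp
  qed
  interpret X: prob_space "distr M borel X" by (rule prob_space_distr) simp
  interpret W: prob_space "distr M borel W" by (rule prob_space_distr) simp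
  have mP: "expectation (\<lambda>\<omega>. indicator B (Y \<omega>)) = prob (Y -` B \<inter> space M)" for B and Y :: "'a \<Rightarrow> 'c"
  proof -
    have "expectation (\<lambda>\<omega>. indicator B (Y \<omega>)) = expectation (\<lambda>\<omega>. indicator (Y -` B \<inter> space M) \<omega> :: real)"
      by (intro Bochner_Integration.integral_cong) (auto simp: indicator_def)
    then show ?thesis by simp
  qed
  show ?thesis unfolding indep_var_distribution_eq
  proof (intro conjI)
    show "distr M borel X \<Otimes>\<^sub>M distr M borel W = distr M (borel \<Otimes>\<^sub>M borel) (\<lambda>x. (X x, W x))"
    proof (rule pair_measure_eqI)
      fix A B assume "A \<in> sets (distr M borel X)" "B \<in> sets (distr M borel W)"
      then have [measurable]: "A \<in> sets borel" "B \<in> sets borel" by auto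
      have "prob ((\<lambda>x. (X x, W x)) -` (A \<times> B) \<inter> space M) = prob (X -` A \<inter> space M) * prob (W -` B \<inter> space M)"
        using prod[of A B] by (simp add: mP[symmetric] indicator_times)
      then show "emeasure (distr M borel X) A * emeasure (distr M borel W) B = emeasure (distr M (borel \<Otimes>\<^sub>M borel) (\<lambda>x. (X x, W x))) (A \<times> B)"
        by (simp add: emeasure_distr emeasure_eq_measure ennreal_mult[symmetric])
    qed (auto intro: X.sigma_finite_measure_axioms W.sigma_finite_measure_axioms sets_pair_measure_cong)
  qed auto
qed

section \<open>Jointly Gaussian pairs and Hermite polynomials\<close>

text \<open>Encoded by linear combinations instead of a bivariate density, so that singular pairs
  such as a variable with itself are included; the Hermite computations below rely on them.\<close>

definition (in prob_space) gaussian_pair :: "('a \<Rightarrow> real) \<Rightarrow> ('a \<Rightarrow> real) \<Rightarrow> bool" where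
  "gaussian_pair X Y \<longleftrightarrow> (\<forall>u v. gaussian_rv M (\<lambda>\<omega>. u * X \<omega> + v * Y \<omega>)) \<and>
     expectation X = 0 \<and> expectation Y = 0"

context prob_space
begin

lemma gaussian_pairD:
  assumes "gaussian_pair X Y"
  shows "gaussian_rv M X" "gaussian_rv M Y" "expectation X = 0" "expectation Y = 0"
    "L2_function M X" "L2_function M Y" "random_variable borel X" "random_variable borel Y"
proof -
  have c: "gaussian_rv M (\<lambda>\<omega>. u * X \<omega> + v * Y \<omega>)" for u v using assms by (simp add: gaussian_pair_def)
  show g: "gaussian_rv M X" "gaussian_rv M Y" using c[of 1 0] c[of 0 1] by auto
  show e: "expectation X = 0" "expectation Y = 0" using assms by (auto simp: gaussian_pair_def)
  show "L2_function M X" "L2_function M Y" using gaussian_rv_L2 g e by auto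
  then show "random_variable borel X" "random_variable borel Y" by auto
qed

lemma gaussian_pair_linear:
  assumes "gaussian_pair X Y"
  shows "gaussian_pair (\<lambda>\<omega>. a * X \<omega> + b * Y \<omega>) (\<lambda>\<omega>. c * X \<omega> + d * Y \<omega>)"
proof -
  note X = gaussian_pairD[OF assms]
  have "gaussian_rv M (\<lambda>\<omega>. (u * a + v * c) * X \<omega> + (u * b + v * d) * Y \<omega>)" for u v
    using assms by (simp add: gaussian_pair_def)
  moreover have "(\<lambda>\<omega>. (u * a + v * c) * X \<omega> + (u * b + v * d) * Y \<omega>) =
      (\<lambda>\<omega>. u * (a * X \<omega> + b * Y \<omega>) + v * (c * X \<omega> + d * Y \<omega>))" for u v
    by (simp add: algebra_simps)
  ultimately show ?thesis
    using X(3,4) L2_integrable[OF X(5)] L2_integrable[OF X(6)] by (simp add: gaussian_pair_def)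
qed

text \<open>The characteristic function of a centred Gaussian variable depends on the variance
  alone, and without the cross term the variance of \<open>u * X + v * W\<close> is
  additive.\<close>

lemma gaussian_pair_uncorrelated_indep:
  assumes P: "gaussian_pair X W" and un: "expectation (\<lambda>\<omega>. X \<omega> * W \<omega>) = 0"
  shows "indep_var borel X borel W"
proof (rule indep_var_char)
  note X = gaussian_pairD[OF P]
  show "random_variable borel X" "random_variable borel W" by fact+
  fix u v
  have G: "gaussian_rv M (\<lambda>\<omega>. u * X \<omega> + v * W \<omega>)" for u v using P by (simp add: gaussian_pair_def)
  have E0: "expectation (\<lambda>\<omega>. u * X \<omega> + v * W \<omega>) = 0" for u v
    using X(3,4) L2_integrable[OF X(5)] L2_integrable[OF X(6)] by simp
  have sq: "(l2norm M (\<lambda>\<omega>. u * X \<omega> + v * W \<omega>))\<^sup>2 = u\<^sup>2 * (l2norm M X)\<^sup>2 + v\<^sup>2 * (l2norm M W)\<^sup>2" for u v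
  proof -
    have "(\<lambda>\<omega>. (u * X \<omega> + v * W \<omega>)\<^sup>2) = (\<lambda>\<omega>. u\<^sup>2 * (X \<omega>)\<^sup>2 + 2 * u * v * (X \<omega> * W \<omega>) + v\<^sup>2 * (W \<omega>)\<^sup>2)"
      by (auto simp: power2_sum power_mult_distrib algebra_simps)
    then show ?thesis
      using X(5,6) L2_mult_integrable[OF X(5,6)] un unfolding l2norm_power2
      by (auto simp: L2_function_def)
  qed
  have "(CLINT \<omega>|M. iexp (u * X \<omega> + v * W \<omega>)) = of_real (exp (- (u\<^sup>2 * (l2norm M X)\<^sup>2 + v\<^sup>2 * (l2norm M W)\<^sup>2) / 2))"
    using gaussian_rv_iexp[OF G E0] unfolding sq .
  also have "\<dots> = of_real (exp (- (u\<^sup>2 * (l2norm M X)\<^sup>2) / 2)) * of_real (exp (- (v\<^sup>2 * (l2norm M W)\<^sup>2) / 2))"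
    by (simp add: exp_add[symmetric] add_divide_distrib flip: of_real_mult)
  also have "of_real (exp (- (u\<^sup>2 * (l2norm M X)\<^sup>2) / 2)) = (CLINT \<omega>|M. iexp (u * X \<omega>))"
    using gaussian_rv_iexp[OF G E0, of u 0] sq[of u 0] by simp
  also have "of_real (exp (- (v\<^sup>2 * (l2norm M W)\<^sup>2) / 2)) = (CLINT \<omega>|M. iexp (v * W \<omega>))"
    using gaussian_rv_iexp[OF G E0, of 0 v] sq[of 0 v] by simp
  finally show "(CLINT \<omega>|M. iexp (u * X \<omega> + v * W \<omega>)) = (CLINT \<omega>|M. iexp (u * X \<omega>)) * (CLINT \<omega>|M. iexp (v * W \<omega>))" .
qed

text \<open>Linear regression of \<open>Y\<close> on \<open>X\<close>. It reduces every later
  statement about a correlated pair to the independent pair \<open>X\<close>, \<open>W\<close>, with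
  \<open>Y = r * X + W\<close>.\<close>

lemma gaussian_pair_residual:
  assumes P: "gaussian_pair X Y" and X1: "l2norm M X = 1" and r: "r = expectation (\<lambda>\<omega>. X \<omega> * Y \<omega>)"
  shows "indep_var borel X borel (\<lambda>\<omega>. Y \<omega> - r * X \<omega>)"
proof (rule gaussian_pair_uncorrelated_indep)
  note X = gaussian_pairD[OF P]
  show "gaussian_pair X (\<lambda>\<omega>. Y \<omega> - r * X \<omega>)"
    using gaussian_pair_linear[OF P, of 1 0 "-r" 1] by simp
  have "(\<lambda>\<omega>. X \<omega> * (Y \<omega> - r * X \<omega>)) = (\<lambda>\<omega>. X \<omega> * Y \<omega> - r * (X \<omega>)\<^sup>2)"
    by (auto simp: algebra_simps power2_eq_square)
  moreover have "expectation (\<lambda>\<omega>. (X \<omega>)\<^sup>2) = 1" using X1 l2norm_power2[of M X] by simp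
  ultimately show "expectation (\<lambda>\<omega>. X \<omega> * (Y \<omega> - r * X \<omega>)) = 0"
    using X(5) L2_mult_integrable[OF X(5,6)] r by (auto simp: L2_function_def)
qed

text \<open>Replacing \<open>Y\<close> by the residual \<open>W\<close> inside \<open>g\<close>
  costs at most \<open>\<bar>r\<bar> * \<bar>X\<bar>\<close>, of mean at most
  \<open>\<bar>r\<bar>\<close>. This is paid once to reach independence and once to return from
  \<open>W\<close> to \<open>Y\<close>, whence the factor 2.\<close>

lemma gaussian_pair_Lipschitz_covariance:
  fixes f g :: "real \<Rightarrow> real"
  assumes P: "gaussian_pair X Y" and X1: "l2norm M X = 1"
    and [measurable]: "f \<in> borel_measurable borel" "g \<in> borel_measurable borel"
    and f01: "\<And>x. 0 \<le> f x" "\<And>x. f x \<le> 1" and g01: "\<And>x. 0 \<le> g x" "\<And>x. g x \<le> 1"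
    and lip: "\<And>x y. \<bar>g x - g y\<bar> \<le> \<bar>x - y\<bar>"
  shows "expectation (\<lambda>\<omega>. f (X \<omega>) * g (Y \<omega>)) \<le> expectation (\<lambda>\<omega>. f (X \<omega>)) * expectation (\<lambda>\<omega>. g (Y \<omega>))
     + 2 * \<bar>expectation (\<lambda>\<omega>. X \<omega> * Y \<omega>)\<bar>"
proof -
  note X = gaussian_pairD[OF P]
  note [measurable] = X(7,8)
  define r where "r = expectation (\<lambda>\<omega>. X \<omega> * Y \<omega>)"
  define W where "W \<omega> = Y \<omega> - r * X \<omega>" for \<omega>
  have [measurable]: "W \<in> borel_measurable M" unfolding W_def by measurable
  have ind: "indep_var borel X borel W"
    unfolding W_def by (rule gaussian_pair_residual[OF P X1 r_def])
  have bint: "integrable M h" if "h \<in> borel_measurable M" "\<And>\<omega>. 0 \<le> h \<omega> \<and> h \<omega> \<le> 1" for h :: "'a \<Rightarrow> real"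
    by (rule integrable_const_bound[of _ 1]) (use that in auto)
  have i1: "integrable M (\<lambda>\<omega>. f (X \<omega>))" "integrable M (\<lambda>\<omega>. g (Y \<omega>))" "integrable M (\<lambda>\<omega>. g (W \<omega>))"
    "integrable M (\<lambda>\<omega>. f (X \<omega>) * g (Y \<omega>))" "integrable M (\<lambda>\<omega>. f (X \<omega>) * g (W \<omega>))"
    by (rule bint; use f01 g01 in \<open>auto intro: mult_le_one\<close>)+
  have iX: "integrable M (\<lambda>\<omega>. \<bar>X \<omega>\<bar>)" using L2_integrable[OF X(5)] by simp
  have EX: "expectation (\<lambda>\<omega>. \<bar>X \<omega>\<bar>) \<le> 1"
    using abs_expectation_le_l2norm[of "\<lambda>\<omega>. \<bar>X \<omega>\<bar>"] X(5) X1
    by (simp add: L2_function_def l2norm_def)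
  have gd: "\<bar>g (Y \<omega>) - g (W \<omega>)\<bar> \<le> \<bar>r\<bar> * \<bar>X \<omega>\<bar>" for \<omega>
    using lip[of "Y \<omega>" "W \<omega>"] by (simp add: W_def abs_mult)
  have "expectation (\<lambda>\<omega>. f (X \<omega>) * g (Y \<omega>)) \<le> expectation (\<lambda>\<omega>. f (X \<omega>) * g (W \<omega>) + \<bar>r\<bar> * \<bar>X \<omega>\<bar>)"
  proof (rule integral_mono)
    fix \<omega>
    have "f (X \<omega>) * (g (Y \<omega>) - g (W \<omega>)) \<le> 1 * (\<bar>r\<bar> * \<bar>X \<omega>\<bar>)"
    proof (rule order_trans[OF abs_ge_self])
      show "\<bar>f (X \<omega>) * (g (Y \<omega>) - g (W \<omega>))\<bar> \<le> 1 * (\<bar>r\<bar> * \<bar>X \<omega>\<bar>)"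
        unfolding abs_mult by (rule mult_mono) (use f01[of "X \<omega>"] gd[of \<omega>] in auto)
    qed
    then show "f (X \<omega>) * g (Y \<omega>) \<le> f (X \<omega>) * g (W \<omega>) + \<bar>r\<bar> * \<bar>X \<omega>\<bar>" by (simp add: algebra_simps)
  qed (use i1 iX in auto)
  also have "\<dots> = expectation (\<lambda>\<omega>. f (X \<omega>) * g (W \<omega>)) + \<bar>r\<bar> * expectation (\<lambda>\<omega>. \<bar>X \<omega>\<bar>)"
    using i1 iX by simp
  also have "\<dots> \<le> expectation (\<lambda>\<omega>. f (X \<omega>) * g (W \<omega>)) + \<bar>r\<bar>"
    using EX by (simp add: mult_left_le)
  also have "expectation (\<lambda>\<omega>. f (X \<omega>) * g (W \<omega>)) = expectation (\<lambda>\<omega>. f (X \<omega>)) * expectation (\<lambda>\<omega>. g (W \<omega>))"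
    using indep_var_compose[OF ind, of f borel g borel] i1 unfolding comp_def
    by (intro indep_var_lebesgue_integral) auto
  also have "expectation (\<lambda>\<omega>. f (X \<omega>)) * expectation (\<lambda>\<omega>. g (W \<omega>)) \<le> expectation (\<lambda>\<omega>. f (X \<omega>)) * (expectation (\<lambda>\<omega>. g (Y \<omega>)) + \<bar>r\<bar>)"
  proof (rule mult_left_mono)
    have "expectation (\<lambda>\<omega>. g (W \<omega>)) \<le> expectation (\<lambda>\<omega>. g (Y \<omega>) + \<bar>r\<bar> * \<bar>X \<omega>\<bar>)"
    proof (rule integral_mono)
      fix \<omega> show "g (W \<omega>) \<le> g (Y \<omega>) + \<bar>r\<bar> * \<bar>X \<omega>\<bar>" using gd[of \<omega>] by linarith
    qed (use i1 iX in auto)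
    also have "\<dots> = expectation (\<lambda>\<omega>. g (Y \<omega>)) + \<bar>r\<bar> * expectation (\<lambda>\<omega>. \<bar>X \<omega>\<bar>)" using i1 iX by simp
    also have "\<dots> \<le> expectation (\<lambda>\<omega>. g (Y \<omega>)) + \<bar>r\<bar>" using EX by (simp add: mult_left_le)
    finally show "expectation (\<lambda>\<omega>. g (W \<omega>)) \<le> expectation (\<lambda>\<omega>. g (Y \<omega>)) + \<bar>r\<bar>" .
    show "0 \<le> expectation (\<lambda>\<omega>. f (X \<omega>))" using f01 by simp
  qed
  also have "expectation (\<lambda>\<omega>. f (X \<omega>)) * (expectation (\<lambda>\<omega>. g (Y \<omega>)) + \<bar>r\<bar>) + \<bar>r\<bar>
      \<le> expectation (\<lambda>\<omega>. f (X \<omega>)) * expectation (\<lambda>\<omega>. g (Y \<omega>)) + 2 * \<bar>r\<bar>"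
  proof -
    have "expectation (\<lambda>\<omega>. f (X \<omega>)) \<le> expectation (\<lambda>\<omega>. 1)" using i1 f01 by (intro integral_mono) auto
    then have "expectation (\<lambda>\<omega>. f (X \<omega>)) * \<bar>r\<bar> \<le> 1 * \<bar>r\<bar>" by (intro mult_right_mono) (auto simp: prob_space)
    then show ?thesis by (simp add: algebra_simps)
  qed
  finally show ?thesis unfolding r_def by simp
qed

end

section \<open>Hermite polynomials and Gaussian integration by parts\<close>

primrec hermite_poly :: "nat \<Rightarrow> real poly" where
  "hermite_poly 0 = 1"
| "hermite_poly (Suc q) = [:0, 1:] * hermite_poly q - pderiv (hermite_poly q)"

lemma hermite_eq_poly: "hermite q = poly (hermite_poly q)"
proof -
  have *: "(deriv ^^ q) (\<lambda>y. exp (- y\<^sup>2 / 2)) = (\<lambda>x. (-1) ^ q * poly (hermite_poly q) x * exp (- x\<^sup>2 / 2 :: real))"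
  proof (induction q)
    case (Suc q)
    have "deriv (\<lambda>x. (-1) ^ q * poly (hermite_poly q) x * exp (- x\<^sup>2 / 2 :: real)) x
       = (-1) ^ Suc q * poly (hermite_poly (Suc q)) x * exp (- x\<^sup>2 / 2)" for x
      by (rule DERIV_imp_deriv) (auto intro!: derivative_eq_intros poly_DERIV simp: algebra_simps)
    then show ?case using Suc by auto
  qed simp
  show ?thesis
  proof
    fix x :: real
    have "hermite q x = ((-1) ^ q * (-1) ^ q) * (exp (x\<^sup>2 / 2) * exp (- x\<^sup>2 / 2)) * poly (hermite_poly q) x"
      by (simp only: hermite_def * mult_ac)
    also have "(-1) ^ q * (-1) ^ q = (1::real)" by (simp flip: power_mult_distrib)
    also have "exp (x\<^sup>2 / 2) * exp (- x\<^sup>2 / 2) = 1" by (simp flip: exp_add)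
    finally show "hermite q x = poly (hermite_poly q) x" by simp
  qed
qed

lemma pderiv_hermite_poly_Suc: "pderiv (hermite_poly (Suc q)) = smult (real (Suc q)) (hermite_poly q)"
proof (induction q)
  case 0
  then show ?case by (simp add: pderiv_pCons)
next
  case (Suc q)
  let ?h = "hermite_poly"
  have "pderiv (?h (Suc (Suc q))) = ?h (Suc q) + [:0, 1:] * pderiv (?h (Suc q)) - pderiv (pderiv (?h (Suc q)))"
    by (simp only: hermite_poly.simps(2)[of "Suc q"] pderiv_diff pderiv_mult) (simp add: pderiv_pCons)
  also have "\<dots> = ?h (Suc q) + smult (real (Suc q)) ([:0, 1:] * ?h q - pderiv (?h q))"
    unfolding Suc.IH by (simp add: pderiv_smult smult_diff_right)
  also have "\<dots> = ?h (Suc q) + smult (real (Suc q)) (?h (Suc q))"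
    by (simp only: hermite_poly.simps(2)[of q])
  also have "\<dots> = smult (1 + real (Suc q)) (?h (Suc q))"
    by (simp only: smult_add_left smult_1_left)
  also have "\<dots> = smult (real (Suc (Suc q))) (?h (Suc q))" by (simp only: of_nat_Suc)
  finally show ?case .
qed

lemma integrable_std_normal_poly: "integrable std_normal_distribution (poly p)"
  unfolding poly_altdef[abs_def]
  by (intro Bochner_Integration.integrable_sum integrable_mult_right integrable_std_normal_distribution_moment)

lemma integrable_std_normal_polyI: "(\<And>x. f x = poly p x) \<Longrightarrow> integrable std_normal_distribution f"
  using integrable_std_normal_poly[of p] by (simp add: ext[of f "poly p"])

lemma hermite_L2: "L2_function std_normal_distribution (hermite q)"
  unfolding L2_function_def hermite_eq_poly
  by (auto intro!: borel_measurable_continuous_onI continuous_intros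
      integrable_std_normal_polyI[of _ "hermite_poly q * hermite_poly q"] simp: power2_eq_square)

text \<open>Integration by parts for monomials, read off from the known moments. At
  \<open>k = 0\<close> the truncated exponent \<open>k - 1\<close> does no harm because the factor
  \<open>real k\<close> vanishes.\<close>

lemma std_normal_moment_Suc:
  "(LINT x|std_normal_distribution. x ^ Suc k) = real k * (LINT x|std_normal_distribution. x ^ (k - 1))"
proof (cases "even k")
  case True
  then show ?thesis
    using integral_std_normal_distribution_moment_odd[of "Suc k"] integral_std_normal_distribution_moment_odd[of "k - 1"]
    by (cases "k = 0") auto
next
  case False
  then obtain j where k: "k = 2 * j + 1" by (auto elim: oddE)
  have "(LINT x|std_normal_distribution. x ^ Suc k) = (LINT x|std_normal_distribution. x ^ (2 * Suc j))"
    by (simp only: k) simp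
  also have "\<dots> = fact (2 * Suc j) / (2 ^ Suc j * fact (Suc j))" by (rule std_normal_distribution_even_moments)
  also have "\<dots> = (2 * (real j + 1) * real k * fact (2 * j)) / (2 * 2 ^ j * ((real j + 1) * fact j))"
    by (simp add: k algebra_simps)
  also have "\<dots> = real k * (fact (2 * j) / (2 ^ j * fact j))"
  proof -
    have "(2 * x * y * a) / (2 * b * (x * c)) = y * (a / (b * c))" if "x \<noteq> 0" for x y a b c :: real
      using that by simp
    then show ?thesis by (metis of_nat_Suc of_nat_0_eq_iff nat.distinct(2) add.commute)
  qed
  also have "fact (2 * j) / (2 ^ j * fact j) = (LINT x|std_normal_distribution. x ^ (k - 1))"
    by (simp add: k std_normal_distribution_even_moments)
  finally show ?thesis .
qed

lemma std_normal_Stein: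
  "(LINT x|std_normal_distribution. x * poly p x) = (LINT x|std_normal_distribution. poly (pderiv p) x)"
proof -
  have I: "integrable std_normal_distribution (\<lambda>x. x ^ k * poly p x)" for k p
    by (rule integrable_std_normal_polyI[of _ "monom 1 k * p"]) (simp add: poly_monom)
  have I': "integrable std_normal_distribution (\<lambda>x. c * x ^ k)" for k c
    by (intro integrable_mult_right integrable_std_normal_distribution_moment)
  \<comment> \<open>The extra power of \<open>x\<close> makes the induction work: splitting off a
    coefficient of \<open>p\<close> turns the rest into the same statement with \<open>k\<close>
    raised by one.\<close>
  have "(LINT x|std_normal_distribution. x ^ Suc k * poly p x)
      = real k * (LINT x|std_normal_distribution. x ^ (k - 1) * poly p x) + (LINT x|std_normal_distribution. x ^ k * poly (pderiv p) x)" for k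
  proof (induction p arbitrary: k)
    case (pCons a p)
    have 1: "(LINT x|std_normal_distribution. x ^ Suc k * poly (pCons a p) x)
       = a * (LINT x|std_normal_distribution. x ^ Suc k) + (LINT x|std_normal_distribution. x ^ Suc (Suc k) * poly p x)"
    proof -
      have "(\<lambda>x. x ^ Suc k * poly (pCons a p) x) = (\<lambda>x. a * x ^ Suc k + x ^ Suc (Suc k) * poly p x)"
        by (simp add: algebra_simps)
      then show ?thesis using I[of "Suc (Suc k)" p] I'[of a "Suc k"] by (simp only: Bochner_Integration.integral_add integral_mult_right_zero)
    qed
    have 2: "real k * (LINT x|std_normal_distribution. x ^ (k - 1) * poly (pCons a p) x)
       = real k * (a * (LINT x|std_normal_distribution. x ^ (k - 1)) + (LINT x|std_normal_distribution. x ^ k * poly p x))"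
    proof (cases "k = 0")
      case False
      have "(\<lambda>x. x ^ (k - 1) * poly (pCons a p) x) = (\<lambda>x. a * x ^ (k - 1) + x ^ k * poly p x)"
        using False by (cases k) (auto simp: algebra_simps)
      then show ?thesis using I[of k p] I'[of a "k - 1"] by (simp only: Bochner_Integration.integral_add integral_mult_right_zero)
    qed simp
    have 3: "(LINT x|std_normal_distribution. x ^ k * poly (pderiv (pCons a p)) x)
       = (LINT x|std_normal_distribution. x ^ k * poly p x) + (LINT x|std_normal_distribution. x ^ Suc k * poly (pderiv p) x)"
    proof -
      have "(\<lambda>x. x ^ k * poly (pderiv (pCons a p)) x) = (\<lambda>x. x ^ k * poly p x + x ^ Suc k * poly (pderiv p) x)"
        by (simp add: pderiv_pCons algebra_simps)
      then show ?thesis using I[of k p] I[of "Suc k" "pderiv p"] by (simp only: Bochner_Integration.integral_add)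
    qed
    show ?case unfolding 1 2 3 std_normal_moment_Suc pCons.IH[of "Suc k"] by (simp add: algebra_simps)
  qed simp
  from this[of 0] show ?thesis by simp
qed

context prob_space
begin

lemma gaussian_rv_poly_L2:
  assumes "gaussian_rv M Y" "expectation Y = 0"
  shows "L2_function M (\<lambda>\<omega>. poly p (Y \<omega>))"
proof -
  have m: "Y \<in> borel_measurable M" using assms(1) by (simp add: gaussian_rv_def)
  have pm: "(\<lambda>x. poly q x) \<in> borel_measurable borel" for q :: "real poly"
    by (intro borel_measurable_continuous_onI continuous_intros)
  have "integrable std_normal_distribution (\<lambda>x. poly (p * p) (l2norm M Y * x))"
    by (rule integrable_std_normal_polyI[of _ "(p * p) \<circ>\<^sub>p [:0, l2norm M Y:]"]) (simp add: poly_pcompose mult.commute)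
  then have "integrable M (\<lambda>\<omega>. poly (p * p) (Y \<omega>))"
    using gaussian_rv_integral(2)[OF assms pm[of "p * p"]] by simp
  then show ?thesis
    using measurable_compose[OF m pm[of p]] by (simp add: L2_function_def power2_eq_square)
qed

lemma unit_gaussian_distr:
  assumes "gaussian_rv M X" "expectation X = 0" "l2norm M X = 1"
  shows "distr M borel X = std_normal_distribution"
proof -
  have "distr std_normal_distribution borel (\<lambda>x. x) = std_normal_distribution"
    by (rule distr_id2) simp
  then show ?thesis using gaussian_rv_distr[OF assms(1,2)] assms(3) by simp
qed

text \<open>For a fixed value \<open>w\<close> of the residual, one-dimensional integration by parts
  applies to the polynomial \<open>p x * q (r * x + w)\<close>; the product and chain rules give the
  two terms, the second with factor \<open>r\<close>. Independence of \<open>X\<close> and the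
  residual then allows integration over \<open>w\<close>.\<close>

lemma gaussian_pair_Stein:
  assumes P: "gaussian_pair X Y" and X1: "l2norm M X = 1" and r: "r = expectation (\<lambda>\<omega>. X \<omega> * Y \<omega>)"
  shows "expectation (\<lambda>\<omega>. X \<omega> * poly p (X \<omega>) * poly q (Y \<omega>))
     = expectation (\<lambda>\<omega>. poly (pderiv p) (X \<omega>) * poly q (Y \<omega>)) + r * expectation (\<lambda>\<omega>. poly p (X \<omega>) * poly (pderiv q) (Y \<omega>))"
proof -
  note X = gaussian_pairD[OF P]
  note [measurable] = X(7,8)
  have pm[measurable]: "(\<lambda>x. poly q x) \<in> borel_measurable borel" for q :: "real poly"
    by (intro borel_measurable_continuous_onI continuous_intros)
  define W where "W \<omega> = Y \<omega> - r * X \<omega>" for \<omega>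
  have [measurable]: "W \<in> borel_measurable M" unfolding W_def by measurable
  have ind: "indep_var borel X borel W"
    unfolding W_def by (rule gaussian_pair_residual[OF P X1 r])
  then have D: "distr M (borel \<Otimes>\<^sub>M borel) (\<lambda>\<omega>. (X \<omega>, W \<omega>)) = std_normal_distribution \<Otimes>\<^sub>M distr M borel W"
    unfolding indep_var_distribution_eq using unit_gaussian_distr[OF X(1,3) X1] by simp
  interpret N: prob_space std_normal_distribution using prob_space_normal_density[of 1 0] by simp
  interpret W: prob_space "distr M borel W" by (rule prob_space_distr) simp
  interpret NW: pair_sigma_finite std_normal_distribution "distr M borel W" ..
  have I: "integrable M (\<lambda>\<omega>. poly p (X \<omega>) * poly q (Y \<omega>))" for p q
    using L2_mult_integrable gaussian_rv_poly_L2 X by blast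
  define T where "T x w = x * poly p x * poly q (r * x + w) - (poly (pderiv p) x * poly q (r * x + w) + r * (poly p x * poly (pderiv q) (r * x + w)))" for x w
  have Tm[measurable]: "case_prod T \<in> borel_measurable (borel \<Otimes>\<^sub>M borel)"
    unfolding T_def case_prod_beta by measurable
  have TE: "T (X \<omega>) (W \<omega>) = X \<omega> * poly p (X \<omega>) * poly q (Y \<omega>) - (poly (pderiv p) (X \<omega>) * poly q (Y \<omega>) + r * (poly p (X \<omega>) * poly (pderiv q) (Y \<omega>)))" for \<omega>
    by (simp add: T_def W_def)
  have I0: "integrable M (\<lambda>\<omega>. X \<omega> * poly p (X \<omega>) * poly q (Y \<omega>))"
    using I[of "[:0, 1:] * p" q] by simp
  have IT: "integrable M (\<lambda>\<omega>. T (X \<omega>) (W \<omega>))"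
    unfolding TE using I I0 by (intro Bochner_Integration.integrable_diff Bochner_Integration.integrable_add integrable_mult_right) auto
  have IT': "integrable (std_normal_distribution \<Otimes>\<^sub>M distr M borel W) (case_prod T)"
    unfolding D[symmetric] using IT by (subst integrable_distr_eq) auto
  have inner: "(LINT x|std_normal_distribution. T x w) = 0" for w
  proof -
    let ?Q = "q \<circ>\<^sub>p [:w, r:]"
    have "(LINT x|std_normal_distribution. x * poly (p * ?Q) x) = (LINT x|std_normal_distribution. poly (pderiv (p * ?Q)) x)"
      by (rule std_normal_Stein)
    moreover have "T x w = x * poly (p * ?Q) x - poly (pderiv (p * ?Q)) x" for x
      by (simp add: T_def pderiv_mult pderiv_pcompose poly_pcompose pderiv_pCons algebra_simps)
    moreover have "integrable std_normal_distribution (\<lambda>x. x * poly (p * ?Q) x)"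
      by (rule integrable_std_normal_polyI[of _ "[:0, 1:] * (p * ?Q)"]) simp
    ultimately show ?thesis using integrable_std_normal_poly[of "pderiv (p * ?Q)"] by simp
  qed
  have "expectation (\<lambda>\<omega>. T (X \<omega>) (W \<omega>)) = (LINT z|distr M (borel \<Otimes>\<^sub>M borel) (\<lambda>\<omega>. (X \<omega>, W \<omega>)). case_prod T z)"
    by (subst integral_distr) auto
  also have "\<dots> = (LINT w|distr M borel W. (LINT x|std_normal_distribution. T x w))"
    unfolding D using NW.integral_snd[OF IT'] by simp
  also have "\<dots> = 0" by (simp add: inner)
  finally show ?thesis unfolding TE using I I0 by simp
qed

text \<open>Each integration by parts lowers both degrees by one and produces a factor
  \<open>r\<close>, and differentiating \<open>hermite_poly n\<close> produces \<open>n\<close>;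
  after \<open>n\<close> rounds the factors make up \<open>fact n * r ^ n\<close>. For different
  degrees the process ends with the mean of a polynomial of positive degree, which is 0, or with the
  derivative of a constant.\<close>

lemma hermite_covariance:
  assumes P: "gaussian_pair X Y" and X1: "l2norm M X = 1" and Y1: "l2norm M Y = 1"
  shows "expectation (\<lambda>\<omega>. hermite m (X \<omega>) * hermite n (Y \<omega>))
     = (if m = n then fact n * expectation (\<lambda>\<omega>. X \<omega> * Y \<omega>) ^ n else 0)"
proof -
  note X = gaussian_pairD[OF P]
  define r where "r = expectation (\<lambda>\<omega>. X \<omega> * Y \<omega>)"
  define K where "K p q = expectation (\<lambda>\<omega>. poly p (X \<omega>) * poly q (Y \<omega>))" for p q
  have I: "integrable M (\<lambda>\<omega>. poly p (X \<omega>) * poly q (Y \<omega>))" for p q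
    using L2_mult_integrable gaussian_rv_poly_L2 X by blast
  \<comment> \<open>The recursion for Hermite polynomials subtracts exactly the first term of the
    integration by parts, so only the term with the factor \<open>r\<close> survives.\<close>
  have st: "K (hermite_poly (Suc m)) q = r * K (hermite_poly m) (pderiv q)" for m q
  proof -
    have 1: "K ([:0, 1:] * p) q = K (pderiv p) q + r * K p (pderiv q)" for p
      using gaussian_pair_Stein[OF P X1 r_def, of p q] by (simp add: K_def)
    have "K ([:0, 1:] * hermite_poly m - pderiv (hermite_poly m)) q = K ([:0, 1:] * hermite_poly m) q - K (pderiv (hermite_poly m)) q"
      using I[of "[:0, 1:] * hermite_poly m" q] I[of "pderiv (hermite_poly m)" q]
      unfolding K_def by (simp add: left_diff_distrib)
    then show ?thesis using 1[of "hermite_poly m"] by simp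
  qed
  have E0: "K 1 (hermite_poly (Suc n)) = 0" for n
  proof -
    \<comment> \<open>The base case involves \<open>Y\<close> alone: integration by parts is applied
      to the singular pair \<open>Y\<close>, \<open>Y\<close> with a constant second
      polynomial.\<close>
    have YY: "gaussian_pair Y Y" using gaussian_pair_linear[OF P, of 0 1 0 1] by simp
    have J: "integrable M (\<lambda>\<omega>. poly q (Y \<omega>))" for q using I[of 1 q] by simp
    have "expectation (\<lambda>\<omega>. Y \<omega> * poly (hermite_poly n) (Y \<omega>)) = expectation (\<lambda>\<omega>. poly (pderiv (hermite_poly n)) (Y \<omega>))"
      using gaussian_pair_Stein[OF YY Y1 refl, of "hermite_poly n" 1] by simp
    then show ?thesis
      using J[of "[:0, 1:] * hermite_poly n"] J[of "pderiv (hermite_poly n)"] by (simp add: K_def)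
  qed
  have "K (hermite_poly m) (hermite_poly n) = (if m = n then fact n * r ^ n else 0)"
  proof (induction m arbitrary: n)
    case 0
    then show ?case using E0 by (cases n) (auto simp: K_def prob_space)
  next
    case (Suc m)
    show ?case
    proof (cases n)
      case 0
      then show ?thesis unfolding st by (simp add: K_def)
    next
      case (Suc n')
      have "K (hermite_poly (Suc m)) (hermite_poly (Suc n')) = r * (real (Suc n') * K (hermite_poly m) (hermite_poly n'))"
        unfolding st pderiv_hermite_poly_Suc by (simp add: K_def mult.left_commute)
      then show ?thesis using Suc Suc.IH[of n'] by simp
    qed
  qed
  then show ?thesis by (simp add: K_def r_def hermite_eq_poly)
qed

lemma hermite_sum_covariance:
  fixes c :: "nat \<Rightarrow> real"
  assumes P: "gaussian_pair X Y" and X1: "l2norm M X = 1" and Y1: "l2norm M Y = 1" and F: "finite F"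
  shows "expectation (\<lambda>\<omega>. (\<Sum>q\<in>F. c q * hermite q (X \<omega>)) * (\<Sum>q\<in>F. c q * hermite q (Y \<omega>)))
     = (\<Sum>q\<in>F. (c q)\<^sup>2 * fact q * expectation (\<lambda>\<omega>. X \<omega> * Y \<omega>) ^ q)"
proof -
  note X = gaussian_pairD[OF P]
  have I: "integrable M (\<lambda>\<omega>. hermite p (X \<omega>) * hermite q (Y \<omega>))" for p q
    unfolding hermite_eq_poly using L2_mult_integrable gaussian_rv_poly_L2 X by blast
  have "expectation (\<lambda>\<omega>. (\<Sum>q\<in>F. c q * hermite q (X \<omega>)) * (\<Sum>q\<in>F. c q * hermite q (Y \<omega>)))
     = expectation (\<lambda>\<omega>. \<Sum>p\<in>F. \<Sum>q\<in>F. c p * c q * (hermite p (X \<omega>) * hermite q (Y \<omega>)))"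
    by (simp add: sum_product mult_ac)
  also have "\<dots> = (\<Sum>p\<in>F. \<Sum>q\<in>F. c p * c q * expectation (\<lambda>\<omega>. hermite p (X \<omega>) * hermite q (Y \<omega>)))"
    using I by (simp add: Bochner_Integration.integral_sum Bochner_Integration.integrable_sum)
  also have "\<dots> = (\<Sum>p\<in>F. \<Sum>q\<in>F. if p = q then (c q)\<^sup>2 * fact q * expectation (\<lambda>\<omega>. X \<omega> * Y \<omega>) ^ q else 0)"
    unfolding hermite_covariance[OF P X1 Y1] by (intro sum.cong refl) (auto simp: power2_eq_square)
  finally show ?thesis using F by (simp add: sum.delta')
qed

text \<open>All degrees are at least two and \<open>\<bar>r\<bar> \<le> 1\<close>, so each power
  \<open>\<bar>r\<bar> ^ q\<close> in the diagonal expansion is at most \<open>r\<^sup>2\<close>.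
  This is proved for the finite truncations and passed to the limit, with the truncation errors
  controlled by Cauchy-Schwarz.\<close>

lemma hermite_tail_covariance_bound:
  fixes R :: "real \<Rightarrow> real"
  assumes P: "gaussian_pair X Y" and X1: "l2norm M X = 1" and Y1: "l2norm M Y = 1"
    and R: "L2_function std_normal_distribution R"
    and lim: "(\<lambda>N. l2norm std_normal_distribution (\<lambda>x. R x - (\<Sum>q=2..N. c q * hermite q x))) \<longlonglongrightarrow> 0"
  shows "\<bar>expectation (\<lambda>\<omega>. R (X \<omega>) * R (Y \<omega>))\<bar> \<le> (expectation (\<lambda>\<omega>. X \<omega> * Y \<omega>))\<^sup>2 * (l2norm std_normal_distribution R)\<^sup>2"
proof -
  note X = gaussian_pairD[OF P]
  let ?S = std_normal_distribution
  define r where "r = expectation (\<lambda>\<omega>. X \<omega> * Y \<omega>)"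
  define Q where "Q N x = (\<Sum>q=2..N. c q * hermite q x)" for N x
  define e where "e N = l2norm ?S (\<lambda>x. R x - Q N x)" for N
  define K where "K = l2norm ?S R"
  have r1: "\<bar>r\<bar> \<le> 1" using L2_Cauchy_Schwarz[OF X(5,6)] X1 Y1 by (simp add: r_def)
  have QL: "L2_function ?S (Q N)" for N
    unfolding Q_def by (intro L2_function_sum L2_function_cmult hermite_L2)
  have lift: "L2_function M (\<lambda>\<omega>. f (Z \<omega>)) \<and> l2norm M (\<lambda>\<omega>. f (Z \<omega>)) = l2norm ?S f"
    if "L2_function ?S f" "gaussian_rv M Z" "expectation Z = 0" "l2norm M Z = 1" for f Z
  proof -
    have [measurable]: "f \<in> borel_measurable borel" "Z \<in> borel_measurable M" using that by (auto simp: L2_function_def gaussian_rv_def)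
    show ?thesis
      using gaussian_rv_integral[OF that(2,3), of "\<lambda>x. (f x)\<^sup>2"] that(1,4) by (simp add: L2_function_def l2norm_def)
  qed
  have bound: "\<bar>expectation (\<lambda>\<omega>. R (X \<omega>) * R (Y \<omega>))\<bar> \<le> r\<^sup>2 * (K + e N)\<^sup>2 + e N * (K + e N) + K * e N" for N
  proof -
    have DL: "L2_function ?S (\<lambda>x. R x - Q N x)" using R QL by (rule L2_function_diff)
    note LX = lift[OF _ X(1,3) X1] and LY = lift[OF _ X(2,4) Y1]
    have QK: "l2norm ?S (Q N) \<le> K + e N"
      using l2norm_triangle_diff[OF QL[of N] R] l2norm_minus_commute[of ?S R "Q N"] unfolding K_def e_def by simp
    have fm: "expectation (\<lambda>\<omega>. Q N (X \<omega>) * Q N (Y \<omega>)) = (\<Sum>q=2..N. (c q)\<^sup>2 * fact q * r ^ q)"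
      unfolding Q_def r_def by (rule hermite_sum_covariance[OF P X1 Y1]) simp
    \<comment> \<open>The same expansion for the pair \<open>X\<close>, \<open>X\<close>, whose
      correlation is 1, computes the norm of the truncation.\<close>
    have XX: "gaussian_pair X X" using gaussian_pair_linear[OF P, of 1 0 1 0] by simp
    have "(l2norm M (\<lambda>\<omega>. Q N (X \<omega>)))\<^sup>2 = expectation (\<lambda>\<omega>. Q N (X \<omega>) * Q N (X \<omega>))"
      unfolding l2norm_power2 by (simp only: power2_eq_square)
    also have "\<dots> = (\<Sum>q=2..N. (c q)\<^sup>2 * fact q * expectation (\<lambda>\<omega>. X \<omega> * X \<omega>) ^ q)"
      unfolding Q_def by (rule hermite_sum_covariance[OF XX X1 X1]) simp
    also have "expectation (\<lambda>\<omega>. X \<omega> * X \<omega>) = 1" using X1 l2norm_power2[of M X] by (simp add: power2_eq_square)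
    finally have nQ: "(l2norm ?S (Q N))\<^sup>2 = (\<Sum>q=2..N. (c q)\<^sup>2 * fact q)" using LX[OF QL] by simp
    have "\<bar>expectation (\<lambda>\<omega>. Q N (X \<omega>) * Q N (Y \<omega>))\<bar> \<le> (\<Sum>q=2..N. r\<^sup>2 * ((c q)\<^sup>2 * fact q))"
      unfolding fm
    proof (rule order_trans[OF sum_abs], rule sum_mono)
      fix q assume "q \<in> {2..N}"
      then have "\<bar>r\<bar> ^ q \<le> \<bar>r\<bar> ^ 2" using r1 by (intro power_decreasing) auto
      then have "((c q)\<^sup>2 * fact q) * \<bar>r\<bar> ^ q \<le> ((c q)\<^sup>2 * fact q) * r\<^sup>2" by (intro mult_left_mono) auto
      then show "\<bar>(c q)\<^sup>2 * fact q * r ^ q\<bar> \<le> r\<^sup>2 * ((c q)\<^sup>2 * fact q)" by (simp add: abs_mult power_abs mult_ac)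
    qed
    also have "\<dots> = r\<^sup>2 * (l2norm ?S (Q N))\<^sup>2" unfolding nQ sum_distrib_left ..
    also have "\<dots> \<le> r\<^sup>2 * (K + e N)\<^sup>2" using QK by (intro mult_left_mono power_mono) auto
    finally have 1: "\<bar>expectation (\<lambda>\<omega>. Q N (X \<omega>) * Q N (Y \<omega>))\<bar> \<le> r\<^sup>2 * (K + e N)\<^sup>2" .
    have "\<bar>expectation (\<lambda>\<omega>. (R (X \<omega>) - Q N (X \<omega>)) * Q N (Y \<omega>))\<bar> \<le> e N * l2norm ?S (Q N)"
      using L2_Cauchy_Schwarz[of M "\<lambda>\<omega>. R (X \<omega>) - Q N (X \<omega>)" "\<lambda>\<omega>. Q N (Y \<omega>)"] LX[OF DL] LY[OF QL[of N]] by (simp add: e_def)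
    also have "\<dots> \<le> e N * (K + e N)" using QK by (intro mult_left_mono) (auto simp: e_def)
    finally have 2: "\<bar>expectation (\<lambda>\<omega>. (R (X \<omega>) - Q N (X \<omega>)) * Q N (Y \<omega>))\<bar> \<le> e N * (K + e N)" .
    have 3: "\<bar>expectation (\<lambda>\<omega>. R (X \<omega>) * (R (Y \<omega>) - Q N (Y \<omega>)))\<bar> \<le> K * e N"
      using L2_Cauchy_Schwarz[of M "\<lambda>\<omega>. R (X \<omega>)" "\<lambda>\<omega>. R (Y \<omega>) - Q N (Y \<omega>)"] LX[OF R] LY[OF DL] by (simp add: e_def K_def)
    have i: "integrable M (\<lambda>\<omega>. Q N (X \<omega>) * Q N (Y \<omega>))" "integrable M (\<lambda>\<omega>. (R (X \<omega>) - Q N (X \<omega>)) * Q N (Y \<omega>))"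
      "integrable M (\<lambda>\<omega>. R (X \<omega>) * (R (Y \<omega>) - Q N (Y \<omega>)))"
      using LX[OF R] LX[OF DL] LX[OF QL[of N]] LY[OF QL[of N]] LY[OF DL] by (auto intro!: L2_mult_integrable)
    \<comment> \<open>The two factors are replaced by their truncations one after the other, so each
      error term contains only one small factor \<open>e N\<close>.\<close>
    have "(\<lambda>\<omega>. R (X \<omega>) * R (Y \<omega>)) = (\<lambda>\<omega>. Q N (X \<omega>) * Q N (Y \<omega>) + (R (X \<omega>) - Q N (X \<omega>)) * Q N (Y \<omega>) + R (X \<omega>) * (R (Y \<omega>) - Q N (Y \<omega>)))"
      by (auto simp: algebra_simps)
    then have "expectation (\<lambda>\<omega>. R (X \<omega>) * R (Y \<omega>)) = expectation (\<lambda>\<omega>. Q N (X \<omega>) * Q N (Y \<omega>))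
       + expectation (\<lambda>\<omega>. (R (X \<omega>) - Q N (X \<omega>)) * Q N (Y \<omega>)) + expectation (\<lambda>\<omega>. R (X \<omega>) * (R (Y \<omega>) - Q N (Y \<omega>)))"
      using i by (simp only: Bochner_Integration.integral_add Bochner_Integration.integrable_add)
    then show ?thesis using 1 2 3 by linarith
  qed
  have e0: "e \<longlonglongrightarrow> 0" using lim unfolding e_def Q_def .
  have "(\<lambda>N. r\<^sup>2 * (K + e N)\<^sup>2 + e N * (K + e N) + K * e N) \<longlonglongrightarrow> r\<^sup>2 * (K + 0)\<^sup>2 + 0 * (K + 0) + K * 0"
    by (intro tendsto_intros e0)
  then show ?thesis using bound unfolding r_def K_def by (intro LIMSEQ_le_const) auto
qed

end

text \<open>Rank one means that the expansion has no constant term; the first Hermite polynomial is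
  the identity, so removing the linear part leaves a series that starts at degree two.\<close>

lemma hermite_rank_one_decomposition:
  assumes G: "square_integrable_gaussian G" and rank: "has_hermite_rank G 1"
  defines "R \<equiv> \<lambda>x. G x - hermite_coeff G 1 * x"
  shows "L2_function std_normal_distribution R"
    and "(\<lambda>N. l2norm std_normal_distribution (\<lambda>x. R x - (\<Sum>q=2..N. hermite_coeff G q / fact q * hermite q x))) \<longlonglongrightarrow> 0"
proof -
  let ?S = std_normal_distribution
  have h1: "hermite (Suc 0) x = x" for x by (simp add: hermite_eq_poly)
  have GL: "L2_function ?S G" using G by (simp add: L2_function_def square_integrable_gaussian_def)
  have "L2_function ?S (\<lambda>x. G x - hermite_coeff G 1 * hermite (Suc 0) x)"
    by (intro L2_function_diff L2_function_cmult GL hermite_L2)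
  then show RL: "L2_function ?S R" by (simp add: R_def h1)
  define D where "D N x = R x - (\<Sum>q=2..N. hermite_coeff G q / fact q * hermite q x)" for N x
  have DL: "L2_function ?S (D N)" for N
    unfolding D_def by (intro L2_function_diff L2_function_sum L2_function_cmult RL hermite_L2)
  have DE: "G x - (\<Sum>q=1..N. hermite_coeff G q / fact q * hermite q x) = D N x" if "1 \<le> N" for N x
  proof -
    have "(\<Sum>q=1..N. hermite_coeff G q / fact q * hermite q x) = hermite_coeff G 1 * x + (\<Sum>q=2..N. hermite_coeff G q / fact q * hermite q x)"
      using that by (simp add: sum.atLeast_Suc_atMost h1 numeral_2_eq_2)
    then show ?thesis by (simp add: D_def R_def)
  qed
  have "(\<lambda>N. \<integral>\<^sup>+ x. ennreal ((G x - (\<Sum>q=1..N. hermite_coeff G q / fact q * hermite q x)) ^ 2) \<partial>?S) \<longlonglongrightarrow> 0"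
    using rank by (simp add: has_hermite_rank_def)
  moreover have "\<forall>\<^sub>F N in sequentially. (\<integral>\<^sup>+ x. ennreal ((G x - (\<Sum>q=1..N. hermite_coeff G q / fact q * hermite q x)) ^ 2) \<partial>?S)
      = ennreal ((l2norm ?S (D N))\<^sup>2)"
    using eventually_ge_at_top[of 1]
  proof eventually_elim
    case (elim N)
    then show ?case unfolding DE[OF elim] l2norm_power2
      using DL by (intro nn_integral_eq_integral) (auto simp: L2_function_def)
  qed
  ultimately have "(\<lambda>N. ennreal ((l2norm ?S (D N))\<^sup>2)) \<longlonglongrightarrow> ennreal 0"
    by (simp add: tendsto_cong)
  then have "(\<lambda>N. (l2norm ?S (D N))\<^sup>2) \<longlonglongrightarrow> 0"
    by (subst (asm) tendsto_ennreal_iff) auto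
  then have "(\<lambda>N. sqrt ((l2norm ?S (D N))\<^sup>2)) \<longlonglongrightarrow> sqrt 0" by (rule tendsto_real_sqrt)
  then show "(\<lambda>N. l2norm ?S (\<lambda>x. R x - (\<Sum>q=2..N. hermite_coeff G q / fact q * hermite q x))) \<longlonglongrightarrow> 0"
    by (simp add: D_def[abs_def])
qed

section \<open>Law of the iterated logarithm: upper bound\<close>

text \<open>Chernoff's bound in pointwise form: where \<open>\<bar>x\<bar> \<ge> y\<close>, the
  standard density is at most \<open>exp (- y\<^sup>2 / 2)\<close> times the sum of the unit normal
  densities centred at \<open>y\<close> and \<open>- y\<close>.\<close>

lemma std_normal_abs_tail:
  assumes "0 \<le> y"
  shows "measure std_normal_distribution {x. y \<le> \<bar>x\<bar>} \<le> 2 * exp (- y\<^sup>2 / 2)"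
proof -
  have nd: "exp (- y\<^sup>2 / 2) * normal_density s 1 x = std_normal_density x * exp (s * x - y\<^sup>2)" if "s\<^sup>2 = y\<^sup>2" for s x
    using that by (simp add: normal_density_def power2_diff add_divide_distrib diff_divide_distrib flip: exp_add)
  have "measure std_normal_distribution {x. y \<le> \<bar>x\<bar>} = (LINT x|std_normal_distribution. indicator {x. y \<le> \<bar>x\<bar>} x)"
    by simp
  also have "\<dots> = (LINT x|lborel. std_normal_density x * indicator {x. y \<le> \<bar>x\<bar>} x)"
    by (subst integral_density) auto
  also have "\<dots> \<le> (LINT x|lborel. exp (- y\<^sup>2 / 2) * normal_density y 1 x + exp (- y\<^sup>2 / 2) * normal_density (- y) 1 x)"
  proof (rule integral_mono)
    show "integrable lborel (\<lambda>x. std_normal_density x * indicator {x. y \<le> \<bar>x\<bar>} x)"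
      by (rule Bochner_Integration.integrable_bound[of _ std_normal_density]) (auto simp: indicator_def)
    show "integrable lborel (\<lambda>x. exp (- y\<^sup>2 / 2) * normal_density y 1 x + exp (- y\<^sup>2 / 2) * normal_density (- y) 1 x)"
      by (intro Bochner_Integration.integrable_add integrable_mult_right) auto
    fix x :: real
    show "std_normal_density x * indicator {x. y \<le> \<bar>x\<bar>} x \<le> exp (- y\<^sup>2 / 2) * normal_density y 1 x + exp (- y\<^sup>2 / 2) * normal_density (- y) 1 x"
    proof (cases "y \<le> \<bar>x\<bar>")
      case True
      then consider "y \<le> x" | "y \<le> - x" by linarith
      then have "1 \<le> exp (y * x - y\<^sup>2) + exp (- y * x - y\<^sup>2)"
      proof cases
        case 1
        then have "y * y \<le> y * x" using assms by (intro mult_left_mono)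
        then have "1 \<le> exp (y * x - y\<^sup>2)" by (simp add: power2_eq_square)
        then show ?thesis by (simp add: add_increasing2)
      next
        case 2
        then have "y * y \<le> y * - x" using assms by (intro mult_left_mono)
        then have "1 \<le> exp (- y * x - y\<^sup>2)" by (simp add: power2_eq_square)
        then show ?thesis by (simp add: add_increasing)
      qed
      then have "std_normal_density x * 1 \<le> std_normal_density x * (exp (y * x - y\<^sup>2) + exp (- y * x - y\<^sup>2))"
        by (intro mult_left_mono) auto
      then show ?thesis using True nd[of y x] nd[of "-y" x] by (simp add: ring_distribs)
    qed auto
  qed
  also have "\<dots> = 2 * exp (- y\<^sup>2 / 2)"
    by (subst Bochner_Integration.integral_add) auto
  finally show ?thesis .
qed

context prob_space
begin

text \<open>An upper bound \<open>s\<close> on the norm keeps the exponent meaningful for degenerate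
  variables and lets estimated variances be inserted directly.\<close>

lemma gaussian_rv_tail:
  assumes "gaussian_rv M Y" "expectation Y = 0" "l2norm M Y \<le> s" "0 < s" "0 \<le> x"
  shows "prob {\<omega> \<in> space M. x < \<bar>Y \<omega>\<bar>} \<le> 2 * exp (- x\<^sup>2 / (2 * s\<^sup>2))"
proof -
  interpret N: prob_space std_normal_distribution using prob_space_normal_density[of 1 0] by simp
  have [measurable]: "Y \<in> borel_measurable M" using assms(1) by (simp add: gaussian_rv_def)
  have "prob {\<omega> \<in> space M. x < \<bar>Y \<omega>\<bar>} = measure (distr M borel Y) {y. x < \<bar>y\<bar>}"
    by (subst measure_distr) (auto simp: vimage_def Int_def conj_commute)
  also have "\<dots> = measure std_normal_distribution {z. x < \<bar>l2norm M Y * z\<bar>}"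
    unfolding gaussian_rv_distr[OF assms(1,2)] by (subst measure_distr) (auto simp: vimage_def)
  also have "\<dots> \<le> measure std_normal_distribution {z. x / s \<le> \<bar>z\<bar>}"
  proof (rule N.finite_measure_mono)
    show "{z. x < \<bar>l2norm M Y * z\<bar>} \<subseteq> {z. x / s \<le> \<bar>z\<bar>}"
    proof safe
      fix z assume "x < \<bar>l2norm M Y * z\<bar>"
      moreover have "\<bar>l2norm M Y * z\<bar> \<le> s * \<bar>z\<bar>" unfolding abs_mult using assms(3) by (intro mult_right_mono) auto
      ultimately show "x / s \<le> \<bar>z\<bar>" using assms(4) by (simp add: field_simps)
    qed
  qed measurable
  also have "\<dots> \<le> 2 * exp (- (x / s)\<^sup>2 / 2)" using assms by (intro std_normal_abs_tail) auto
  finally show ?thesis by (simp add: power_divide mult.commute)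
qed

text \<open>A whole finite family is tested at each stage \<open>k\<close>, as required both for the
  skeleton points of a dyadic block and for its chaining increments.\<close>

lemma gaussian_Borel_Cantelli:
  fixes Y :: "nat \<Rightarrow> 'i \<Rightarrow> 'a \<Rightarrow> real"
  assumes fin: "\<And>k. finite (F k)"
    and Y: "\<And>k i. gaussian_rv M (Y k i)" "\<And>k i. expectation (Y k i) = 0"
    and ev: "\<forall>\<^sub>F k in sequentially. (\<forall>i\<in>F k. l2norm M (Y k i) \<le> s k i \<and> 0 < s k i \<and> 0 \<le> x k i)
       \<and> (\<Sum>i\<in>F k. 2 * exp (- (x k i)\<^sup>2 / (2 * (s k i)\<^sup>2))) \<le> b k"
    and b: "summable b"
  shows "AE \<omega> in M. \<forall>\<^sub>F k in sequentially. \<forall>i\<in>F k. \<bar>Y k i \<omega>\<bar> \<le> x k i"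
proof -
  have [measurable]: "Y k i \<in> borel_measurable M" for k i using Y(1) by (simp add: gaussian_rv_def)
  define Bad where "Bad k = (\<Union>i\<in>F k. {\<omega> \<in> space M. x k i < \<bar>Y k i \<omega>\<bar>})" for k
  have Bm: "Bad k \<in> sets M" for k unfolding Bad_def using fin by (intro sets.finite_UN) auto
  have "\<forall>\<^sub>F k in sequentially. norm (prob (Bad k)) \<le> b k"
    using ev
  proof eventually_elim
    case (elim k)
    have "prob (Bad k) \<le> (\<Sum>i\<in>F k. prob {\<omega> \<in> space M. x k i < \<bar>Y k i \<omega>\<bar>})"
      unfolding Bad_def using fin by (intro finite_measure_subadditive_finite) auto
    also have "\<dots> \<le> (\<Sum>i\<in>F k. 2 * exp (- (x k i)\<^sup>2 / (2 * (s k i)\<^sup>2)))"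
      using elim Y by (intro sum_mono gaussian_rv_tail) auto
    finally show ?case using elim by simp
  qed
  then have "summable (\<lambda>k. prob (Bad k))" using b by (rule summable_comparison_test_ev)
  then have "AE \<omega> in M. \<forall>\<^sub>F k in sequentially. \<omega> \<in> space M - Bad k"
    by (intro borel_cantelli_AE1 Bm) (auto simp: emeasure_eq_measure)
  then show ?thesis
  proof eventually_elim
    case (elim \<omega>)
    then show ?case by eventually_elim (auto simp: Bad_def not_less)
  qed
qed

end

section \<open>Dyadic rounding and chaining\<close>

lemma dyadic_chain:
  fixes u :: "nat \<Rightarrow> real"
  shows "\<bar>u n - u ((n div 2 ^ j) * 2 ^ j)\<bar> \<le> (\<Sum>i<j. \<bar>u ((n div 2 ^ i) * 2 ^ i) - u ((n div 2 ^ Suc i) * 2 ^ Suc i)\<bar>)"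
  by (induction j) auto

text \<open>Rounding \<open>n\<close> down to multiples of increasing powers of two clears its
  binary digits from the lowest upwards. Each step either changes nothing or moves by a single
  dyadic interval of length \<open>2 ^ i\<close>.\<close>

lemma dyadic_step:
  "(n div 2 ^ Suc i) * 2 ^ Suc i = (if even (n div 2 ^ i) then (n div 2 ^ i) * 2 ^ i else (n div 2 ^ i - 1) * (2 ^ i :: nat))"
proof -
  have "n div 2 ^ Suc i = (n div 2 ^ i) div 2" by (simp add: div_mult2_eq mult.commute[of 2])
  then have "(n div 2 ^ Suc i) * 2 ^ Suc i = ((n div 2 ^ i) div 2 * 2) * (2 ^ i :: nat)" by simp
  moreover have "(n div 2 ^ i) div 2 * 2 = (if even (n div 2 ^ i) then n div 2 ^ i else n div 2 ^ i - 1)"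
    by (auto elim!: oddE)
  ultimately show ?thesis by simp
qed

lemma dyadic_chain_bound:
  fixes u :: "nat \<Rightarrow> real"
  assumes n: "2 ^ k \<le> n" "n < 2 ^ Suc k" and j: "j \<le> k" and x0: "\<And>i. 0 \<le> x i"
    and inc: "\<And>i l. i < j \<Longrightarrow> 2 ^ (k - i) \<le> l \<Longrightarrow> l < 2 ^ Suc (k - i) \<Longrightarrow> \<bar>u (Suc l * 2 ^ i) - u (l * 2 ^ i)\<bar> \<le> x i"
  shows "\<bar>u n - u ((n div 2 ^ j) * 2 ^ j)\<bar> \<le> (\<Sum>i<j. x i)"
proof (rule order_trans[OF dyadic_chain sum_mono])
  fix i assume "i \<in> {..<j}"
  then have i: "i < j" "i < k" using j by auto
  define q where "q = n div 2 ^ i"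
  show "\<bar>u ((n div 2 ^ i) * 2 ^ i) - u ((n div 2 ^ Suc i) * 2 ^ Suc i)\<bar> \<le> x i"
  proof (cases "even q")
    case True
    then show ?thesis unfolding dyadic_step using x0 by (simp add: q_def)
  next
    case False
    have p: "(2::nat) ^ k = 2 ^ (k - i) * 2 ^ i" using i by (simp add: power_add[symmetric])
    have q1: "2 ^ (k - i) \<le> q" unfolding q_def using n(1) p by (simp add: less_eq_div_iff_mult_less_eq)
    have q2: "q < 2 ^ Suc (k - i)" unfolding q_def using n(2) p by (simp add: div_less_iff_less_mult)
    \<comment> \<open>The odd \<open>q\<close> cannot equal the left end \<open>2 ^ (k - i)\<close>,
      which is even because \<open>i < k\<close>. Hence rounding down does not leave the dyadic
      block.\<close>
    have "even ((2::nat) ^ (k - i))" using i by simp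
    with False q1 have "2 ^ (k - i) \<noteq> q" by metis
    with q1 have l: "2 ^ (k - i) \<le> q - 1" "q - 1 < 2 ^ Suc (k - i)" "Suc (q - 1) = q" using q2 False by (auto elim: oddE)
    show ?thesis using inc[OF i(1) l(1,2)] False unfolding dyadic_step l(3) by (simp add: q_def)
  qed
qed

lemma eventually_dyadic:
  assumes "\<forall>\<^sub>F k in sequentially. \<forall>n::nat. 2 ^ k \<le> n \<longrightarrow> n < 2 ^ Suc k \<longrightarrow> Q n"
  shows "\<forall>\<^sub>F n in sequentially. Q n"
proof -
  obtain N where N: "\<And>k n. N \<le> k \<Longrightarrow> 2 ^ k \<le> n \<Longrightarrow> n < 2 ^ Suc k \<Longrightarrow> Q n"
    using assms unfolding eventually_sequentially by blast
  have "Q n" if "2 ^ N \<le> n" for n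
  proof -
    have "1 \<le> n" using that by (metis one_le_numeral one_le_power order_trans)
    then obtain k where k: "2 ^ k \<le> n" "n < 2 ^ (k + 1)" using ex_power_ivl1[of 2 n] by auto
    then have "(2::nat) ^ N < 2 ^ (k + 1)" using that by linarith
    then have "N \<le> k" using power_less_imp_less_exp[of "2::nat" N "k + 1"] by simp
    then show ?thesis using N k by simp
  qed
  then show ?thesis unfolding eventually_sequentially by blast
qed

lemma sum_reverse_geometric_le:
  fixes r :: real
  assumes "0 \<le> r" "r < 1" "j0 \<le> k"
  shows "(\<Sum>j<k - j0. r ^ (k - j)) \<le> r ^ j0 / (1 - r)"
proof -
  have "(\<Sum>j<m. r ^ (j0 + m - j)) \<le> r ^ j0 * (1 - r ^ m) / (1 - r)" for m
  proof (induction m)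
    case (Suc m)
    have "(\<Sum>j<Suc m. r ^ (j0 + Suc m - j)) = r ^ (j0 + Suc m) + (\<Sum>j<m. r ^ (j0 + m - j))"
      by (subst sum.lessThan_Suc_shift) simp
    also have "\<dots> \<le> r ^ (j0 + m) + r ^ j0 * (1 - r ^ m) / (1 - r)"
      using Suc assms by (intro add_mono power_decreasing) auto
    also have "\<dots> = r ^ j0 * (1 - r ^ Suc m) / (1 - r)"
      using assms by (simp add: field_simps power_add)
    finally show ?case .
  qed simp
  from this[of "k - j0"] have "(\<Sum>j<k - j0. r ^ (k - j)) \<le> r ^ j0 * (1 - r ^ (k - j0)) / (1 - r)" using assms(3) by simp
  also have "\<dots> \<le> r ^ j0 * 1 / (1 - r)" using assms by (intro divide_right_mono mult_left_mono) auto
  finally show ?thesis by simp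
qed

text \<open>Everything that the iterated logarithm law needs to know about the Gaussian process.
  \<open>doubling\<close> compares standard deviations inside a dyadic block,
  \<open>increment\<close> feeds the chaining of the upper bound, and \<open>covariance\<close> the
  near independence of the lower bound; regular variation has disappeared into the
  constants.\<close>

locale gaussian_lil = prob_space +
  fixes U :: "nat \<Rightarrow> 'a \<Rightarrow> real" and \<sigma> :: "nat \<Rightarrow> real" and N0 :: nat and C K \<eta> :: real
  assumes \<sigma>_def: "\<And>n. \<sigma> n = l2norm M (U n)"
    and pair: "\<And>m n. gaussian_pair (U m) (U n)"
    and C0: "0 < C" and K1: "1 \<le> K" and eta: "0 < \<eta>" and N0: "1 \<le> N0"
    and sigma_pos: "\<And>n. N0 \<le> n \<Longrightarrow> 0 < \<sigma> n"
    and doubling: "\<And>m n. N0 \<le> m \<Longrightarrow> m \<le> n \<Longrightarrow> n \<le> 2 * m \<Longrightarrow> \<sigma> m \<le> K * \<sigma> n \<and> \<sigma> n \<le> K * \<sigma> m"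
    and increment: "\<And>m n. N0 \<le> m \<Longrightarrow> m \<le> n \<Longrightarrow> n \<le> 2 * m \<Longrightarrow>
       (l2norm M (\<lambda>\<omega>. U n \<omega> - U m \<omega>))\<^sup>2 \<le> C * (real (n - m) / real m) * (\<sigma> m)\<^sup>2"
    and covariance: "\<And>m n. N0 \<le> m \<Longrightarrow> 2 * m \<le> n \<Longrightarrow>
       \<bar>expectation (\<lambda>\<omega>. U m \<omega> * U n \<omega>)\<bar> \<le> C * (real m / real n) powr \<eta> * \<sigma> m * \<sigma> n"
begin

lemma U_props: "gaussian_rv M (U n)" "expectation (U n) = 0" "L2_function M (U n)" "random_variable borel (U n)"
  using gaussian_pairD[OF pair[of n n]] by auto

lemma diff_props: "gaussian_rv M (\<lambda>\<omega>. U n \<omega> - U m \<omega>)" "expectation (\<lambda>\<omega>. U n \<omega> - U m \<omega>) = 0"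
  using gaussian_pairD[OF gaussian_pair_linear[OF pair[of n m], of 1 "-1" 1 "-1"]] by auto

text \<open>At a point \<open>n \<ge> 2 ^ k\<close> the Gaussian tail is at most twice
  \<open>exp (- (1 + \<delta>)\<^sup>2 * ln (ln n))\<close>, hence at most twice a power of
  \<open>k * ln 2\<close> with exponent below -1. The number \<open>2 ^ j0\<close> of points per
  block does not depend on \<open>k\<close>, so the sum over all blocks converges.\<close>

lemma skeleton_bound:
  assumes "0 < \<delta>"
  shows "AE \<omega> in M. \<forall>\<^sub>F k in sequentially. \<forall>i\<in>{2 ^ j0..<2 ^ Suc j0}.
     \<bar>U (i * 2 ^ (k - j0)) \<omega>\<bar> \<le> (1 + \<delta>) * \<sigma> (i * 2 ^ (k - j0)) * sqrt (2 * ln (ln (real (i * 2 ^ (k - j0)))))"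
proof (rule gaussian_Borel_Cantelli)
  let ?n = "\<lambda>(k::nat) (i::nat). i * 2 ^ (k - j0) :: nat"
  show "summable (\<lambda>k. 2 ^ j0 * (2 * (real k * ln 2) powr (- (1 + \<delta>)\<^sup>2)))"
  proof -
    have "1 < (1 + \<delta>)\<^sup>2" using assms by (simp add: power2_eq_square algebra_simps add_pos_pos)
    then have "summable (\<lambda>k. real k powr (- (1 + \<delta>)\<^sup>2))" by (subst summable_real_powr_iff) simp
    then have "summable (\<lambda>k. (2 ^ j0 * 2 * (ln 2) powr (- (1 + \<delta>)\<^sup>2)) * real k powr (- (1 + \<delta>)\<^sup>2))"
      by (rule summable_mult)
    then show ?thesis by (simp add: powr_mult mult_ac)
  qed
  have "\<forall>\<^sub>F k in sequentially. N0 \<le> 2 ^ k \<and> j0 \<le> k \<and> 2 \<le> k"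
  proof -
    have "\<forall>\<^sub>F k in sequentially. N0 \<le> k \<and> j0 \<le> k \<and> 2 \<le> k"
      by (intro eventually_conj eventually_ge_at_top)
    then show ?thesis by eventually_elim (meson less_exp less_imp_le order_trans)
  qed
  then show "\<forall>\<^sub>F k in sequentially. (\<forall>i\<in>{2 ^ j0..<2 ^ Suc j0}. l2norm M (U (?n k i)) \<le> \<sigma> (?n k i) \<and> 0 < \<sigma> (?n k i)
      \<and> 0 \<le> (1 + \<delta>) * \<sigma> (?n k i) * sqrt (2 * ln (ln (real (?n k i)))))
      \<and> (\<Sum>i\<in>{2 ^ j0..<2 ^ Suc j0}. 2 * exp (- ((1 + \<delta>) * \<sigma> (?n k i) * sqrt (2 * ln (ln (real (?n k i)))))\<^sup>2 / (2 * (\<sigma> (?n k i))\<^sup>2)))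
      \<le> 2 ^ j0 * (2 * (real k * ln 2) powr (- (1 + \<delta>)\<^sup>2))"
  proof eventually_elim
    case (elim k)
    have n: "2 ^ k \<le> ?n k i" if "i \<in> {2 ^ j0..<2 ^ Suc j0}" for i
    proof -
      have "(2::nat) ^ k = 2 ^ j0 * 2 ^ (k - j0)" using elim by (simp add: power_add[symmetric])
      also have "\<dots> \<le> ?n k i" using that by (intro mult_right_mono) auto
      finally show ?thesis .
    qed
    have l2: "ln 2 * real k \<ge> 1"
    proof -
      have "1 / 2 \<le> ln (2::real)" using ln2_ge_two_thirds by simp
      then have "(1 / 2) * 2 \<le> ln 2 * real k" using elim by (intro mult_mono) auto
      then show ?thesis by simp
    qed
    have lnn: "real k * ln 2 \<le> ln (real (?n k i))" "0 \<le> ln (ln (real (?n k i)))"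
      "ln (real k * ln 2) \<le> ln (ln (real (?n k i)))" if "i \<in> {2 ^ j0..<2 ^ Suc j0}" for i
    proof -
      have "real (2 ^ k) \<le> real (?n k i)" using n[OF that] by (simp only: of_nat_le_iff)
      then have "ln (real (2 ^ k)) \<le> ln (real (?n k i))"
        by (subst ln_le_cancel_iff) (auto intro: order_less_le_trans[of 0 "real (2 ^ k)"])
      then show 1: "real k * ln 2 \<le> ln (real (?n k i))" by (simp add: ln_realpow)
      then show "0 \<le> ln (ln (real (?n k i)))" using l2 by (intro ln_ge_zero) (simp add: mult.commute)
      show "ln (real k * ln 2) \<le> ln (ln (real (?n k i)))" using 1 l2 by (subst ln_le_cancel_iff) (auto simp: mult.commute)
    qed
    have pos: "0 < \<sigma> (?n k i)" if "i \<in> {2 ^ j0..<2 ^ Suc j0}" for i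
      using n[OF that] elim by (intro sigma_pos) linarith
    have "(\<Sum>i\<in>{2 ^ j0..<2 ^ Suc j0}. 2 * exp (- ((1 + \<delta>) * \<sigma> (?n k i) * sqrt (2 * ln (ln (real (?n k i)))))\<^sup>2 / (2 * (\<sigma> (?n k i))\<^sup>2)))
       \<le> (\<Sum>i\<in>{2 ^ j0..<2 ^ Suc j0::nat}. 2 * (real k * ln 2) powr (- (1 + \<delta>)\<^sup>2))"
    proof (intro sum_mono mult_left_mono)
      fix i assume i: "i \<in> {2 ^ j0..<2 ^ Suc j0::nat}"
      have "- ((1 + \<delta>) * \<sigma> (?n k i) * sqrt (2 * ln (ln (real (?n k i)))))\<^sup>2 / (2 * (\<sigma> (?n k i))\<^sup>2)
         = - ((1 + \<delta>)\<^sup>2 * ln (ln (real (?n k i))))"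
        using pos[OF i] lnn(2)[OF i] by (simp add: power_mult_distrib)
      also have "\<dots> \<le> - ((1 + \<delta>)\<^sup>2 * ln (real k * ln 2))" using lnn(3)[OF i] by (simp add: mult_left_mono)
      finally show "exp (- ((1 + \<delta>) * \<sigma> (?n k i) * sqrt (2 * ln (ln (real (?n k i)))))\<^sup>2 / (2 * (\<sigma> (?n k i))\<^sup>2)) \<le> (real k * ln 2) powr (- (1 + \<delta>)\<^sup>2)"
        using elim by (simp add: powr_def)
    qed simp
    also have "\<dots> = 2 ^ j0 * (2 * (real k * ln 2) powr (- (1 + \<delta>)\<^sup>2))" by simp
    finally have b: "(\<Sum>i\<in>{2 ^ j0..<2 ^ Suc j0}. 2 * exp (- ((1 + \<delta>) * \<sigma> (?n k i) * sqrt (2 * ln (ln (real (?n k i)))))\<^sup>2 / (2 * (\<sigma> (?n k i))\<^sup>2)))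
       \<le> 2 ^ j0 * (2 * (real k * ln 2) powr (- (1 + \<delta>)\<^sup>2))" .
    have "l2norm M (U (?n k i)) \<le> \<sigma> (?n k i) \<and> 0 < \<sigma> (?n k i) \<and> 0 \<le> (1 + \<delta>) * \<sigma> (?n k i) * sqrt (2 * ln (ln (real (?n k i))))"
      if "i \<in> {2 ^ j0..<2 ^ Suc j0}" for i
      using pos[OF that] lnn(2)[OF that] assms by (simp add: \<sigma>_def)
    then show ?case using b by blast
  qed
qed (auto intro: U_props)


text \<open>
  The dyadic increments of length \<open>2 ^ j\<close> inside \<open>[2 ^ k, 2 ^ Suc k]\<close> have variance of order
  \<open>2 powr (j - k)\<close> relative to \<open>(\<sigma> (2 ^ k))\<^sup>2\<close>. The thresholds only decay like
  \<open>2 powr ((j - k) / 4)\<close>, so the Gaussian tails beat the \<open>2 ^ (k - j)\<close> terms of the union bound.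
\<close>

lemma chain_bound:
  assumes j0: "\<And>e. j0 \<le> e \<Longrightarrow> 2 + real e \<le> (sqrt 2) ^ e / (2 * C * K\<^sup>2)"
  shows "AE \<omega> in M. \<forall>\<^sub>F k in sequentially. \<forall>(j, l) \<in> Sigma {..<k - j0} (\<lambda>j. {2 ^ (k - j)..<2 ^ Suc (k - j)}).
     \<bar>U (Suc l * 2 ^ j) \<omega> - U (l * 2 ^ j) \<omega>\<bar> \<le> sqrt (1 / sqrt 2) ^ (k - j) * \<sigma> (2 ^ k) * sqrt (ln (real k))"
proof -
  define F where "F k = Sigma {..<k - j0} (\<lambda>j. {2 ^ (k - j)..<2 ^ Suc (k - j) :: nat})" for k
  define Y where "Y k z \<omega> = U (Suc (snd z) * 2 ^ fst z) \<omega> - U (snd z * 2 ^ fst z) \<omega>" for k :: nat and z :: "nat \<times> nat" and \<omega>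
  define x where "x k z = sqrt (1 / sqrt 2) ^ (k - fst z) * \<sigma> (2 ^ k) * sqrt (ln (real k))" for k and z :: "nat \<times> nat"
  define s where "s k z = sqrt C * K * \<sigma> (2 ^ k) * (1 / sqrt 2) ^ (k - fst z)" for k and z :: "nat \<times> nat"
  have "AE \<omega> in M. \<forall>\<^sub>F k in sequentially. \<forall>z\<in>F k. \<bar>Y k z \<omega>\<bar> \<le> x k z"
  proof (rule gaussian_Borel_Cantelli)
    show "finite (F k)" for k by (simp add: F_def)
    show "gaussian_rv M (Y k z)" "expectation (Y k z) = 0" for k z
      using diff_props unfolding Y_def by auto
    show "summable (\<lambda>k. 4 * inverse (real k ^ 2))"
      by (intro summable_mult inverse_power_summable) simp
    have "\<forall>\<^sub>F k in sequentially. N0 \<le> k \<and> j0 \<le> k \<and> 4 \<le> k"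
      by (intro eventually_conj eventually_ge_at_top)
    then show "\<forall>\<^sub>F k in sequentially. (\<forall>z\<in>F k. l2norm M (Y k z) \<le> s k z \<and> 0 < s k z \<and> 0 \<le> x k z)
       \<and> (\<Sum>z\<in>F k. 2 * exp (- (x k z)\<^sup>2 / (2 * (s k z)\<^sup>2))) \<le> 4 * inverse (real k ^ 2)"
    proof eventually_elim
      case (elim k)
      have N0k: "N0 \<le> 2 ^ k" using elim by (meson less_exp less_imp_le order_trans)
      have sp: "0 < \<sigma> (2 ^ k)" using sigma_pos N0k by simp
      have lnk: "0 \<le> ln (real k)" using elim by simp
      have spos: "0 < s k z" and xpos: "0 \<le> x k z" for z
        using sp C0 K1 lnk by (auto simp: s_def x_def)
      have norm: "l2norm M (Y k z) \<le> s k z" if "z \<in> F k" for z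
      proof -
        obtain j l where z: "z = (j, l)" by (cases z)
        have jl: "j < k - j0" "2 ^ (k - j) \<le> l" "l < 2 ^ Suc (k - j)" using that by (auto simp: F_def z)
        have p: "(2::nat) ^ k = 2 ^ (k - j) * 2 ^ j" using jl by (simp add: power_add[symmetric])
        have a1: "2 ^ k \<le> l * 2 ^ j" unfolding p using jl by (intro mult_right_mono) auto
        have "l * 2 ^ j \<le> 2 ^ Suc (k - j) * 2 ^ j" using jl by (intro mult_right_mono) auto
        then have a2: "l * 2 ^ j \<le> 2 * 2 ^ k" unfolding p by simp
        have l1: "1 \<le> l" using jl(2) by (metis one_le_numeral one_le_power order_trans)
        have "(l2norm M (Y k z))\<^sup>2 \<le> C * (real (Suc l * 2 ^ j - l * 2 ^ j) / real (l * 2 ^ j)) * (\<sigma> (l * 2 ^ j))\<^sup>2"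
          unfolding Y_def z fst_conv snd_conv using N0k a1 l1 by (intro increment) auto
        also have "real (Suc l * 2 ^ j - l * 2 ^ j) / real (l * 2 ^ j) = 1 / real l" by simp
        also have "C * (1 / real l) * (\<sigma> (l * 2 ^ j))\<^sup>2 \<le> C * (1 / 2 ^ (k - j)) * (K * \<sigma> (2 ^ k))\<^sup>2"
        proof (intro mult_mono power_mono)
          have "real (2 ^ (k - j)) \<le> real l" using jl(2) by (simp only: of_nat_le_iff)
          then show "1 / real l \<le> 1 / 2 ^ (k - j)" by (intro divide_left_mono) (use l1 in auto)
          show "\<sigma> (l * 2 ^ j) \<le> K * \<sigma> (2 ^ k)" using doubling[OF N0k a1 a2] by simp
        qed (use C0 in \<open>auto simp: \<sigma>_def\<close>)
        also have "\<dots> = (s k z)\<^sup>2"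
        proof -
          have "(sqrt 2 ^ (k - j))\<^sup>2 = ((sqrt 2)\<^sup>2) ^ (k - j)" by (metis power_mult mult.commute)
          then have "(sqrt 2 ^ (k - j))\<^sup>2 = (2::real) ^ (k - j)" by simp
          then show ?thesis unfolding s_def z fst_conv using C0 by (simp add: power_mult_distrib power_divide)
        qed
        finally show ?thesis by (rule power2_le_imp_le) (use spos[of z] in simp)
      qed
      have ratio: "(x k z)\<^sup>2 / (2 * (s k z)\<^sup>2) = ln (real k) * ((sqrt 2) ^ (k - fst z) / (2 * C * K\<^sup>2))" for z
      proof -
        have e: "(1 / sqrt 2) ^ e = sqrt 2 ^ e * (((1 / sqrt 2) ^ e)\<^sup>2)" for e :: nat
          by (simp add: power2_eq_square power_divide)
        have "(sqrt (1 / sqrt 2) ^ e)\<^sup>2 = ((sqrt (1 / sqrt 2))\<^sup>2) ^ e" for e by (metis power_mult mult.commute)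
        then have "(sqrt (1 / sqrt 2) ^ e)\<^sup>2 = (1 / sqrt 2) ^ e" for e by simp
        then have "(x k z)\<^sup>2 = (1 / sqrt 2) ^ (k - fst z) * (\<sigma> (2 ^ k))\<^sup>2 * ln (real k)"
          unfolding x_def power_mult_distrib by (simp only: real_sqrt_pow2[OF lnk])
        then have X: "(x k z)\<^sup>2 = sqrt 2 ^ (k - fst z) * ((1 / sqrt 2) ^ (k - fst z))\<^sup>2 * (\<sigma> (2 ^ k))\<^sup>2 * ln (real k)"
          by (rule trans) (rule arg_cong[OF e[of "k - fst z"], of "\<lambda>v. v * (\<sigma> (2 ^ k))\<^sup>2 * ln (real k)"])
        have S: "(s k z)\<^sup>2 = C * K\<^sup>2 * (\<sigma> (2 ^ k))\<^sup>2 * ((1 / sqrt 2) ^ (k - fst z))\<^sup>2"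
          unfolding s_def using C0 by (simp add: power_mult_distrib)
        have nz: "(\<sigma> (2 ^ k))\<^sup>2 \<noteq> 0" "((1 / sqrt 2) ^ (k - fst z))\<^sup>2 \<noteq> 0" using sp by auto
        have gen: "(p * q * r * t) / (2 * (C * K\<^sup>2 * r * q)) = t * (p / (2 * C * K\<^sup>2))" if "r \<noteq> 0" "q \<noteq> 0" for p q r t :: real
          using that by (simp add: mult_ac)
        show ?thesis unfolding X S by (rule gen[OF nz])
      qed
      \<comment> \<open>The assumption on \<open>j0\<close> turns the exponent into at least
        \<open>(2 + e) * ln k\<close> with \<open>e = k - j\<close>. One factor \<open>k ^ e\<close>
        beats the \<open>2 ^ e\<close> increments of that level as soon as \<open>k \<ge> 4\<close>,
        and the remaining \<open>k\<^sup>2\<close> makes the series over \<open>k\<close>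
        converge.\<close>
      have "(\<Sum>z\<in>F k. 2 * exp (- (x k z)\<^sup>2 / (2 * (s k z)\<^sup>2))) \<le> (\<Sum>z\<in>F k. 2 * (inverse (real k ^ 2) * (1 / real k) ^ (k - fst z)))"
      proof (intro sum_mono mult_left_mono)
        fix z assume "z \<in> F k"
        then have "j0 \<le> k - fst z" by (auto simp: F_def)
        then have "ln (real k) * (2 + real (k - fst z)) \<le> (x k z)\<^sup>2 / (2 * (s k z)\<^sup>2)"
          unfolding ratio using j0 lnk by (intro mult_left_mono) auto
        then have "exp (- (x k z)\<^sup>2 / (2 * (s k z)\<^sup>2)) \<le> exp (- (real (2 + (k - fst z)) * ln (real k)))"
          by (simp add: mult.commute)
        also have "\<dots> = inverse (real k ^ (2 + (k - fst z)))"
          using elim by (simp only: exp_minus exp_of_nat_mult) simp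
        also have "\<dots> = inverse (real k ^ 2) * (1 / real k) ^ (k - fst z)"
        proof -
          have "(1 / real k) ^ e = inverse (real k ^ e)" for e by (simp add: divide_inverse power_inverse)
          then show ?thesis by (simp only: power_add inverse_mult_distrib)
        qed
        finally show "exp (- (x k z)\<^sup>2 / (2 * (s k z)\<^sup>2)) \<le> inverse (real k ^ 2) * (1 / real k) ^ (k - fst z)" .
      qed simp
      also have "\<dots> = (\<Sum>j<k - j0. \<Sum>l\<in>{2 ^ (k - j)..<2 ^ Suc (k - j) :: nat}. 2 * (inverse (real k ^ 2) * (1 / real k) ^ (k - j)))"
        unfolding F_def by (subst sum.Sigma) (auto simp: case_prod_beta)
      also have "\<dots> = (\<Sum>j<k - j0. 2 * inverse (real k ^ 2) * (2 / real k) ^ (k - j))"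
        by (intro sum.cong refl) (simp add: power_divide)
      also have "\<dots> \<le> (\<Sum>j<k - j0. 2 * inverse (real k ^ 2) * (1 / 2) ^ (k - j))"
        using elim by (intro sum_mono mult_left_mono power_mono) (auto simp: field_simps)
      also have "\<dots> = 2 * inverse (real k ^ 2) * (\<Sum>j<k - j0. (1 / 2) ^ (k - j))" by (simp add: sum_distrib_left)
      also have "\<dots> \<le> 2 * inverse (real k ^ 2) * ((1 / 2) ^ j0 / (1 - 1 / 2))"
        using elim by (intro mult_left_mono sum_reverse_geometric_le) auto
      also have "\<dots> \<le> 2 * inverse (real k ^ 2) * 2"
        by (intro mult_left_mono) (auto simp: power_le_one)
      finally have "(\<Sum>z\<in>F k. 2 * exp (- (x k z)\<^sup>2 / (2 * (s k z)\<^sup>2))) \<le> 4 * inverse (real k ^ 2)" by simp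
      then show ?case using norm spos xpos by blast
    qed
  qed
  then show ?thesis by (simp add: F_def Y_def x_def case_prod_beta)
qed

end

context gaussian_lil
begin

lemma LIL_upper:
  assumes "0 < \<epsilon>"
  shows "AE \<omega> in M. \<forall>\<^sub>F n in sequentially. \<bar>U n \<omega>\<bar> \<le> (1 + \<epsilon>) * (\<sigma> n * sqrt (2 * ln (ln (real n))))"
proof -
  define q where "q = sqrt (1 / sqrt 2)"
  have q: "0 < q" "q < 1" by (auto simp: q_def)
  define \<delta> where "\<delta> = \<epsilon> / 2"
  have d: "0 < \<delta>" using assms by (simp add: \<delta>_def)
  \<comment> \<open>The final constant, assembled from the skeleton bound, the passage from the
    standard deviation at the skeleton point to that at \<open>n\<close>, and the geometric sum of
    the chaining thresholds. It tends to \<open>1 + \<delta>\<close>, strictly below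
    \<open>1 + \<epsilon>\<close>, as the skeleton is refined.\<close>
  have "(\<lambda>j0. (1 + \<delta>) * (1 + K * sqrt C * sqrt ((1 / 2) ^ j0)) + q ^ j0 / (1 - q) * K)
     \<longlonglongrightarrow> (1 + \<delta>) * (1 + K * sqrt C * sqrt 0) + 0 / (1 - q) * K"
    using q by (intro tendsto_intros LIMSEQ_power_zero) auto
  then have "\<forall>\<^sub>F j0 in sequentially. (1 + \<delta>) * (1 + K * sqrt C * sqrt ((1 / 2) ^ j0)) + q ^ j0 / (1 - q) * K < 1 + \<epsilon>"
    by (rule order_tendstoD) (use assms in \<open>simp add: \<delta>_def\<close>)
  moreover have "\<forall>\<^sub>F j0 in sequentially. \<forall>e\<ge>j0. 2 + real e \<le> (sqrt 2) ^ e / (2 * C * K\<^sup>2)"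
  proof -
    have "0 < 2 * C * K\<^sup>2" using C0 K1 by simp
    moreover have "\<forall>\<^sub>F e in sequentially. (2 + real e) * D \<le> (sqrt 2) ^ e" if "0 < D" for D :: real
      using that by real_asymp
    ultimately have "\<forall>\<^sub>F e in sequentially. (2 + real e) * (2 * C * K\<^sup>2) \<le> (sqrt 2) ^ e" by blast
    then have "\<forall>\<^sub>F e in sequentially. 2 + real e \<le> (sqrt 2) ^ e / (2 * C * K\<^sup>2)"
      using \<open>0 < 2 * C * K\<^sup>2\<close> by (simp only: pos_le_divide_eq)
    then show ?thesis unfolding eventually_sequentially by (meson order_trans)
  qed
  ultimately have "\<forall>\<^sub>F j0 in sequentially. (1 + \<delta>) * (1 + K * sqrt C * sqrt ((1 / 2) ^ j0)) + q ^ j0 / (1 - q) * K < 1 + \<epsilon> \<and>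
     (\<forall>e\<ge>j0. 2 + real e \<le> (sqrt 2) ^ e / (2 * C * K\<^sup>2))" by (rule eventually_conj)
  then obtain j0 where j1: "(1 + \<delta>) * (1 + K * sqrt C * sqrt ((1 / 2) ^ j0)) + q ^ j0 / (1 - q) * K < 1 + \<epsilon>"
    and j2: "\<And>e. j0 \<le> e \<Longrightarrow> 2 + real e \<le> (sqrt 2) ^ e / (2 * C * K\<^sup>2)"
    unfolding eventually_sequentially by blast
  have "AE \<omega> in M. \<forall>\<^sub>F k in sequentially. \<forall>(j, l) \<in> Sigma {..<k - j0} (\<lambda>j. {2 ^ (k - j)..<2 ^ Suc (k - j)}).
     \<bar>U (Suc l * 2 ^ j) \<omega> - U (l * 2 ^ j) \<omega>\<bar> \<le> sqrt (1 / sqrt 2) ^ (k - j) * \<sigma> (2 ^ k) * sqrt (ln (real k))"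
    using j2 by (rule chain_bound)
  with skeleton_bound[OF d, of j0] show ?thesis
  proof eventually_elim
    case (elim \<omega>)
    have "\<forall>\<^sub>F k in sequentially. N0 \<le> k \<and> j0 \<le> k \<and> 3 \<le> k"
      by (intro eventually_conj eventually_ge_at_top)
    with elim have "\<forall>\<^sub>F k in sequentially. \<forall>n. 2 ^ k \<le> n \<longrightarrow> n < 2 ^ Suc k \<longrightarrow> \<bar>U n \<omega>\<bar> \<le> (1 + \<epsilon>) * (\<sigma> n * sqrt (2 * ln (ln (real n))))"
    proof eventually_elim
      case (elim k)
      show ?case
      proof (intro allI impI)
        fix n :: nat assume n: "2 ^ k \<le> n" "n < 2 ^ Suc k"
        have N0k: "N0 \<le> 2 ^ k" using elim by (meson less_exp less_imp_le order_trans)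
        define m where "m = n div 2 ^ (k - j0)"
        define b where "b = m * 2 ^ (k - j0)"
        have p: "(2::nat) ^ k = 2 ^ j0 * 2 ^ (k - j0)" using elim by (simp add: power_add[symmetric])
        have m: "2 ^ j0 \<le> m" "m < 2 ^ Suc j0"
          using n p by (auto simp: m_def less_eq_div_iff_mult_less_eq div_less_iff_less_mult)
        have bk: "2 ^ k \<le> b" unfolding b_def p using m by (intro mult_right_mono) auto
        have bn: "b \<le> n" "n - b \<le> 2 ^ (k - j0)"
          unfolding b_def m_def by (auto simp: minus_div_mult_eq_mod intro!: less_imp_le)
        have n2b: "n \<le> 2 * b" using n(2) bk by simp
        have snpos: "0 < \<sigma> n" "0 < \<sigma> b" using N0k bk bn by (auto intro!: sigma_pos)
        define \<Lambda> where "\<Lambda> = sqrt (2 * ln (ln (real n)))"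
        have l2: "2 / 3 * real k \<le> real k * ln 2" using ln2_ge_two_thirds mult_left_mono[of "2 / 3" "ln 2" "real k"] by simp
        have k3: "3 \<le> real k" using elim by simp
        have b0: "0 < b" using bk by (metis gr0I le_zero_eq power_not_zero zero_neq_numeral)
        have lnb: "real k * ln 2 \<le> ln (real b)"
        proof -
          have "real (2 ^ k) \<le> real b" using bk by (simp only: of_nat_le_iff)
          then have "ln (real (2 ^ k)) \<le> ln (real b)"
            using b0 by (subst ln_le_cancel_iff) auto
          then show ?thesis by (simp add: ln_realpow)
        qed
        have lnbn: "ln (real b) \<le> ln (real n)" using bn b0 by simp
        have lnb1: "1 < ln (real b)" using lnb l2 k3 by linarith
        have lln: "0 < ln (ln (real b))" "ln (ln (real b)) \<le> ln (ln (real n))" using lnb1 lnbn by auto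
        have Lb: "sqrt (2 * ln (ln (real b))) \<le> \<Lambda>" using lln by (simp add: \<Lambda>_def)
        have Lk: "sqrt (ln (real k)) \<le> \<Lambda>"
        proof -
          \<comment> \<open>The chaining thresholds contain \<open>ln k\<close>, the claim
            \<open>2 * ln (ln n)\<close>. Since \<open>ln n\<close> is at least
            \<open>2 * k / 3\<close>, it suffices that \<open>k \<le> (2 * k / 3)\<^sup>2\<close>,
            which holds from \<open>k = 3\<close> on.\<close>
          have "ln (real k) \<le> 2 * ln (real k * (2 / 3))"
          proof -
            have "real k * 1 \<le> real k * (real k * (4 / 9))" using k3 by (intro mult_left_mono) auto
            then have "real k \<le> (real k * (2 / 3))\<^sup>2" by (simp add: power2_eq_square)
            then have "ln (real k) \<le> ln ((real k * (2 / 3))\<^sup>2)" using k3 by simp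
            also have "\<dots> = 2 * ln (real k * (2 / 3))" using k3 by (subst ln_realpow) auto
            finally show ?thesis .
          qed
          also have "ln (real k * (2 / 3)) \<le> ln (ln (real n))"
          proof -
            have 1: "real k * (2 / 3) \<le> ln (real n)" using l2 lnb lnbn by linarith
            have 2: "0 < real k * (2 / 3)" using k3 by linarith
            with 1 have "0 < ln (real n)" by linarith
            with 1 2 show ?thesis by (simp only: ln_le_cancel_iff)
          qed
          finally show ?thesis unfolding \<Lambda>_def by simp
        qed
        have L0: "0 \<le> \<Lambda>" unfolding \<Lambda>_def using lln by simp
        have E1: "\<bar>U b \<omega>\<bar> \<le> (1 + \<delta>) * \<sigma> b * sqrt (2 * ln (ln (real b)))"
          using elim m unfolding b_def by auto
        have diffn: "l2norm M (\<lambda>\<omega>. U n \<omega> - U b \<omega>) \<le> sqrt C * sqrt ((1 / 2) ^ j0) * \<sigma> b"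
        proof (rule power2_le_imp_le)
          have "(l2norm M (\<lambda>\<omega>. U n \<omega> - U b \<omega>))\<^sup>2 \<le> C * (real (n - b) / real b) * (\<sigma> b)\<^sup>2"
            using N0k bk bn n2b by (intro increment) auto
          also have "\<dots> \<le> C * (1 / 2) ^ j0 * (\<sigma> b)\<^sup>2"
          proof (intro mult_right_mono mult_left_mono)
            have "real (n - b) / real b \<le> real (2 ^ (k - j0)) / real (2 ^ k)"
              using bn bk by (intro frac_le) (auto simp only: of_nat_le_iff of_nat_0_le_iff of_nat_0_less_iff zero_less_power zero_less_numeral)
            also have "\<dots> = (1 / 2) ^ j0" unfolding p by (simp add: power_divide)
            finally show "real (n - b) / real b \<le> (1 / 2) ^ j0" .
          qed (use C0 in auto)
          also have "\<dots> = (sqrt C * sqrt ((1 / 2) ^ j0) * \<sigma> b)\<^sup>2" using C0 by (simp add: power_mult_distrib)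
          finally show "(l2norm M (\<lambda>\<omega>. U n \<omega> - U b \<omega>))\<^sup>2 \<le> (sqrt C * sqrt ((1 / 2) ^ j0) * \<sigma> b)\<^sup>2" .
        qed (use C0 snpos in auto)
        have Kb: "\<sigma> b \<le> K * \<sigma> n" using doubling[of b n] N0k bk bn n2b by auto
        \<comment> \<open>Doubling would only give the factor \<open>K\<close> here. The triangle
          inequality with the small increment from \<open>b\<close> to \<open>n\<close> makes the
          ratio of the standard deviations close to 1, as the sharp constant requires.\<close>
        have "\<sigma> b \<le> \<sigma> n + sqrt C * sqrt ((1 / 2) ^ j0) * \<sigma> b"
          using l2norm_triangle_diff[OF U_props(3)[of n] U_props(3)[of b]] diffn by (simp add: \<sigma>_def)
        also have "\<dots> \<le> \<sigma> n + sqrt C * sqrt ((1 / 2) ^ j0) * (K * \<sigma> n)"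
          using Kb C0 by (intro add_left_mono mult_left_mono) auto
        finally have sb: "\<sigma> b \<le> (1 + K * sqrt C * sqrt ((1 / 2) ^ j0)) * \<sigma> n" by (simp add: algebra_simps)
        have E2: "\<bar>U n \<omega> - U b \<omega>\<bar> \<le> (\<Sum>j<k - j0. q ^ (k - j) * \<sigma> (2 ^ k) * sqrt (ln (real k)))"
          unfolding b_def m_def
        proof (rule dyadic_chain_bound[OF n])
          fix i l :: nat assume il: "i < k - j0" "2 ^ (k - i) \<le> l" "l < 2 ^ Suc (k - i)"
          have "(i, l) \<in> Sigma {..<k - j0} (\<lambda>j. {2 ^ (k - j)..<2 ^ Suc (k - j) :: nat})" using il by auto
          then show "\<bar>U (Suc l * 2 ^ i) \<omega> - U (l * 2 ^ i) \<omega>\<bar> \<le> q ^ (k - i) * \<sigma> (2 ^ k) * sqrt (ln (real k))"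
            using elim unfolding q_def by fast
        qed (use q k3 in \<open>auto simp: \<sigma>_def\<close>)
        also have "\<dots> = (\<Sum>j<k - j0. q ^ (k - j)) * (\<sigma> (2 ^ k) * sqrt (ln (real k)))"
          by (simp add: sum_distrib_right mult.assoc)
        also have "\<dots> \<le> (q ^ j0 / (1 - q)) * (K * \<sigma> n * \<Lambda>)"
        proof (intro mult_mono sum_reverse_geometric_le)
          show "\<sigma> (2 ^ k) \<le> K * \<sigma> n" using doubling[of "2 ^ k" n] N0k n by auto
        qed (use q Lk elim snpos K1 k3 L0 in \<open>auto simp: \<sigma>_def\<close>)
        finally have E2': "\<bar>U n \<omega> - U b \<omega>\<bar> \<le> (q ^ j0 / (1 - q)) * (K * \<sigma> n * \<Lambda>)" .
        have "\<bar>U b \<omega>\<bar> \<le> (1 + \<delta>) * ((1 + K * sqrt C * sqrt ((1 / 2) ^ j0)) * \<sigma> n) * \<Lambda>"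
          using E1 by (rule order_trans) (intro mult_mono sb Lb order_refl, use d snpos lln C0 K1 in auto)
        then have "\<bar>U n \<omega>\<bar> \<le> ((1 + \<delta>) * (1 + K * sqrt C * sqrt ((1 / 2) ^ j0)) + q ^ j0 / (1 - q) * K) * (\<sigma> n * \<Lambda>)"
          using E2' by (simp add: algebra_simps)
        also have "\<dots> \<le> (1 + \<epsilon>) * (\<sigma> n * \<Lambda>)" using j1 snpos L0 by (intro mult_right_mono) auto
        finally show "\<bar>U n \<omega>\<bar> \<le> (1 + \<epsilon>) * (\<sigma> n * sqrt (2 * ln (ln (real n))))" unfolding \<Lambda>_def .
      qed
    qed
    then show ?case by (rule eventually_dyadic)
  qed
qed

end

section \<open>Law of the iterated logarithm: lower bound\<close>

text \<open>Second moment method: pairwise covariances with a summable product bound make the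
  variance of the partial sums at most their mean plus a constant. As the means diverge, Chebyshev's
  inequality gives probability 0 to the event that the partial sums remain bounded.\<close>

lemma (in prob_space) infinitely_often_positive:
  fixes f :: "nat \<Rightarrow> 'a \<Rightarrow> real"
  assumes m[measurable]: "\<And>k. f k \<in> borel_measurable M"
    and f01: "\<And>k \<omega>. 0 \<le> f k \<omega>" "\<And>k \<omega>. f k \<omega> \<le> 1"
    and cov: "\<And>k l. k \<noteq> l \<Longrightarrow> expectation (\<lambda>\<omega>. f k \<omega> * f l \<omega>) \<le> expectation (f k) * expectation (f l) + b k * b l"
    and b: "\<And>k. 0 \<le> b k" "summable b" and div: "\<not> summable (\<lambda>k. expectation (f k))"
  shows "AE \<omega> in M. \<exists>\<^sub>F k in sequentially. 0 < f k \<omega>"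
proof -
  define T where "T N \<omega> = (\<Sum>k<N. f k \<omega>)" for N \<omega>
  define \<mu> where "\<mu> N = (\<Sum>k<N. expectation (f k))" for N
  define B where "B = (\<Sum>k. b k)\<^sup>2"
  have [measurable]: "T N \<in> borel_measurable M" for N unfolding T_def by measurable
  have fi: "integrable M (f k)" and ffi: "integrable M (\<lambda>\<omega>. f k \<omega> * f l \<omega>)" for k l
    using f01 by (auto intro!: integrable_const_bound[of _ 1] AE_I2 mult_le_one)
  have E0: "0 \<le> expectation (f k)" for k using f01 by simp
  have ET: "expectation (T N) = \<mu> N" for N unfolding T_def \<mu>_def using fi by (intro Bochner_Integration.integral_sum) auto
  have Tb: "0 \<le> T N \<omega>" "T N \<omega> \<le> real N" for N \<omega>
    using f01 sum_mono[of "{..<N}" "\<lambda>k. f k \<omega>" "\<lambda>_. 1"] by (auto simp: T_def intro!: sum_nonneg)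
  have Ti: "integrable M (T N)" for N by (rule integrable_const_bound[of _ "real N"]) (use Tb in auto)
  have T2: "(\<lambda>\<omega>. (T N \<omega>)\<^sup>2) = (\<lambda>\<omega>. \<Sum>k<N. \<Sum>l<N. f k \<omega> * f l \<omega>)" for N
    by (simp add: T_def power2_eq_square sum_product)
  have T2i: "integrable M (\<lambda>\<omega>. (T N \<omega>)\<^sup>2)" for N unfolding T2 using ffi by (intro Bochner_Integration.integrable_sum) auto
  have Var: "expectation (\<lambda>\<omega>. (T N \<omega> - \<mu> N)\<^sup>2) \<le> \<mu> N + B" for N
  proof -
    have "expectation (\<lambda>\<omega>. (T N \<omega> - \<mu> N)\<^sup>2) = expectation (\<lambda>\<omega>. (T N \<omega>)\<^sup>2) - (\<mu> N)\<^sup>2"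
      using variance_eq[OF Ti T2i] by (simp add: ET)
    also have "\<dots> = (\<Sum>k<N. \<Sum>l<N. expectation (\<lambda>\<omega>. f k \<omega> * f l \<omega>) - expectation (f k) * expectation (f l))"
      unfolding T2 using ffi by (simp add: Bochner_Integration.integral_sum Bochner_Integration.integrable_sum \<mu>_def power2_eq_square sum_product sum_subtractf)
    \<comment> \<open>On the diagonal no covariance bound is available, but values in
      \<open>{0..1}\<close> satisfy \<open>f\<^sup>2 \<le> f\<close>; these terms contribute the
      mean \<open>\<mu> N\<close>.\<close>
    also have "\<dots> \<le> (\<Sum>k<N. \<Sum>l<N. (if k = l then expectation (f k) else 0) + b k * b l)"
    proof (intro sum_mono)
      fix k l
      show "expectation (\<lambda>\<omega>. f k \<omega> * f l \<omega>) - expectation (f k) * expectation (f l) \<le> (if k = l then expectation (f k) else 0) + b k * b l"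
      proof (cases "k = l")
        case True
        have "expectation (\<lambda>\<omega>. f k \<omega> * f k \<omega>) \<le> expectation (f k)"
          using f01 by (intro integral_mono ffi fi) (simp add: mult_left_le)
        moreover have "0 \<le> expectation (f k) * expectation (f k)" "0 \<le> b k * b k" using b by auto
        ultimately show ?thesis unfolding True by (simp only: refl if_True)
      qed (use cov[of k l] in auto)
    qed
    also have "\<dots> = \<mu> N + (\<Sum>k<N. b k)\<^sup>2"
      by (simp add: sum.distrib \<mu>_def power2_eq_square sum_product)
    also have "(\<Sum>k<N. b k)\<^sup>2 \<le> B"
      unfolding B_def using b by (intro power_mono sum_le_suminf sum_nonneg) auto
    finally show ?thesis by simp
  qed
  have null: "AE \<omega> in M. \<exists>N. real m < T N \<omega>" for m
  proof -
    define A where "A = {\<omega> \<in> space M. \<forall>N. T N \<omega> \<le> real m}"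
    have [measurable]: "A \<in> sets M" unfolding A_def by measurable
    have "prob A = 0"
    proof (rule ccontr)
      assume "prob A \<noteq> 0"
      then have pA: "0 < prob A" by (simp add: order_less_le)
      \<comment> \<open>Chebyshev's bound for the event \<open>T N \<le> m\<close>, as a function of
        \<open>x = \<mu> N\<close>: the variance grows at most linearly in the mean, the squared
        distance quadratically.\<close>
      have "((\<lambda>x. (x + B) / (x - real m)\<^sup>2) \<longlongrightarrow> 0) at_top" by real_asymp
      from order_tendstoD(2)[OF this pA] have "\<forall>\<^sub>F x in at_top. (x + B) / (x - real m)\<^sup>2 < prob A \<and> real m < x"
        by (intro eventually_conj eventually_gt_at_top)
      then obtain x0 where x0: "\<And>x. x0 \<le> x \<Longrightarrow> (x + B) / (x - real m)\<^sup>2 < prob A \<and> real m < x"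
        unfolding eventually_at_top_linorder by blast
      obtain N where N: "x0 < \<mu> N"
        using div summableI_nonneg_bounded[of "\<lambda>k. expectation (f k)" x0] E0 unfolding \<mu>_def by (meson linorder_not_less)
      then have mN: "real m < \<mu> N" "(\<mu> N + B) / (\<mu> N - real m)\<^sup>2 < prob A" using x0[of "\<mu> N"] by auto
      have "prob A \<le> prob {\<omega> \<in> space M. (\<mu> N - real m)\<^sup>2 \<le> (T N \<omega> - \<mu> N)\<^sup>2}"
      proof (rule finite_measure_mono)
        show "A \<subseteq> {\<omega> \<in> space M. (\<mu> N - real m)\<^sup>2 \<le> (T N \<omega> - \<mu> N)\<^sup>2}"
        proof
          fix \<omega> assume "\<omega> \<in> A"
          then have "T N \<omega> \<le> real m" "\<omega> \<in> space M" by (auto simp: A_def)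
          then have "(\<mu> N - real m)\<^sup>2 \<le> (\<mu> N - T N \<omega>)\<^sup>2" using mN by (intro power_mono) auto
          then show "\<omega> \<in> {\<omega> \<in> space M. (\<mu> N - real m)\<^sup>2 \<le> (T N \<omega> - \<mu> N)\<^sup>2}"
            using \<open>\<omega> \<in> space M\<close> by (simp add: power2_commute)
        qed
      qed measurable
      also have "\<dots> \<le> expectation (\<lambda>\<omega>. (T N \<omega> - \<mu> N)\<^sup>2) / (\<mu> N - real m)\<^sup>2"
      proof (rule integral_Markov_inequality_measure[where A = "{}"])
        show "integrable M (\<lambda>\<omega>. (T N \<omega> - \<mu> N)\<^sup>2)"
          using T2i[of N] Ti[of N] by (simp add: power2_diff)
      qed (use mN in auto)
      also have "\<dots> \<le> (\<mu> N + B) / (\<mu> N - real m)\<^sup>2" using Var by (intro divide_right_mono) auto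
      finally show False using mN by simp
    qed
    then have "AE \<omega> in M. \<omega> \<notin> A" by (simp add: AE_iff_measurable[of A] emeasure_eq_measure A_def)
    then show ?thesis by (rule AE_mp) (auto simp: A_def not_le)
  qed
  have "AE \<omega> in M. \<forall>m. \<exists>N. real m < T N \<omega>" using null by (simp add: AE_all_countable)
  then show ?thesis
  proof eventually_elim
    case (elim \<omega>)
    show ?case
    proof (rule ccontr)
      assume "\<not> ?case"
      then obtain k1 where k1: "\<And>k. k1 \<le> k \<Longrightarrow> f k \<omega> = 0"
        unfolding frequently_def eventually_sequentially using f01 by (metis order_antisym_conv not_less)
      obtain N where N: "real k1 < T N \<omega>" using elim by blast
      have "T N \<omega> \<le> (\<Sum>k<N + k1. f k \<omega>)" unfolding T_def by (rule sum_mono2) (use f01 in auto)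
      also have "\<dots> = (\<Sum>k<k1. f k \<omega>)" by (rule sum.mono_neutral_right) (use k1 in \<open>auto simp: not_less\<close>)
      also have "\<dots> \<le> real k1" using Tb(2)[of k1 \<omega>] by (simp add: T_def)
      finally show False using N by simp
    qed
  qed
qed

text \<open>On \<open>{y + 1..y + 2}\<close> the ramp equals 1 and the density is at least its value
  at \<open>y + 2\<close>. The crude shift by 2 is harmless because thresholds grow like the square
  root of a logarithm and have room below the critical level.\<close>

lemma std_normal_clamp_lower:
  assumes "0 \<le> y"
  shows "exp (- (y + 2)\<^sup>2 / 2) / sqrt (2 * pi) \<le> (LINT x|std_normal_distribution. max 0 (min 1 (x - y)))"
proof -
  have "exp (- (y + 2)\<^sup>2 / 2) / sqrt (2 * pi) = (LINT x|lborel. std_normal_density (y + 2) * indicator {y + 1..y + 2} x)"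
    by (simp add: std_normal_density_def)
  also have "\<dots> \<le> (LINT x|lborel. std_normal_density x * max 0 (min 1 (x - y)))"
  proof (rule integral_mono)
    show "integrable lborel (\<lambda>x. std_normal_density (y + 2) * indicator {y + 1..y + 2} x)" by simp
    show "integrable lborel (\<lambda>x. std_normal_density x * max 0 (min 1 (x - y)))"
      by (rule Bochner_Integration.integrable_bound[of _ std_normal_density]) (auto simp: abs_mult mult_left_le)
    fix x :: real
    show "std_normal_density (y + 2) * indicator {y + 1..y + 2} x \<le> std_normal_density x * max 0 (min 1 (x - y))"
    proof (cases "x \<in> {y + 1..y + 2}")
      case True
      then have "x\<^sup>2 \<le> (y + 2)\<^sup>2" using assms by (intro power_mono) auto
      then have "std_normal_density (y + 2) \<le> std_normal_density x" by (simp add: std_normal_density_def divide_right_mono)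
      then show ?thesis using True by simp
    qed auto
  qed
  also have "\<dots> = (LINT x|std_normal_distribution. max 0 (min 1 (x - y)))"
    by (subst integral_density) auto
  finally show ?thesis .
qed

text \<open>Since \<open>fact k \<le> k ^ k\<close>, the iterated logarithm is at most
  \<open>ln (p * k * ln k)\<close>, which is asymptotic to \<open>ln k\<close>; the factor
  \<open>b < 1\<close> leaves room for the shift by 2. The bound makes the ramp expectations at
  least of order \<open>1 / k\<close>, the terms of a divergent series.\<close>

lemma lil_threshold_le_ln:
  fixes b :: real
  assumes "0 < b" "b < 1" "1 \<le> p"
  shows "\<forall>\<^sub>F k in sequentially. (b * sqrt (2 * ln (ln (real (fact k ^ p)))) + 2)\<^sup>2 / 2 \<le> ln (real k)"
proof -
  define L where "L k = ln (real p * (real k * ln (real k)))" for k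
  have p: "0 < real p" using assms by simp
  have l1: "(\<lambda>k. L k / ln (real k)) \<longlonglongrightarrow> 1" unfolding L_def using p by real_asymp
  have l2: "(\<lambda>k. 1 / ln (real k)) \<longlonglongrightarrow> 0" by real_asymp
  have "(\<lambda>k. (b * sqrt (L k / ln (real k)) + sqrt 2 * sqrt (1 / ln (real k)))\<^sup>2) \<longlonglongrightarrow> (b * sqrt 1 + sqrt 2 * sqrt 0)\<^sup>2"
    by (intro tendsto_intros l1 l2)
  moreover have "(b * sqrt 1 + sqrt 2 * sqrt 0)\<^sup>2 < 1" using assms by (simp add: power_less_one_iff)
  ultimately have "\<forall>\<^sub>F k in sequentially. (b * sqrt (L k / ln (real k)) + sqrt 2 * sqrt (1 / ln (real k)))\<^sup>2 < 1"
    by (rule order_tendstoD)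
  moreover have "\<forall>\<^sub>F k in sequentially. 3 \<le> k" by (rule eventually_ge_at_top)
  ultimately show ?thesis
  proof eventually_elim
    case (elim k)
    have "ln 3 \<le> ln (real k)" using elim by (subst ln_le_cancel_iff) auto
    then have lk: "1 < ln (real k)" using ln3_gt_1 by linarith
    have f1: "real k \<le> real (fact k ^ p)"
    proof -
      have "k \<le> fact k" by (rule fact_ge_self)
      also have "fact k \<le> (fact k ^ p :: nat)" using assms(3) by (intro self_le_power) (auto simp: fact_ge_1)
      finally show ?thesis by (simp only: of_nat_le_iff)
    qed
    then have "ln (real k) \<le> ln (real (fact k ^ p))" using elim by (subst ln_le_cancel_iff) auto
    then have lf1: "1 < ln (real (fact k ^ p))" using lk by linarith
    have "real (fact k ^ p) \<le> real ((k ^ k) ^ p)"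
      using fact_le_power[of k, where 'a=nat] by (simp only: of_nat_le_iff) (intro power_mono, auto)
    then have "ln (real (fact k ^ p)) \<le> ln (real ((k ^ k) ^ p))"
      using elim f1 by (subst ln_le_cancel_iff) auto
    also have "\<dots> = real p * (real k * ln (real k))" using elim by (simp add: ln_realpow)
    finally have up: "ln (real (fact k ^ p)) \<le> real p * (real k * ln (real k))" .
    have "0 < ln (real (fact k ^ p))" using lf1 by linarith
    moreover from this up have "0 < real p * (real k * ln (real k))" by linarith
    ultimately have "ln (ln (real (fact k ^ p))) \<le> L k" unfolding L_def using up by (simp only: ln_le_cancel_iff)
    moreover have "0 \<le> ln (ln (real (fact k ^ p)))" using lf1 by (intro ln_ge_zero) linarith
    ultimately have "(b * sqrt (2 * ln (ln (real (fact k ^ p)))) + 2)\<^sup>2 \<le> (b * sqrt (2 * L k) + 2)\<^sup>2"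
      using assms by (intro power_mono add_right_mono mult_left_mono) auto
    also have "b * sqrt (2 * L k) + 2 = sqrt (2 * ln (real k)) * (b * sqrt (L k / ln (real k)) + sqrt 2 * sqrt (1 / ln (real k)))"
    proof -
      have "sqrt (2 * ln (real k)) * sqrt (L k / ln (real k)) = sqrt (2 * L k)"
        using lk by (simp flip: real_sqrt_mult)
      moreover have "sqrt (2 * ln (real k)) * (sqrt 2 * sqrt (1 / ln (real k))) = 2"
        using lk by (simp flip: real_sqrt_mult)
      ultimately show ?thesis by (simp add: ring_distribs)
    qed
    also have "(\<dots>)\<^sup>2 \<le> 2 * ln (real k) * 1"
      unfolding power_mult_distrib using elim lk by (intro mult_mono) auto
    finally show ?case by simp
  qed
qed

context gaussian_lil
begin

text \<open>The sign \<open>s\<close> provides the statement for the process and for its negative,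
  that is, for the limit superior and the limit inferior. It cancels in all covariances.\<close>

lemma LIL_lower:
  assumes e: "0 < \<epsilon>" "\<epsilon> < 1" and sgn: "\<bar>s\<bar> = 1"
  shows "AE \<omega> in M. \<exists>\<^sub>F n in sequentially. (1 - \<epsilon>) * (\<sigma> n * sqrt (2 * ln (ln (real n)))) \<le> s * U n \<omega>"
proof -
  \<comment> \<open>With \<open>p * \<eta> \<ge> 4\<close> the correlations for \<open>k < l\<close>
    are at most of order \<open>1 / l ^ 4\<close>, hence at most
    \<open>C / (k\<^sup>2 * l\<^sup>2)\<close>. This is the product of summable factors that the
    second moment method asks for.\<close>
  obtain p :: nat where p0: "4 / \<eta> < real p" using reals_Archimedean2 by blast
  have p: "4 \<le> real p * \<eta>" "1 \<le> p"
  proof -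
    show "4 \<le> real p * \<eta>" using p0 eta by (simp add: field_simps)
    have "0 < 4 / \<eta>" using eta by simp
    with p0 have "0 < real p" by linarith
    then show "1 \<le> p" by simp
  qed
  \<comment> \<open>consecutive ratios are \<open>k ^ p\<close>, so the correlations are summable, while still \<open>ln (ln (nn k)) \<sim> ln k\<close>\<close>
  define nn where "nn k = (fact k ^ p :: nat)" for k
  have kn: "k \<le> nn k" for k
  proof -
    have "k \<le> fact k" by (rule fact_ge_self)
    also have "fact k \<le> (fact k ^ p :: nat)" using p(2) by (intro self_le_power) (auto simp: fact_ge_1)
    finally show ?thesis by (simp add: nn_def)
  qed
  have nnpos: "0 < nn k" for k by (simp add: nn_def)
  define y where "y k = (1 - \<epsilon>) * sqrt (2 * ln (ln (real (nn k))))" for k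
  have "\<forall>\<^sub>F k in sequentially. (y k + 2)\<^sup>2 / 2 \<le> ln (real k) \<and> N0 \<le> k \<and> 3 \<le> k"
    unfolding y_def nn_def using e p by (intro eventually_conj lil_threshold_le_ln eventually_ge_at_top) auto
  then obtain k0 where k0: "\<And>k. k0 \<le> k \<Longrightarrow> (y k + 2)\<^sup>2 / 2 \<le> ln (real k)" "\<And>k. k0 \<le> k \<Longrightarrow> N0 \<le> k \<and> 3 \<le> k"
    unfolding eventually_sequentially by blast
  have N0nn: "N0 \<le> nn k" if "k0 \<le> k" for k using k0(2)[OF that] kn[of k] by linarith
  have y0: "0 \<le> y k" if "k0 \<le> k" for k
  proof -
    have "3 \<le> real (nn k)" using k0(2)[OF that] kn[of k] by linarith
    then have "ln 3 \<le> ln (real (nn k))" by (subst ln_le_cancel_iff) auto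
    then have "1 \<le> ln (real (nn k))" using ln3_gt_1 by linarith
    then show ?thesis using e by (simp add: y_def)
  qed
  define Z where "Z k \<omega> = s / \<sigma> (nn k) * U (nn k) \<omega>" for k \<omega>
  have sp: "0 < \<sigma> (nn k)" if "k0 \<le> k" for k using sigma_pos N0nn[OF that] by simp
  have ZZ: "gaussian_pair (Z k) (Z l)" for k l
    using gaussian_pair_linear[OF pair[of "nn k" "nn l"], of "s / \<sigma> (nn k)" 0 0 "s / \<sigma> (nn l)"] by (simp add: Z_def[abs_def])
  have Z1: "l2norm M (Z k) = 1" if "k0 \<le> k" for k
    unfolding Z_def l2norm_cmult using sp[OF that] sgn by (simp add: \<sigma>_def abs_divide)
  have ss: "s * s = 1" using sgn by (metis abs_mult_self_eq mult_1)
  have Zcov: "\<bar>expectation (\<lambda>\<omega>. Z k \<omega> * Z l \<omega>)\<bar> \<le> C * (inverse (real k ^ 2) * inverse (real l ^ 2))" if kl: "k0 \<le> k" "k < l" for k l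
  proof -
    have l3: "3 \<le> real l" "3 \<le> real k" using k0(2)[of l] k0(2)[of k] kl by auto
    have "l * fact k \<le> (fact l :: nat)"
    proof -
      have "fact k \<le> (fact (l - 1) :: nat)" using kl by (intro fact_mono_nat) auto
      then have "l * fact k \<le> l * fact (l - 1)" by (rule mult_left_mono) simp
      also have "l * fact (l - 1) = (fact l :: nat)" using kl by (simp add: fact_reduce)
      finally show ?thesis .
    qed
    then have "(l * fact k) ^ p \<le> (fact l :: nat) ^ p" by (rule power_mono) simp
    then have nl: "l ^ p * nn k \<le> nn l" by (simp add: nn_def power_mult_distrib)
    have "l \<le> l ^ p" using p(2) l3 by (intro self_le_power) auto
    then have "2 \<le> l ^ p" using l3 by linarith
    then have "2 * nn k \<le> nn l" using nl mult_right_mono[of 2 "l ^ p" "nn k"] by linarith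
    then have c: "\<bar>expectation (\<lambda>\<omega>. U (nn k) \<omega> * U (nn l) \<omega>)\<bar> \<le> C * (real (nn k) / real (nn l)) powr \<eta> * \<sigma> (nn k) * \<sigma> (nn l)"
      using N0nn[OF kl(1)] by (intro covariance)
    have "real (nn k) / real (nn l) \<le> inverse (real l ^ p)"
    proof -
      have "real (l ^ p * nn k) \<le> real (nn l)" using nl by (simp only: of_nat_le_iff)
      then show ?thesis using l3 nnpos[of l] by (simp add: field_simps)
    qed
    then have "(real (nn k) / real (nn l)) powr \<eta> \<le> inverse (real l ^ p) powr \<eta>"
      using eta by (intro powr_mono2) auto
    also have "\<dots> = inverse (real l powr (real p * \<eta>))"
      using l3 by (simp add: powr_realpow[symmetric] powr_powr powr_minus[symmetric] flip: powr_minus)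
    also have "\<dots> \<le> inverse (real l powr 4)"
      using l3 p(1) by (intro le_imp_inverse_le powr_mono) auto
    also have "real l powr 4 = real l ^ 2 * real l ^ 2"
      using l3 by (simp add: powr_numeral flip: power_add)
    also have "inverse (real l ^ 2 * real l ^ 2) \<le> inverse (real k ^ 2 * real l ^ 2)"
      using l3 kl by (intro le_imp_inverse_le mult_right_mono power_mono) auto
    finally have r: "(real (nn k) / real (nn l)) powr \<eta> \<le> inverse (real k ^ 2) * inverse (real l ^ 2)" by simp
    have "expectation (\<lambda>\<omega>. Z k \<omega> * Z l \<omega>) = expectation (\<lambda>\<omega>. (s * s / (\<sigma> (nn k) * \<sigma> (nn l))) * (U (nn k) \<omega> * U (nn l) \<omega>))"
      by (simp add: Z_def mult_ac)
    also have "\<dots> = expectation (\<lambda>\<omega>. U (nn k) \<omega> * U (nn l) \<omega>) / (\<sigma> (nn k) * \<sigma> (nn l))"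
      unfolding ss by simp
    finally have "\<bar>expectation (\<lambda>\<omega>. Z k \<omega> * Z l \<omega>)\<bar> = \<bar>expectation (\<lambda>\<omega>. U (nn k) \<omega> * U (nn l) \<omega>)\<bar> / (\<sigma> (nn k) * \<sigma> (nn l))"
      using sp[of k] sp[of l] kl by (simp add: abs_divide abs_mult)
    also have "\<dots> \<le> C * (real (nn k) / real (nn l)) powr \<eta>"
      using c sp[of k] sp[of l] kl by (simp add: pos_divide_le_eq mult.assoc)
    also have "\<dots> \<le> C * (inverse (real k ^ 2) * inverse (real l ^ 2))"
      using r C0 by (intro mult_left_mono) auto
    finally show ?thesis .
  qed
  \<comment> \<open>A ramp in place of the indicator of \<open>x > y k\<close>: it is positive on
    exactly this set, and it is 1-Lipschitz, as the covariance bound demands.\<close>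
  define g where "g k x = max 0 (min 1 (x - y k))" for k and x :: real
  define f where "f k \<omega> = g (k + k0) (Z (k + k0) \<omega>)" for k \<omega>
  have [measurable]: "Z k \<in> borel_measurable M" for k using gaussian_pairD(7)[OF ZZ[of k k]] .
  have gm[measurable]: "g k \<in> borel_measurable borel" for k unfolding g_def[abs_def] by measurable
  have g01: "0 \<le> g k x" "g k x \<le> 1" for k x by (auto simp: g_def)
  \<comment> \<open>The square root shares the constant evenly between the two factors; the 2 comes
    from the Lipschitz covariance bound, the \<open>C\<close> from the correlations.\<close>
  define b where "b k = sqrt (2 * C) * inverse (real (k + k0) ^ 2)" for k
  have "AE \<omega> in M. \<exists>\<^sub>F k in sequentially. 0 < f k \<omega>"
  proof (rule infinitely_often_positive)
    show "f k \<in> borel_measurable M" for k unfolding f_def by measurable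
    show "0 \<le> f k \<omega>" "f k \<omega> \<le> 1" for k \<omega> using g01 by (auto simp: f_def)
    show "0 \<le> b k" for k using C0 by (simp add: b_def)
    have "summable (\<lambda>k. inverse (real k ^ 2))" by (rule inverse_power_summable) simp
    then have "summable (\<lambda>k. inverse (real (k + k0) ^ 2))" by (subst summable_iff_shift)
    then show "summable b" unfolding b_def by (rule summable_mult)
    have cov1: "expectation (\<lambda>\<omega>. f k \<omega> * f l \<omega>) \<le> expectation (f k) * expectation (f l) + b k * b l" if "k < l" for k l
    proof -
      have "expectation (\<lambda>\<omega>. f k \<omega> * f l \<omega>) \<le> expectation (f k) * expectation (f l) + 2 * \<bar>expectation (\<lambda>\<omega>. Z (k + k0) \<omega> * Z (l + k0) \<omega>)\<bar>"
        unfolding f_def[abs_def]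
        by (rule gaussian_pair_Lipschitz_covariance[OF ZZ Z1 gm gm]) (auto simp: g_def)
      also have "2 * \<bar>expectation (\<lambda>\<omega>. Z (k + k0) \<omega> * Z (l + k0) \<omega>)\<bar> \<le> 2 * (C * (inverse (real (k + k0) ^ 2) * inverse (real (l + k0) ^ 2)))"
        using that by (intro mult_left_mono Zcov) auto
      also have "\<dots> = b k * b l"
      proof -
        have "b k * b l = (sqrt (2 * C) * sqrt (2 * C)) * (inverse (real (k + k0) ^ 2) * inverse (real (l + k0) ^ 2))"
          unfolding b_def by (simp only: mult_ac)
        also have "sqrt (2 * C) * sqrt (2 * C) = 2 * C" using C0 by simp
        finally show ?thesis by (simp only: mult.assoc)
      qed
      finally show ?thesis by simp
    qed
    show "expectation (\<lambda>\<omega>. f k \<omega> * f l \<omega>) \<le> expectation (f k) * expectation (f l) + b k * b l" if "k \<noteq> l" for k l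
    proof (cases "k < l")
      case False
      then have "l < k" using that by simp
      from cov1[OF this] show ?thesis by (simp add: mult.commute)
    qed (rule cov1)
    have Ef: "inverse (real (k + k0)) / sqrt (2 * pi) \<le> expectation (f k)" for k
    proof -
      have kk: "k0 \<le> k + k0" by simp
      have "inverse (real (k + k0)) = exp (- ln (real (k + k0)))" using k0(2)[OF kk] by (simp add: exp_minus)
      also have "\<dots> \<le> exp (- (y (k + k0) + 2)\<^sup>2 / 2)" using k0(1)[OF kk] by simp
      finally have "inverse (real (k + k0)) / sqrt (2 * pi) \<le> exp (- (y (k + k0) + 2)\<^sup>2 / 2) / sqrt (2 * pi)"
        by (intro divide_right_mono) auto
      also have "\<dots> \<le> (LINT x|std_normal_distribution. g (k + k0) x)"
        unfolding g_def by (rule std_normal_clamp_lower[OF y0[OF kk]])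
      also have "\<dots> = expectation (f k)"
        unfolding f_def[abs_def] using gaussian_rv_integral(1)[OF gaussian_pairD(1,3)[OF ZZ[of "k + k0" "k + k0"]] gm] Z1[OF kk] by simp
      finally show ?thesis .
    qed
    show "\<not> summable (\<lambda>k. expectation (f k))"
    proof
      assume "summable (\<lambda>k. expectation (f k))"
      then have "summable (\<lambda>k. inverse (real (k + k0)) / sqrt (2 * pi))"
        by (rule summable_comparison_test') (use Ef in auto)
      then have "summable (\<lambda>k. sqrt (2 * pi) * (inverse (real (k + k0)) / sqrt (2 * pi)))" by (rule summable_mult)
      then have "summable (\<lambda>k. inverse (real (k + k0)))" by simp
      then have "summable (\<lambda>k. inverse (real k))" by (subst (asm) summable_iff_shift)
      then show False using not_summable_harmonic[where 'a=real] by simp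
    qed
  qed
  then show ?thesis
  proof eventually_elim
    case (elim \<omega>)
    show ?case unfolding frequently_sequentially
    proof
      fix N
      obtain k where k: "N \<le> k" "0 < f k \<omega>" using elim unfolding frequently_sequentially by blast
      define n where "n = nn (k + k0)"
      have "y (k + k0) < Z (k + k0) \<omega>" using k(2) by (simp add: f_def g_def)
      then have "(1 - \<epsilon>) * sqrt (2 * ln (ln (real n))) < s / \<sigma> n * U n \<omega>" by (simp add: y_def Z_def n_def)
      moreover have "0 < \<sigma> n" using sp[of "k + k0"] by (simp add: n_def)
      ultimately have "(1 - \<epsilon>) * sqrt (2 * ln (ln (real n))) * \<sigma> n \<le> s * U n \<omega>"
        by (simp add: pos_less_divide_eq less_imp_le)
      then have "(1 - \<epsilon>) * (\<sigma> n * sqrt (2 * ln (ln (real n)))) \<le> s * U n \<omega>" by (simp add: mult_ac)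
      moreover have "N \<le> n" using k(1) kn[of "k + k0"] by (simp add: n_def)
      ultimately show "\<exists>n\<ge>N. (1 - \<epsilon>) * (\<sigma> n * sqrt (2 * ln (ln (real n)))) \<le> s * U n \<omega>" by blast
    qed
  qed
qed

end

section \<open>Variance of the weighted sums\<close>

text \<open>The distance of \<open>s\<close> and \<open>t\<close> within the natural numbers: by
  truncation at least one of the two summands is 0.\<close>

definition lag :: "nat \<Rightarrow> nat \<Rightarrow> nat" where
  "lag s t = (s - t) + (t - s)"

lemma lag_commute: "lag s t = lag t s"
  by (simp add: lag_def)

lemma sum_lag_le:
  fixes w :: "nat \<Rightarrow> real"
  assumes w: "\<And>h. 0 \<le> w h" and I: "I \<subseteq> {1..n}" and s: "s \<in> {1..n}"
  shows "(\<Sum>t\<in>I. w (lag s t)) \<le> 2 * (\<Sum>h<n. w h)"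
proof -
  have "(\<Sum>t\<in>I. w (lag s t)) \<le> (\<Sum>t\<in>{1..s} \<union> {s<..n}. w (lag s t))"
    by (rule sum_mono2) (use I w in auto)
  also have "\<dots> = (\<Sum>t\<in>{1..s}. w (lag s t)) + (\<Sum>t\<in>{s<..n}. w (lag s t))"
    by (rule sum.union_disjoint) auto
  also have "(\<Sum>t\<in>{1..s}. w (lag s t)) = (\<Sum>h\<in>(\<lambda>t. s - t) ` {1..s}. w h)"
    by (subst sum.reindex) (auto simp: inj_on_def lag_def)
  also have "\<dots> \<le> (\<Sum>h<n. w h)"
    by (rule sum_mono2) (use s w in auto)
  also have "(\<Sum>t\<in>{s<..n}. w (lag s t)) = (\<Sum>h\<in>(\<lambda>t. t - s) ` {s<..n}. w h)"
    by (subst sum.reindex) (auto simp: inj_on_def lag_def)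
  also have "\<dots> \<le> (\<Sum>h<n. w h)"
    by (rule sum_mono2) (use s w in auto)
  finally show ?thesis by simp
qed

text \<open>Schur's test: products are split by the arithmetic-geometric mean inequality, and by
  symmetry only row sums remain. Each lag occurs at most twice in a row, once on each side, whence
  the factor 2. The linear dependence on the sum of the squared weights makes bounds over disjoint
  blocks additive.\<close>

lemma quadratic_form_lag_le:
  fixes w c :: "nat \<Rightarrow> real"
  assumes w: "\<And>h. 0 \<le> w h" and I: "I \<subseteq> {1..n}"
  shows "(\<Sum>s\<in>I. \<Sum>t\<in>I. \<bar>c s\<bar> * \<bar>c t\<bar> * w (lag s t)) \<le> 2 * (\<Sum>t\<in>I. (c t)\<^sup>2) * (\<Sum>h<n. w h)"
proof -
  have am: "\<bar>p\<bar> * \<bar>q\<bar> \<le> p\<^sup>2 / 2 + q\<^sup>2 / 2" for p q :: real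
  proof -
    have "0 \<le> (\<bar>p\<bar> - \<bar>q\<bar>)\<^sup>2" by simp
    then show ?thesis by (simp add: power2_diff)
  qed
  have "(\<Sum>s\<in>I. \<Sum>t\<in>I. \<bar>c s\<bar> * \<bar>c t\<bar> * w (lag s t)) \<le> (\<Sum>s\<in>I. \<Sum>t\<in>I. ((c s)\<^sup>2 / 2 + (c t)\<^sup>2 / 2) * w (lag s t))"
    by (intro sum_mono mult_right_mono am w)
  also have "\<dots> = (\<Sum>s\<in>I. \<Sum>t\<in>I. (c s)\<^sup>2 / 2 * w (lag s t)) + (\<Sum>s\<in>I. \<Sum>t\<in>I. (c t)\<^sup>2 / 2 * w (lag s t))"
    by (simp only: distrib_right sum.distrib)
  also have "(\<Sum>s\<in>I. \<Sum>t\<in>I. (c t)\<^sup>2 / 2 * w (lag s t)) = (\<Sum>s\<in>I. \<Sum>t\<in>I. (c s)\<^sup>2 / 2 * w (lag s t))"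
    by (subst sum.swap) (simp add: lag_commute)
  also have "(\<Sum>s\<in>I. \<Sum>t\<in>I. (c s)\<^sup>2 / 2 * w (lag s t)) = (\<Sum>s\<in>I. (c s)\<^sup>2 / 2 * (\<Sum>t\<in>I. w (lag s t)))"
    by (simp only: sum_distrib_left)
  also have "\<dots> + \<dots> = (\<Sum>s\<in>I. (c s)\<^sup>2 * (\<Sum>t\<in>I. w (lag s t)))"
    by (simp add: sum.distrib[symmetric])
  also have "\<dots> \<le> (\<Sum>s\<in>I. (c s)\<^sup>2 * (2 * (\<Sum>h<n. w h)))"
    by (intro sum_mono mult_left_mono sum_lag_le w I) (use I in auto)
  finally show ?thesis by (simp add: sum_distrib_left sum_distrib_right mult_ac)
qed

lemma sum_split_atLeast1: "(\<Sum>h<n. f h) \<le> f 0 + (\<Sum>h=1..n. f h)" if "\<And>h. 0 \<le> f h" for f :: "nat \<Rightarrow> real"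
proof -
  have "(\<Sum>h<n. f h) \<le> (\<Sum>h\<in>insert 0 {1..n}. f h)" by (rule sum_mono2) (use that in auto)
  then show ?thesis by simp
qed

lemma L2_lincomb_inner:
  assumes Y: "\<And>t. t \<in> I \<union> J \<Longrightarrow> L2_function M (Y t)"
  shows "integral\<^sup>L M (\<lambda>\<omega>. (\<Sum>s\<in>I. b s * Y s \<omega>) * (\<Sum>t\<in>J. c t * Y t \<omega>)) = (\<Sum>s\<in>I. \<Sum>t\<in>J. b s * c t * (LINT \<omega>|M. Y s \<omega> * Y t \<omega>))"
proof -
  have i: "integrable M (\<lambda>\<omega>. b s * c t * (Y s \<omega> * Y t \<omega>))" if "s \<in> I" "t \<in> J" for s t
    using that by (intro integrable_mult_right L2_mult_integrable Y) auto
  have "integral\<^sup>L M (\<lambda>\<omega>. (\<Sum>s\<in>I. b s * Y s \<omega>) * (\<Sum>t\<in>J. c t * Y t \<omega>)) = integral\<^sup>L M (\<lambda>\<omega>. \<Sum>s\<in>I. \<Sum>t\<in>J. b s * c t * (Y s \<omega> * Y t \<omega>))"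
    by (simp add: sum_product mult_ac)
  also have "\<dots> = (\<Sum>s\<in>I. integral\<^sup>L M (\<lambda>\<omega>. \<Sum>t\<in>J. b s * c t * (Y s \<omega> * Y t \<omega>)))"
    using i by (intro Bochner_Integration.integral_sum Bochner_Integration.integrable_sum) auto
  also have "\<dots> = (\<Sum>s\<in>I. \<Sum>t\<in>J. (LINT \<omega>|M. b s * c t * (Y s \<omega> * Y t \<omega>)))"
    using i by (intro sum.cong refl Bochner_Integration.integral_sum) auto
  finally show ?thesis by simp
qed

lemma sum_diff_greaterThanAtMost:
  fixes f :: "nat \<Rightarrow> real"
  assumes "m \<le> n"
  shows "(\<Sum>t=1..n. f t) - (\<Sum>t=1..m. f t) = (\<Sum>t\<in>{m<..n}. f t)"
proof -
  have "{1..n} = {1..m} \<union> {m<..n}" using assms by auto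
  then have "(\<Sum>t=1..n. f t) = (\<Sum>t=1..m. f t) + (\<Sum>t\<in>{m<..n}. f t)"
    by (simp only:) (rule sum.union_disjoint, auto)
  then show ?thesis by simp
qed

section \<open>Second moments of the weighted Gaussian sums\<close>

locale regvar_sums = prob_space +
  fixes X :: "nat \<Rightarrow> 'a \<Rightarrow> real" and \<rho> a :: "nat \<Rightarrow> real" and \<alpha> d :: real
  assumes gauss: "\<And>I b. finite I \<Longrightarrow> I \<subseteq> {1..} \<Longrightarrow> gaussian_rv M (\<lambda>\<omega>. \<Sum>t\<in>I. b t * X t \<omega>)"
    and mean0: "\<And>t. 1 \<le> t \<Longrightarrow> expectation (X t) = 0"
    and var1: "\<And>t. 1 \<le> t \<Longrightarrow> expectation (\<lambda>\<omega>. (X t \<omega>)\<^sup>2) = 1"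
    and cov: "\<And>t h. 1 \<le> t \<Longrightarrow> \<rho> h = expectation (\<lambda>\<omega>. X t \<omega> * X (t + h) \<omega>)"
    and regvar_a: "regvar a (- d)" and regvar_\<rho>: "regvar \<rho> (- \<alpha>)"
    and alpha: "0 < \<alpha>" "\<alpha> < 1" and d\<alpha>: "2 * d + \<alpha> < 1"
begin

lemma X_props:
  assumes "1 \<le> t"
  shows "gaussian_rv M (X t)" "L2_function M (X t)" "l2norm M (X t) = 1"
proof -
  show g: "gaussian_rv M (X t)" using gauss[of "{t}" "\<lambda>_. 1"] assms by simp
  show "L2_function M (X t)" using gaussian_rv_L2[OF g mean0[OF assms]] .
  show "l2norm M (X t) = 1" using var1[OF assms] by (simp add: l2norm_def)
qed

lemma X_pair:
  assumes "1 \<le> s" "1 \<le> t"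
  shows "gaussian_pair (X s) (X t)"
  unfolding gaussian_pair_def
proof (intro conjI allI)
  fix u v
  show "gaussian_rv M (\<lambda>\<omega>. u * X s \<omega> + v * X t \<omega>)"
  proof (cases "s = t")
    case True
    then show ?thesis using gauss[of "{t}" "\<lambda>_. u + v"] assms by (simp add: distrib_right)
  next
    case False
    then show ?thesis using gauss[of "{s, t}" "\<lambda>i. if i = s then u else v"] assms by simp
  qed
qed (use mean0 assms in auto)

lemma cov_lag:
  assumes "1 \<le> s" "1 \<le> t"
  shows "expectation (\<lambda>\<omega>. X s \<omega> * X t \<omega>) = \<rho> (lag s t)"
proof (cases "s \<le> t")
  case True
  then show ?thesis using cov[OF assms(1), of "t - s"] by (simp add: lag_def)
next
  case False
  then show ?thesis using cov[OF assms(2), of "s - t"] by (simp add: lag_def mult.commute)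
qed

lemma rho_le_1: "\<bar>\<rho> h\<bar> \<le> 1"
  using L2_Cauchy_Schwarz[OF X_props(2)[of 1] X_props(2)[of "1 + h"]] X_props(3)[of 1] X_props(3)[of "1 + h"] cov[of 1 h]
  by simp

lemma lincomb_inner:
  assumes I: "finite I" "I \<subseteq> {1..}" and J: "finite J" "J \<subseteq> {1..}"
  shows "expectation (\<lambda>\<omega>. (\<Sum>s\<in>I. b s * X s \<omega>) * (\<Sum>t\<in>J. c t * X t \<omega>)) = (\<Sum>s\<in>I. \<Sum>t\<in>J. b s * c t * \<rho> (lag s t))"
proof -
  have "expectation (\<lambda>\<omega>. (\<Sum>s\<in>I. b s * X s \<omega>) * (\<Sum>t\<in>J. c t * X t \<omega>)) = (\<Sum>s\<in>I. \<Sum>t\<in>J. b s * c t * expectation (\<lambda>\<omega>. X s \<omega> * X t \<omega>))"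
  proof (rule L2_lincomb_inner)
    fix t assume "t \<in> I \<union> J"
    then have "1 \<le> t" using I J by auto
    then show "L2_function M (X t)" by (rule X_props)
  qed
  also have "\<dots> = (\<Sum>s\<in>I. \<Sum>t\<in>J. b s * c t * \<rho> (lag s t))"
    using I J by (intro sum.cong refl) (auto simp: cov_lag subset_iff)
  finally show ?thesis .
qed

definition U :: "nat \<Rightarrow> 'a \<Rightarrow> real" where
  "U n \<omega> = (\<Sum>t=1..n. a t * X t \<omega>)"

definition \<sigma> :: "nat \<Rightarrow> real" where
  "\<sigma> n = l2norm M (U n)"

text \<open>The order of magnitude of \<open>(\<sigma> n)\<^sup>2\<close>.\<close>

definition B :: "nat \<Rightarrow> real" where
  "B n = (real n powr 2 * (a n * a n)) * \<rho> n"

lemma lincomb_props: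
  assumes "finite I" "I \<subseteq> {1..}"
  shows "L2_function M (\<lambda>\<omega>. \<Sum>t\<in>I. b t * X t \<omega>)" "expectation (\<lambda>\<omega>. \<Sum>t\<in>I. b t * X t \<omega>) = 0"
proof -
  show "L2_function M (\<lambda>\<omega>. \<Sum>t\<in>I. b t * X t \<omega>)"
    using assms by (intro L2_function_sum L2_function_cmult X_props) auto
  have "expectation (\<lambda>\<omega>. \<Sum>t\<in>I. b t * X t \<omega>) = (\<Sum>t\<in>I. b t * expectation (X t))"
    using assms L2_integrable[OF X_props(2)] by (subst Bochner_Integration.integral_sum) (auto intro!: sum.cong)
  then show "expectation (\<lambda>\<omega>. \<Sum>t\<in>I. b t * X t \<omega>) = 0" using assms mean0 by (auto intro!: sum.neutral)
qed

lemma U_L2: "L2_function M (U n)"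
  unfolding U_def[abs_def] by (rule lincomb_props) auto

lemma U_pair: "gaussian_pair (U m) (U n)"
  unfolding gaussian_pair_def
proof (intro conjI allI)
  fix u v
  have "gaussian_rv M (\<lambda>\<omega>. \<Sum>t\<in>{1..max m n}. ((if t \<le> m then u * a t else 0) + (if t \<le> n then v * a t else 0)) * X t \<omega>)"
    by (rule gauss) auto
  moreover have "(\<Sum>t\<in>{1..max m n}. ((if t \<le> m then u * a t else 0) + (if t \<le> n then v * a t else 0)) * X t \<omega>) = u * U m \<omega> + v * U n \<omega>" for \<omega>
  proof -
    have part: "(\<Sum>t\<in>{1..max m n}. (if t \<le> k then w * a t else 0) * X t \<omega>) = w * U k \<omega>" if "k \<le> max m n" for k w
    proof -
      have "(\<Sum>t\<in>{1..max m n}. (if t \<le> k then w * a t else 0) * X t \<omega>) = (\<Sum>t\<in>{1..k}. (if t \<le> k then w * a t else 0) * X t \<omega>)"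
        by (rule sum.mono_neutral_right) (use that in auto)
      also have "\<dots> = w * U k \<omega>" by (simp add: U_def sum_distrib_left mult.assoc)
      finally show ?thesis .
    qed
    show ?thesis unfolding distrib_right sum.distrib by (simp only: part max.cobounded1 max.cobounded2)
  qed
  ultimately show "gaussian_rv M (\<lambda>\<omega>. u * U m \<omega> + v * U n \<omega>)" by simp
next
  show "expectation (U m) = 0" "expectation (U n) = 0"
    unfolding U_def[abs_def] by (rule lincomb_props; auto)+
qed

lemma U_diff: "m \<le> n \<Longrightarrow> U n \<omega> - U m \<omega> = (\<Sum>t\<in>{m<..n}. a t * X t \<omega>)"
  unfolding U_def by (rule sum_diff_greaterThanAtMost)

lemma lincomb_norm_le:
  assumes "I \<subseteq> {1..n}"
  shows "(l2norm M (\<lambda>\<omega>. \<Sum>t\<in>I. b t * X t \<omega>))\<^sup>2 \<le> 2 * (\<Sum>t\<in>I. (b t)\<^sup>2) * (\<Sum>h<n. \<bar>\<rho> h\<bar>)"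
proof -
  have I: "finite I" "I \<subseteq> {1..}" using assms finite_subset by auto
  have "(l2norm M (\<lambda>\<omega>. \<Sum>t\<in>I. b t * X t \<omega>))\<^sup>2 = (\<Sum>s\<in>I. \<Sum>t\<in>I. b s * b t * \<rho> (lag s t))"
    unfolding l2norm_power2 using lincomb_inner[OF I I, of b b] by (simp only: power2_eq_square)
  also have "\<dots> \<le> (\<Sum>s\<in>I. \<Sum>t\<in>I. \<bar>b s\<bar> * \<bar>b t\<bar> * \<bar>\<rho> (lag s t)\<bar>)"
    by (intro sum_mono) (metis abs_ge_self abs_mult)
  also have "\<dots> \<le> 2 * (\<Sum>t\<in>I. (b t)\<^sup>2) * (\<Sum>h<n. \<bar>\<rho> h\<bar>)"
    by (rule quadratic_form_lag_le) (use assms in auto)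
  finally show ?thesis .
qed

lemma sum_a2_le: obtains C where "0 < C" "\<forall>\<^sub>F n in sequentially. (\<Sum>t=1..n. (a t)\<^sup>2) \<le> C * real n * (a n)\<^sup>2"
proof -
  have "regvar (\<lambda>n. a n * a n) (- d + - d)" by (intro regvar_mult regvar_a)
  moreover have "-1 < - d + - d" using d\<alpha> alpha by simp
  ultimately obtain C where "0 < C" "\<forall>\<^sub>F n in sequentially. (\<Sum>m=1..n. \<bar>a m * a m\<bar>) \<le> C * real n * (a n * a n)"
    by (rule regvar_sum_abs_le)
  then show thesis by (intro that[of C]) (simp_all add: power2_eq_square)
qed

lemma regvar_n_rho: "regvar (\<lambda>n. real n powr s * \<rho> n) (s - \<alpha>)"
  using regvar_mult[OF regvar_powr[of s] regvar_\<rho>] by simp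

text \<open>The sums of regularly varying sequences start at 1, whereas Schur's test includes lag 0.
  That term is at most 1 and is absorbed because \<open>n * \<rho> n\<close> tends to infinity, by
  \<alpha> < 1.\<close>

lemma sum_rho_le: obtains C where "0 < C" "\<forall>\<^sub>F n in sequentially. (\<Sum>h<n. \<bar>\<rho> h\<bar>) \<le> C * (real n * \<rho> n)"
proof -
  obtain C where C: "0 < C" "\<forall>\<^sub>F n in sequentially. (\<Sum>m=1..n. \<bar>\<rho> m\<bar>) \<le> C * real n * \<rho> n"
    using regvar_sum_abs_le[OF regvar_\<rho>] alpha by auto
  have "filterlim (\<lambda>n. real n powr 1 * \<rho> n) at_top sequentially"
    by (rule regvar_at_top[OF regvar_n_rho]) (use alpha in simp)
  then have "\<forall>\<^sub>F n in sequentially. 1 \<le> real n powr 1 * \<rho> n" unfolding filterlim_at_top by blast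
  with C(2) have "\<forall>\<^sub>F n in sequentially. (\<Sum>h<n. \<bar>\<rho> h\<bar>) \<le> (1 + C) * (real n * \<rho> n)"
  proof eventually_elim
    case (elim n)
    have "(\<Sum>h<n. \<bar>\<rho> h\<bar>) \<le> \<bar>\<rho> 0\<bar> + (\<Sum>h=1..n. \<bar>\<rho> h\<bar>)" by (rule sum_split_atLeast1) simp
    also have "\<dots> \<le> real n * \<rho> n + C * real n * \<rho> n" using elim rho_le_1[of 0] by simp
    finally show ?case by (simp add: algebra_simps)
  qed
  then show thesis using C(1) by (intro that[of "1 + C"]) auto
qed

text \<open>One of the two factors in \<open>(\<rho> h)\<^sup>2\<close> is estimated by a power
  \<open>h powr (- \<delta>)\<close>, the other is kept and summed. The result is smaller than the
  sum of \<open>\<bar>\<rho> h\<bar>\<close> by a power of \<open>n\<close>, which is the entire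
  gain of rank two over rank one.\<close>

lemma sum_rho2_le: obtains C \<delta> where "0 < C" "0 < \<delta>" "\<forall>\<^sub>F n in sequentially. (\<Sum>h<n. (\<rho> h)\<^sup>2) \<le> C * (real n powr (1 - \<delta>) * \<rho> n)"
proof -
  \<comment> \<open>Two demands: \<delta> < \<alpha>, so that \<open>\<rho>\<close> decays at least
    at this rate, and \<alpha> + \<delta> < 1, so that the remaining sum is still governed by its
    last term.\<close>
  define \<delta> where "\<delta> = min \<alpha> (1 - \<alpha>) / 2"
  have d: "0 < \<delta>" "\<delta> < \<alpha>" "\<alpha> + \<delta> < 1" using alpha by (auto simp: \<delta>_def min_def field_simps)
  obtain C1 where C1: "0 < C1" "\<forall>\<^sub>F n in sequentially. \<rho> n \<le> C1 * real n powr (- \<delta>)"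
    by (rule regvar_upper_powr[OF regvar_\<rho>, of "- \<delta>"]) (use d in auto)
  obtain n1 where n1: "\<And>n. n1 \<le> n \<Longrightarrow> 0 < \<rho> n \<and> \<rho> n \<le> C1 * real n powr (- \<delta>)"
    using eventually_conj[OF regvar_pos[OF regvar_\<rho>] C1(2)] unfolding eventually_sequentially by blast
  \<comment> \<open>The second summand covers the lags below \<open>n1\<close>, where only
    \<open>\<bar>\<rho> h\<bar> \<le> 1\<close> is known.\<close>
  define C2 where "C2 = C1 + real n1 powr \<delta>"
  have C2: "0 < C2" using C1 by (simp add: C2_def add_pos_nonneg)
  have rb: "\<bar>\<rho> h\<bar> \<le> C2 * real h powr (- \<delta>)" if "1 \<le> h" for h
  proof (cases "n1 \<le> h")
    case True
    then have "\<bar>\<rho> h\<bar> \<le> C1 * real h powr (- \<delta>)" using n1[of h] by simp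
    also have "\<dots> \<le> C2 * real h powr (- \<delta>)" by (intro mult_right_mono) (auto simp: C2_def)
    finally show ?thesis .
  next
    case False
    have "\<bar>\<rho> h\<bar> \<le> 1" by (rule rho_le_1)
    also have "1 = real h powr \<delta> * real h powr (- \<delta>)" using that by (simp add: powr_add[symmetric])
    also have "\<dots> \<le> C2 * real h powr (- \<delta>)"
    proof (intro mult_right_mono)
      have "real h powr \<delta> \<le> real n1 powr \<delta>" using False d by (intro powr_mono2) auto
      then show "real h powr \<delta> \<le> C2" using C1 by (simp add: C2_def)
    qed simp
    finally show ?thesis .
  qed
  have rv: "regvar (\<lambda>n. real n powr (- \<delta>) * \<rho> n) (- \<delta> - \<alpha>)" by (rule regvar_n_rho)
  obtain C3 where C3: "0 < C3" "\<forall>\<^sub>F n in sequentially. (\<Sum>m=1..n. \<bar>real m powr (- \<delta>) * \<rho> m\<bar>) \<le> C3 * real n * (real n powr (- \<delta>) * \<rho> n)"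
    by (rule regvar_sum_abs_le[OF rv]) (use d in auto)
  have "filterlim (\<lambda>n. real n powr (1 - \<delta>) * \<rho> n) at_top sequentially"
    by (rule regvar_at_top[OF regvar_n_rho]) (use d in simp)
  then have "\<forall>\<^sub>F n in sequentially. 1 \<le> real n powr (1 - \<delta>) * \<rho> n" unfolding filterlim_at_top by blast
  with C3(2) eventually_ge_at_top[of 1] have "\<forall>\<^sub>F n in sequentially. (\<Sum>h<n. (\<rho> h)\<^sup>2) \<le> (1 + C2 * C3) * (real n powr (1 - \<delta>) * \<rho> n)"
  proof eventually_elim
    case (elim n)
    have "(\<Sum>h<n. (\<rho> h)\<^sup>2) \<le> (\<rho> 0)\<^sup>2 + (\<Sum>h=1..n. (\<rho> h)\<^sup>2)" by (rule sum_split_atLeast1) simp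
    also have "(\<rho> 0)\<^sup>2 \<le> 1" using rho_le_1[of 0] by (simp add: abs_square_le_1)
    also have "(\<Sum>h=1..n. (\<rho> h)\<^sup>2) \<le> (\<Sum>h=1..n. C2 * \<bar>real h powr (- \<delta>) * \<rho> h\<bar>)"
    proof (rule sum_mono)
      fix h assume "h \<in> {1..n}"
      then have "\<bar>\<rho> h\<bar> * \<bar>\<rho> h\<bar> \<le> (C2 * real h powr (- \<delta>)) * \<bar>\<rho> h\<bar>" by (intro mult_right_mono rb) auto
      then show "(\<rho> h)\<^sup>2 \<le> C2 * \<bar>real h powr (- \<delta>) * \<rho> h\<bar>" by (simp add: power2_eq_square abs_mult mult.assoc)
    qed
    also have "\<dots> \<le> C2 * (C3 * real n * (real n powr (- \<delta>) * \<rho> n))"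
      unfolding sum_distrib_left[symmetric] using elim C2 by (intro mult_left_mono) auto
    also have "real n powr (1 - \<delta>) = real n * real n powr (- \<delta>)" using elim by (simp add: powr_diff powr_minus divide_inverse)
    ultimately show ?case using elim \<open>real n powr (1 - \<delta>) = real n * real n powr (- \<delta>)\<close> by (simp add: algebra_simps)
  qed
  then show thesis using C2 C3(1) d by (intro that[of "1 + C2 * C3" \<delta>]) (auto intro: add_pos_pos)
qed

lemma regvar_B: "regvar B (2 - 2 * d - \<alpha>)"
  using regvar_mult[OF regvar_mult[OF regvar_powr[of 2] regvar_mult[OF regvar_a regvar_a]] regvar_\<rho>]
  by (simp add: B_def[abs_def])

lemma B_index: "1 < 2 - 2 * d - \<alpha>" using d\<alpha> by simp

lemma B_eq: "B n = (real n * (a n)\<^sup>2) * (real n * \<rho> n)"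
  by (simp add: B_def power2_eq_square)

end

context regvar_sums
begin

lemma sigma_upper: obtains C where "0 < C" "\<forall>\<^sub>F n in sequentially. (\<sigma> n)\<^sup>2 \<le> C * B n"
proof -
  obtain C1 where C1: "0 < C1" "\<forall>\<^sub>F n in sequentially. (\<Sum>t=1..n. (a t)\<^sup>2) \<le> C1 * real n * (a n)\<^sup>2" by (rule sum_a2_le)
  obtain C2 where C2: "0 < C2" "\<forall>\<^sub>F n in sequentially. (\<Sum>h<n. \<bar>\<rho> h\<bar>) \<le> C2 * (real n * \<rho> n)" by (rule sum_rho_le)
  from C1(2) C2(2) have "\<forall>\<^sub>F n in sequentially. (\<sigma> n)\<^sup>2 \<le> (2 * C1 * C2) * B n"
  proof eventually_elim
    case (elim n)
    have "(\<sigma> n)\<^sup>2 \<le> 2 * (\<Sum>t=1..n. (a t)\<^sup>2) * (\<Sum>h<n. \<bar>\<rho> h\<bar>)"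
      unfolding \<sigma>_def U_def[abs_def] by (rule lincomb_norm_le) simp
    also have "\<dots> \<le> 2 * (C1 * real n * (a n)\<^sup>2) * (C2 * (real n * \<rho> n))"
      using elim C1(1) by (intro mult_mono mult_left_mono) (auto intro!: sum_nonneg mult_nonneg_nonneg)
    also have "\<dots> = (2 * C1 * C2) * B n" by (simp add: B_eq)
    finally show ?case .
  qed
  then show thesis using C1(1) C2(1) by (intro that[of "2 * C1 * C2"]) auto
qed

text \<open>Cancellation can come only from the first weights and from short lags, where signs are
  unknown. The former are removed with \<open>U t0\<close>, a fixed variable; the latter cost at
  most a multiple of the sum of the \<open>(a t)\<^sup>2\<close>, which is of smaller order than
  \<open>B n\<close> because \<open>n * \<rho> n\<close> tends to infinity.\<close>

lemma sigma_lower: obtains c where "0 < c" "\<forall>\<^sub>F n in sequentially. c * B n \<le> (\<sigma> n)\<^sup>2"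
proof -
  obtain C1 where C1: "0 < C1" "\<forall>\<^sub>F n in sequentially. (\<Sum>t=1..n. (a t)\<^sup>2) \<le> C1 * real n * (a n)\<^sup>2" by (rule sum_a2_le)
  obtain Ca na where Ca: "0 < Ca" "1 \<le> na" "\<And>m n. na \<le> m \<Longrightarrow> m \<le> n \<Longrightarrow> real n \<le> 4 * real m \<Longrightarrow>
    0 < a m \<and> 0 < a n \<and> a n \<le> Ca * a m \<and> a m \<le> Ca * a n"
    using regvar_comparable[OF regvar_a, of 4] by auto
  obtain Cr nr where Cr: "0 < Cr" "1 \<le> nr" "\<And>m n. nr \<le> m \<Longrightarrow> m \<le> n \<Longrightarrow> real n \<le> 4 * real m \<Longrightarrow>
    0 < \<rho> m \<and> 0 < \<rho> n \<and> \<rho> n \<le> Cr * \<rho> m \<and> \<rho> m \<le> Cr * \<rho> n"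
    using regvar_comparable[OF regvar_\<rho>, of 4] by auto
  define t0 where "t0 = max na nr"
  have apos: "0 < a t" if "t0 \<le> t" for t using Ca(3)[of t t] that by (simp add: t0_def)
  have rpos: "0 < \<rho> t" if "t0 \<le> t" for t using Cr(3)[of t t] that by (simp add: t0_def)
  \<comment> \<open>The square below has side \<open>k \<ge> n / 8\<close>, giving 1/64; on it each
    weight loses at most a factor \<open>Ca\<close> and the covariance at most \<open>Cr\<close>
    against their values at \<open>n\<close>.\<close>
  define c where "c = 1 / (64 * Ca * Ca * Cr)"
  have c: "0 < c" using Ca(1) Cr(1) by (simp add: c_def)
  have "filterlim (\<lambda>n. real n powr 1 * \<rho> n) at_top sequentially"
    by (rule regvar_at_top[OF regvar_n_rho]) (use alpha in simp)
  then have e1: "\<forall>\<^sub>F n in sequentially. 4 * real t0 * C1 / c \<le> real n powr 1 * \<rho> n" unfolding filterlim_at_top by blast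
  have "filterlim B at_top sequentially"
    by (rule regvar_at_top[OF regvar_B]) (use B_index in simp)
  then have e2: "\<forall>\<^sub>F n in sequentially. 8 * (\<sigma> t0)\<^sup>2 / c \<le> B n" unfolding filterlim_at_top by blast
  have "\<forall>\<^sub>F n in sequentially. 8 * (t0 + 1) \<le> n" by (rule eventually_ge_at_top)
  with C1(2) e1 e2 have "\<forall>\<^sub>F n in sequentially. (c / 8) * B n \<le> (\<sigma> n)\<^sup>2"
  proof eventually_elim
    case (elim n)
    \<comment> \<open>Quarters of \<open>{1..n}\<close>: points of the second and the fourth are
      more than \<open>k\<close> apart, and indices and lags there are within a factor 4 of
      \<open>n\<close>, as the comparison constants require.\<close>
    define k where "k = n div 4"
    have k: "t0 < k" "4 * k \<le> n" "n < 4 * (k + 1)" using elim unfolding k_def by auto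
    define I where "I = {t0<..n}"
    \<comment> \<open>all terms with lag at least \<open>t0\<close> are positive, and those in the square \<open>P \<times> R\<close> already have the right order\<close>
    define P where "P = {k + 1..2 * k}"
    define R where "R = {3 * k + 1..4 * k}"
    have PI: "P \<subseteq> I" and RI: "R \<subseteq> I" using k by (auto simp: P_def R_def I_def)
    define e where "e = (a n * a n * \<rho> n) / (Ca * Ca * Cr)"
    define w where "w h = (if h < t0 then 1 else 0 :: real)" for h
    have an: "0 < a n" and rn: "0 < \<rho> n" using apos rpos k by auto
    have alow: "a n / Ca \<le> a s" if "s \<in> P \<union> R" for s
      using Ca(3)[of s n] that k Ca(1) by (auto simp: P_def R_def t0_def field_simps)
    \<comment> \<open>A pointwise minorant of the covariance terms: at short lags the worst sign is
      assumed and charged to \<open>w\<close>, at long lags every term is positive and those in the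
      square are at least \<open>e\<close>.\<close>
    have pair_term: "(if s \<in> P \<and> t \<in> R then e else 0) - \<bar>a s\<bar> * \<bar>a t\<bar> * w (lag s t) \<le> a s * a t * \<rho> (lag s t)" if "s \<in> I" "t \<in> I" for s t
    proof (cases "lag s t < t0")
      case True
      have "\<not> (s \<in> P \<and> t \<in> R)" using True k by (auto simp: P_def R_def lag_def)
      moreover have "- (\<bar>a s\<bar> * \<bar>a t\<bar> * 1) \<le> a s * a t * \<rho> (lag s t)"
      proof -
        have "\<bar>a s * a t * \<rho> (lag s t)\<bar> \<le> \<bar>a s\<bar> * \<bar>a t\<bar> * 1"
          unfolding abs_mult by (intro mult_left_mono rho_le_1) auto
        then show ?thesis by linarith
      qed
      ultimately show ?thesis using True by (auto simp: w_def)
    next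
      case False
      have as: "0 < a s" "0 < a t" using that apos by (auto simp: I_def)
      have rs: "0 < \<rho> (lag s t)" using False rpos by simp
      show ?thesis
      proof (cases "s \<in> P \<and> t \<in> R")
        case True
        have "\<rho> n / Cr \<le> \<rho> (lag s t)"
        proof -
          have "lag s t = t - s" "k + 1 \<le> t - s" "t - s \<le> n" using True k by (auto simp: P_def R_def lag_def)
          then show ?thesis using Cr(3)[of "lag s t" n] k Cr(1) by (auto simp: t0_def field_simps)
        qed
        then have "(a n / Ca) * (a n / Ca) * (\<rho> n / Cr) \<le> a s * a t * \<rho> (lag s t)"
          using alow[of s] alow[of t] True an rn Ca(1) Cr(1) as by (intro mult_mono) auto
        then show ?thesis using True False by (simp add: w_def e_def)
      qed (use False as rs in \<open>auto simp: w_def\<close>)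
    qed
    have kke: "real k * real k * e = (\<Sum>s\<in>I. \<Sum>t\<in>I. if s \<in> P \<and> t \<in> R then e else 0)"
    proof -
      have "(\<Sum>s\<in>I. \<Sum>t\<in>I. if s \<in> P \<and> t \<in> R then e else 0) = (\<Sum>s\<in>I. if s \<in> P then (\<Sum>t\<in>I. if t \<in> R then e else 0) else 0)"
        by (intro sum.cong refl) auto
      also have "\<dots> = (\<Sum>s\<in>I \<inter> P. \<Sum>t\<in>I \<inter> R. e)" by (subst (1 2) sum.inter_restrict) (auto simp: I_def)
      also have "I \<inter> P = P" using PI by blast
      also have "I \<inter> R = R" using RI by blast
      finally show ?thesis by (simp add: P_def R_def mult.assoc)
    qed
    have "real k * real k * e - 2 * (C1 * real n * (a n)\<^sup>2) * real t0
        \<le> real k * real k * e - 2 * (\<Sum>t\<in>I. (a t)\<^sup>2) * (\<Sum>h<n. w h)"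
    proof -
      have "(\<Sum>t\<in>I. (a t)\<^sup>2) \<le> (\<Sum>t=1..n. (a t)\<^sup>2)" by (rule sum_mono2) (auto simp: I_def)
      then have "(\<Sum>t\<in>I. (a t)\<^sup>2) \<le> C1 * real n * (a n)\<^sup>2" using elim by linarith
      moreover have "(\<Sum>h<n. w h) \<le> real t0"
      proof -
        have "(\<Sum>h<n. w h) = real (card ({..<n} \<inter> {h. h < t0}))" unfolding w_def by (simp add: sum.If_cases)
        also have "card ({..<n} \<inter> {h. h < t0}) \<le> card {..<t0}" by (rule card_mono) auto
        finally show ?thesis by simp
      qed
      moreover have "0 \<le> (\<Sum>h<n. w h)" "0 \<le> (\<Sum>t\<in>I. (a t)\<^sup>2)" by (auto simp: w_def intro!: sum_nonneg)
      ultimately have "(\<Sum>t\<in>I. (a t)\<^sup>2) * (\<Sum>h<n. w h) \<le> (C1 * real n * (a n)\<^sup>2) * real t0" by (intro mult_mono) auto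
      then show ?thesis by (simp add: mult.assoc)
    qed
    also have "\<dots> \<le> real k * real k * e - (\<Sum>s\<in>I. \<Sum>t\<in>I. \<bar>a s\<bar> * \<bar>a t\<bar> * w (lag s t))"
    proof -
      have "(\<Sum>s\<in>I. \<Sum>t\<in>I. \<bar>a s\<bar> * \<bar>a t\<bar> * w (lag s t)) \<le> 2 * (\<Sum>t\<in>I. (a t)\<^sup>2) * (\<Sum>h<n. w h)"
        by (rule quadratic_form_lag_le) (auto simp: w_def I_def)
      then show ?thesis by linarith
    qed
    also have "real k * real k * e - (\<Sum>s\<in>I. \<Sum>t\<in>I. \<bar>a s\<bar> * \<bar>a t\<bar> * w (lag s t)) = (\<Sum>s\<in>I. \<Sum>t\<in>I. (if s \<in> P \<and> t \<in> R then e else 0) - \<bar>a s\<bar> * \<bar>a t\<bar> * w (lag s t))"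
      unfolding kke by (simp add: sum_subtractf)
    also have "\<dots> \<le> (\<Sum>s\<in>I. \<Sum>t\<in>I. a s * a t * \<rho> (lag s t))" by (intro sum_mono pair_term)
    also have "\<dots> = (l2norm M (\<lambda>\<omega>. U n \<omega> - U t0 \<omega>))\<^sup>2"
    proof -
      have "t0 \<le> n" using k by simp
      then have ud: "U n \<omega> - U t0 \<omega> = (\<Sum>t\<in>I. a t * X t \<omega>)" for \<omega> unfolding I_def by (rule U_diff)
      have Is: "finite I" "I \<subseteq> {1..}" by (auto simp: I_def)
      show ?thesis unfolding l2norm_power2 ud using lincomb_inner[OF Is Is, of a a] by (simp only: power2_eq_square)
    qed
    also have "\<dots> \<le> (\<sigma> n + \<sigma> t0)\<^sup>2"
    proof (rule power_mono)
      have "l2norm M (\<lambda>\<omega>. U n \<omega> + (-1) * U t0 \<omega>) \<le> l2norm M (U n) + l2norm M (\<lambda>\<omega>. (-1) * U t0 \<omega>)"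
        by (intro l2norm_triangle U_L2 L2_function_cmult)
      then show "l2norm M (\<lambda>\<omega>. U n \<omega> - U t0 \<omega>) \<le> \<sigma> n + \<sigma> t0" unfolding l2norm_cmult \<sigma>_def by simp
    qed simp
    also have "\<dots> \<le> 2 * (\<sigma> n)\<^sup>2 + 2 * (\<sigma> t0)\<^sup>2"
    proof -
      have "0 \<le> (\<sigma> n - \<sigma> t0)\<^sup>2" by simp
      then show ?thesis by (simp add: power2_sum power2_diff)
    qed
    finally have low: "real k * real k * e - 2 * (C1 * real n * (a n)\<^sup>2) * real t0 \<le> 2 * (\<sigma> n)\<^sup>2 + 2 * (\<sigma> t0)\<^sup>2" .
    have kn: "real n / 8 \<le> real k"
    proof -
      have "n \<le> 8 * k" using k(1,3) by presburger
      then show ?thesis by simp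
    qed
    have e0: "0 \<le> e" using an rn Ca(1) Cr(1) by (simp add: e_def)
    have "c * B n = (real n / 8) * (real n / 8) * e" by (simp add: B_eq c_def e_def power2_eq_square mult_ac)
    also have "\<dots> \<le> real k * real k * e" using kn e0 by (intro mult_right_mono mult_mono) auto
    finally have b1: "c * B n \<le> real k * real k * e" .
    have b2: "2 * (C1 * real n * (a n)\<^sup>2) * real t0 \<le> c / 2 * B n"
    proof -
      have "4 * real t0 * C1 \<le> c * (real n * \<rho> n)" using elim c by (simp add: field_simps)
      then have "(real n * (a n)\<^sup>2) * (4 * real t0 * C1) \<le> (real n * (a n)\<^sup>2) * (c * (real n * \<rho> n))" by (intro mult_left_mono) auto
      then show ?thesis by (simp add: B_eq mult_ac)
    qed
    have b3: "2 * (\<sigma> t0)\<^sup>2 \<le> c / 4 * B n" using elim c by (simp add: field_simps)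
    \<comment> \<open>Of \<open>c * B n\<close>, half is lost to the short lags and a quarter to the
      initial segment. The remaining quarter bounds twice the variance, since a squared sum was
      estimated by twice the sum of squares; this yields \<open>c / 8\<close>.\<close>
    show ?case using low b1 b2 b3 by linarith
  qed
  then show thesis using c by (intro that[of "c / 8"]) auto
qed

text \<open>The covariance of \<open>U m\<close> and \<open>U n\<close> is split at time
  \<open>2 * m\<close>. Up to there Cauchy-Schwarz suffices, since
  \<open>\<sigma> m / \<sigma> n\<close> itself decays like a power of \<open>m / n\<close>. Beyond
  it every lag is at least half of the later index, so \<open>\<rho> (t - s)\<close> is comparable
  to \<open>\<rho> t\<close> and the double sum factorises.\<close>

lemma gaussian_lil_U:
  obtains C K \<eta> N0 where "gaussian_lil M U \<sigma> N0 C K \<eta>"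
proof -
  obtain Cu where Cu: "0 < Cu" "\<forall>\<^sub>F n in sequentially. (\<sigma> n)\<^sup>2 \<le> Cu * B n" by (rule sigma_upper)
  obtain cl where cl: "0 < cl" "\<forall>\<^sub>F n in sequentially. cl * B n \<le> (\<sigma> n)\<^sup>2" by (rule sigma_lower)
  obtain Ca na where Ca: "0 < Ca" "1 \<le> na" "\<And>m n. na \<le> m \<Longrightarrow> m \<le> n \<Longrightarrow> real n \<le> 2 * real m \<Longrightarrow>
    0 < a m \<and> 0 < a n \<and> a n \<le> Ca * a m \<and> a m \<le> Ca * a n"
    using regvar_comparable[OF regvar_a, of 2] by auto
  obtain Cr nr where Cr: "0 < Cr" "1 \<le> nr" "\<And>m n. nr \<le> m \<Longrightarrow> m \<le> n \<Longrightarrow> real n \<le> 2 * real m \<Longrightarrow>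
    0 < \<rho> m \<and> 0 < \<rho> n \<and> \<rho> n \<le> Cr * \<rho> m \<and> \<rho> m \<le> Cr * \<rho> n"
    using regvar_comparable[OF regvar_\<rho>, of 2] by auto
  obtain Cb nb where Cb: "0 < Cb" "1 \<le> nb" "\<And>m n. nb \<le> m \<Longrightarrow> m \<le> n \<Longrightarrow> real n \<le> 2 * real m \<Longrightarrow>
    0 < B m \<and> 0 < B n \<and> B n \<le> Cb * B m \<and> B m \<le> Cb * B n"
    using regvar_comparable[OF regvar_B, of 2] by auto
  obtain C2 where C2: "0 < C2" "\<forall>\<^sub>F n in sequentially. (\<Sum>h<n. \<bar>\<rho> h\<bar>) \<le> C2 * (real n * \<rho> n)" by (rule sum_rho_le)
  \<comment> \<open>\<epsilon> is the excess of the index of \<open>B\<close> over 1, so the lower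
    Potter exponent becomes -1 and \<open>B m / B n\<close> is at most
    \<open>D * m / n\<close>.\<close>
  obtain D nD where D: "0 < D" "1 \<le> nD" "\<And>m n. nD \<le> m \<Longrightarrow> m \<le> n \<Longrightarrow> 0 < B m \<and>
     B n \<le> D * (real n / real m) powr ((2 - 2 * d - \<alpha>) + (1 - 2 * d - \<alpha>)) * B m \<and>
     B m \<le> D * (real n / real m) powr ((1 - 2 * d - \<alpha>) - (2 - 2 * d - \<alpha>)) * B n"
    using regvarE[OF regvar_B, of "1 - 2 * d - \<alpha>"] d\<alpha> by auto
  obtain E nE where E: "0 < E" "1 \<le> nE" "\<And>m n. nE \<le> m \<Longrightarrow> m \<le> n \<Longrightarrow> 0 < \<rho> m \<and>
     \<rho> n \<le> E * (real n / real m) powr (- \<alpha> + \<alpha> / 2) * \<rho> m \<and>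
     \<rho> m \<le> E * (real n / real m) powr (\<alpha> / 2 - (- \<alpha>)) * \<rho> n"
    using regvarE[OF regvar_\<rho>, of "\<alpha> / 2"] alpha by auto
  obtain F1 where F1: "0 < F1" "\<forall>\<^sub>F n in sequentially. (\<Sum>m=1..n. \<bar>a m\<bar>) \<le> F1 * real n * a n"
    by (rule regvar_sum_abs_le[OF regvar_a]) (use d\<alpha> alpha in auto)
  have "regvar (\<lambda>n. a n * \<rho> n) (- d + - \<alpha>)" by (intro regvar_mult regvar_a regvar_\<rho>)
  then obtain F2 where F2: "0 < F2" "\<forall>\<^sub>F n in sequentially. (\<Sum>m=1..n. \<bar>a m * \<rho> m\<bar>) \<le> F2 * real n * (a n * \<rho> n)"
    by (rule regvar_sum_abs_le) (use d\<alpha> alpha in auto)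
  have "\<forall>\<^sub>F n in sequentially. (\<sigma> n)\<^sup>2 \<le> Cu * B n \<and> cl * B n \<le> (\<sigma> n)\<^sup>2 \<and> (\<Sum>h<n. \<bar>\<rho> h\<bar>) \<le> C2 * (real n * \<rho> n)
     \<and> (\<Sum>m=1..n. \<bar>a m\<bar>) \<le> F1 * real n * a n \<and> (\<Sum>m=1..n. \<bar>a m * \<rho> m\<bar>) \<le> F2 * real n * (a n * \<rho> n)
     \<and> na \<le> n \<and> nr \<le> n \<and> nb \<le> n \<and> nD \<le> n \<and> nE \<le> n"
    using Cu(2) cl(2) C2(2) F1(2) F2(2) by (intro eventually_conj eventually_ge_at_top)
  then obtain N0 where N0: "\<And>n. N0 \<le> n \<Longrightarrow> (\<sigma> n)\<^sup>2 \<le> Cu * B n \<and> cl * B n \<le> (\<sigma> n)\<^sup>2 \<and> (\<Sum>h<n. \<bar>\<rho> h\<bar>) \<le> C2 * (real n * \<rho> n)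
     \<and> (\<Sum>m=1..n. \<bar>a m\<bar>) \<le> F1 * real n * a n \<and> (\<Sum>m=1..n. \<bar>a m * \<rho> m\<bar>) \<le> F2 * real n * (a n * \<rho> n)
     \<and> na \<le> n \<and> nr \<le> n \<and> nb \<le> n \<and> nD \<le> n \<and> nE \<le> n"
    unfolding eventually_sequentially by blast
  have s0: "0 \<le> \<sigma> n" for n by (simp add: \<sigma>_def)
  have Bp: "0 < B n" if "N0 \<le> n" for n using Cb(3)[of n n] N0[OF that] by simp
  have sl: "sqrt cl * sqrt (B n) \<le> \<sigma> n" if "N0 \<le> n" for n
    using N0[OF that] s0[of n] by (metis real_sqrt_le_iff real_sqrt_mult real_sqrt_abs abs_of_nonneg)
  have su: "\<sigma> n \<le> sqrt Cu * sqrt (B n)" if "N0 \<le> n" for n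
    using N0[OF that] s0[of n] by (metis real_sqrt_le_iff real_sqrt_mult real_sqrt_abs abs_of_nonneg)
  have sp: "0 < \<sigma> n" if "N0 \<le> n" for n
  proof -
    have "0 < sqrt cl * sqrt (B n)" using cl(1) Bp[OF that] by simp
    then show ?thesis using sl[OF that] by linarith
  qed
  have cmp: "\<sigma> m \<le> sqrt (Cu * x / cl) * \<sigma> n" if "N0 \<le> m" "N0 \<le> n" "B m \<le> x * B n" "0 \<le> x" for m n x
  proof -
    have "\<sigma> m \<le> sqrt Cu * sqrt (B m)" by (rule su[OF that(1)])
    also have "\<dots> \<le> sqrt Cu * sqrt (x * B n)" using that Cu(1) by (intro mult_left_mono) auto
    also have "\<dots> = sqrt (Cu * x / cl) * (sqrt cl * sqrt (B n))"
      using cl(1) by (simp add: real_sqrt_mult real_sqrt_divide)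
    also have "\<dots> \<le> sqrt (Cu * x / cl) * \<sigma> n" using sl[OF that(2)] that Cu(1) cl(1) by (intro mult_left_mono) auto
    finally show ?thesis .
  qed
  define K where "K = max 1 (sqrt (Cu * Cb / cl))"
  have dbl: "\<sigma> m \<le> K * \<sigma> n \<and> \<sigma> n \<le> K * \<sigma> m" if "N0 \<le> m" "m \<le> n" "n \<le> 2 * m" for m n
  proof -
    have "real n \<le> 2 * real m" using that by linarith
    then have b: "B n \<le> Cb * B m" "B m \<le> Cb * B n" using Cb(3)[of m n] N0[OF that(1)] that by auto
    have k: "sqrt (Cu * Cb / cl) * \<sigma> i \<le> K * \<sigma> i" for i using s0[of i] by (intro mult_right_mono) (auto simp: K_def)
    have "\<sigma> m \<le> sqrt (Cu * Cb / cl) * \<sigma> n" using that b Cb(1) by (intro cmp) auto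
    moreover have "\<sigma> n \<le> sqrt (Cu * Cb / cl) * \<sigma> m" using that b Cb(1) by (intro cmp) auto
    ultimately show ?thesis using k[of m] k[of n] by linarith
  qed
  define Ci where "Ci = 4 * Ca\<^sup>2 * C2 * Cr / cl"
  have Ci: "0 < Ci" using Ca Cr C2 cl by (simp add: Ci_def)
  have inc: "(l2norm M (\<lambda>\<omega>. U n \<omega> - U m \<omega>))\<^sup>2 \<le> Ci * (real (n - m) / real m) * (\<sigma> m)\<^sup>2"
    if mn: "N0 \<le> m" "m \<le> n" "n \<le> 2 * m" for m n
  proof -
    have m1: "1 \<le> real m" using N0[OF mn(1)] Ca(2) by simp
    have rr: "real n \<le> 2 * real m" using mn by linarith
    have rpos: "0 < \<rho> n" "0 < \<rho> m" "\<rho> n \<le> Cr * \<rho> m" using Cr(3)[of m n] N0[OF mn(1)] mn rr by auto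
    \<comment> \<open>Schur's test with all lags below \<open>n\<close>, even though the increment
      only contains lags below \<open>n - m\<close>: the block length then enters linearly through
      the sum of the squared weights, which is what the chaining needs.\<close>
    have "(l2norm M (\<lambda>\<omega>. U n \<omega> - U m \<omega>))\<^sup>2 \<le> 2 * (\<Sum>t\<in>{m<..n}. (a t)\<^sup>2) * (\<Sum>h<n. \<bar>\<rho> h\<bar>)"
      unfolding U_diff[OF mn(2)] by (rule lincomb_norm_le) auto
    also have "\<dots> \<le> 2 * (real (n - m) * (Ca\<^sup>2 * (a m)\<^sup>2)) * (C2 * (2 * real m * (Cr * \<rho> m)))"
    proof (intro mult_mono mult_left_mono)
      have "(\<Sum>t\<in>{m<..n}. (a t)\<^sup>2) \<le> (\<Sum>t\<in>{m<..n}. Ca\<^sup>2 * (a m)\<^sup>2)"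
      proof (rule sum_mono)
        fix t assume "t \<in> {m<..n}"
        then have t: "m \<le> t" "real t \<le> 2 * real m" using rr by auto
        have "a t \<le> Ca * a m" "0 < a t" using Ca(3)[of m t] N0[OF mn(1)] t by auto
        then have "(a t)\<^sup>2 \<le> (Ca * a m)\<^sup>2" by (intro power_mono) auto
        then show "(a t)\<^sup>2 \<le> Ca\<^sup>2 * (a m)\<^sup>2" by (simp add: power_mult_distrib)
      qed
      then show "(\<Sum>t\<in>{m<..n}. (a t)\<^sup>2) \<le> real (n - m) * (Ca\<^sup>2 * (a m)\<^sup>2)" by simp
      have "(\<Sum>h<n. \<bar>\<rho> h\<bar>) \<le> C2 * (real n * \<rho> n)" using N0[of n] mn by linarith
      also have "\<dots> \<le> C2 * (2 * real m * (Cr * \<rho> m))"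
        using C2(1) rr rpos by (intro mult_left_mono mult_mono) auto
      finally show "(\<Sum>h<n. \<bar>\<rho> h\<bar>) \<le> C2 * (2 * real m * (Cr * \<rho> m))" .
    qed (auto intro: sum_nonneg)
    also have "\<dots> = (4 * Ca\<^sup>2 * C2 * Cr) * (real (n - m) / real m) * B m"
      using m1 by (simp add: B_eq)
    also have "\<dots> \<le> (4 * Ca\<^sup>2 * C2 * Cr) * (real (n - m) / real m) * ((\<sigma> m)\<^sup>2 / cl)"
      using N0[OF mn(1)] cl(1) C2(1) Cr(1) by (intro mult_left_mono) (auto simp: field_simps)
    also have "\<dots> = Ci * (real (n - m) / real m) * (\<sigma> m)\<^sup>2" by (simp add: Ci_def)
    finally show ?thesis .
  qed
  define Cc where "Cc = K * sqrt (Cu * D / cl) + Cr * F1 * F2 * sqrt E / cl"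
  have Cc: "0 < Cc" using Cu cl D Cr F1 F2 E by (simp add: Cc_def K_def add_pos_pos)
  have covb: "\<bar>expectation (\<lambda>\<omega>. U m \<omega> * U n \<omega>)\<bar> \<le> Cc * (real m / real n) powr (\<alpha> / 4) * \<sigma> m * \<sigma> n"
    if mn: "N0 \<le> m" "2 * m \<le> n" for m n
  proof -
    have m1: "1 \<le> real m" using N0[OF mn(1)] Ca(2) by simp
    have n1: "1 \<le> real n" "N0 \<le> n" "m \<le> n" using m1 mn by linarith+
    let ?q = "real m / real n"
    have q: "0 < ?q" "?q \<le> 1" using m1 n1 mn by auto
    have split: "expectation (\<lambda>\<omega>. U m \<omega> * U n \<omega>) = expectation (\<lambda>\<omega>. U m \<omega> * U (2 * m) \<omega>) + expectation (\<lambda>\<omega>. U m \<omega> * (U n \<omega> - U (2 * m) \<omega>))"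
      using L2_mult_integrable[OF U_L2[of m] U_L2[of "2 * m"]] L2_mult_integrable[OF U_L2[of m] L2_function_diff[OF U_L2[of n] U_L2[of "2 * m"]]]
      by (subst Bochner_Integration.integral_add[symmetric]) (auto simp: algebra_simps)
    have p1: "\<bar>expectation (\<lambda>\<omega>. U m \<omega> * U (2 * m) \<omega>)\<bar> \<le> K * sqrt (Cu * D / cl) * ?q powr (\<alpha> / 4) * \<sigma> m * \<sigma> n"
    proof -
      have "B m \<le> (D * ?q) * B n"
      proof -
        have "B m \<le> D * (real n / real m) powr ((1 - 2 * d - \<alpha>) - (2 - 2 * d - \<alpha>)) * B n"
          using D(3)[of m n] N0[OF mn(1)] n1 by simp
        also have "(1 - 2 * d - \<alpha>) - (2 - 2 * d - \<alpha>) = - 1" by simp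
        also have "(real n / real m) powr (- 1) = ?q" using m1 n1 by (simp add: powr_minus)
        finally show ?thesis .
      qed
      then have "\<sigma> m \<le> sqrt (Cu * (D * ?q) / cl) * \<sigma> n" using mn n1 D(1) q by (intro cmp) auto
      also have "sqrt (Cu * (D * ?q) / cl) = sqrt (Cu * D / cl) * ?q powr (1 / 2)"
        using q by (simp add: real_sqrt_mult real_sqrt_divide powr_half_sqrt mult_ac)
      also have "?q powr (1 / 2) \<le> ?q powr (\<alpha> / 4)" using q alpha by (intro powr_mono') auto
      finally have sm: "\<sigma> m \<le> sqrt (Cu * D / cl) * ?q powr (\<alpha> / 4) * \<sigma> n"
        using Cu(1) cl(1) D(1) s0[of n] by (simp add: mult_left_mono mult_right_mono)
      have "\<bar>expectation (\<lambda>\<omega>. U m \<omega> * U (2 * m) \<omega>)\<bar> \<le> \<sigma> m * \<sigma> (2 * m)"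
        unfolding \<sigma>_def by (intro L2_Cauchy_Schwarz U_L2)
      also have "\<dots> \<le> \<sigma> m * (K * \<sigma> m)" using dbl[of m "2 * m"] mn s0[of m] by (intro mult_left_mono) auto
      also have "\<dots> \<le> \<sigma> m * (K * (sqrt (Cu * D / cl) * ?q powr (\<alpha> / 4) * \<sigma> n))"
        using sm s0[of m] by (intro mult_left_mono) (auto simp: K_def)
      finally show ?thesis by (simp add: mult_ac)
    qed
    have p2: "\<bar>expectation (\<lambda>\<omega>. U m \<omega> * (U n \<omega> - U (2 * m) \<omega>))\<bar> \<le> (Cr * F1 * F2 * sqrt E / cl) * ?q powr (\<alpha> / 4) * \<sigma> m * \<sigma> n"
    proof -
      have "expectation (\<lambda>\<omega>. U m \<omega> * (U n \<omega> - U (2 * m) \<omega>)) = (\<Sum>s=1..m. \<Sum>t\<in>{2 * m<..n}. a s * a t * \<rho> (lag s t))"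
        unfolding U_diff[OF mn(2)] U_def[of m] by (rule lincomb_inner) auto
      also have "\<bar>\<dots>\<bar> \<le> (\<Sum>s=1..m. \<Sum>t\<in>{2 * m<..n}. \<bar>a s * a t * \<rho> (lag s t)\<bar>)"
        by (intro order_trans[OF sum_abs] sum_mono sum_abs)
      also have "\<dots> \<le> (\<Sum>s=1..m. \<Sum>t\<in>{2 * m<..n}. \<bar>a s\<bar> * (Cr * \<bar>a t * \<rho> t\<bar>))"
      proof (intro sum_mono)
        fix s t assume st: "s \<in> {1..m}" "t \<in> {2 * m<..n}"
        then have l: "lag s t = t - s" "m \<le> t - s" "t - s \<le> t" "real t \<le> 2 * real (t - s)" by (auto simp: lag_def)
        have "\<rho> (t - s) \<le> Cr * \<rho> t" "0 < \<rho> (t - s)" "0 < \<rho> t" using Cr(3)[of "t - s" t] l N0[OF mn(1)] by auto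
        then have "\<bar>a s\<bar> * \<bar>a t\<bar> * \<bar>\<rho> (t - s)\<bar> \<le> \<bar>a s\<bar> * \<bar>a t\<bar> * (Cr * \<bar>\<rho> t\<bar>)" by (intro mult_left_mono) auto
        then show "\<bar>a s * a t * \<rho> (lag s t)\<bar> \<le> \<bar>a s\<bar> * (Cr * \<bar>a t * \<rho> t\<bar>)" by (simp add: l(1) abs_mult mult_ac)
      qed
      also have "\<dots> = Cr * (\<Sum>s=1..m. \<bar>a s\<bar>) * (\<Sum>t\<in>{2 * m<..n}. \<bar>a t * \<rho> t\<bar>)"
      proof -
        have "(\<Sum>s=1..m. \<Sum>t\<in>{2 * m<..n}. \<bar>a s\<bar> * (Cr * \<bar>a t * \<rho> t\<bar>)) = (\<Sum>s=1..m. \<bar>a s\<bar>) * (\<Sum>t\<in>{2 * m<..n}. Cr * \<bar>a t * \<rho> t\<bar>)"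
          by (simp only: sum_product)
        then show ?thesis by (simp only: sum_distrib_left[symmetric] mult_ac)
      qed
      also have "\<dots> \<le> Cr * (F1 * real m * a m) * (F2 * real n * (a n * \<rho> n))"
      proof (intro mult_mono mult_left_mono)
        show "(\<Sum>s=1..m. \<bar>a s\<bar>) \<le> F1 * real m * a m" using N0[OF mn(1)] by simp
        have "(\<Sum>t\<in>{2 * m<..n}. \<bar>a t * \<rho> t\<bar>) \<le> (\<Sum>t=1..n. \<bar>a t * \<rho> t\<bar>)" by (rule sum_mono2) auto
        then show "(\<Sum>t\<in>{2 * m<..n}. \<bar>a t * \<rho> t\<bar>) \<le> F2 * real n * (a n * \<rho> n)" using N0[OF n1(2)] by linarith
        have "0 < a m" using Ca(3)[of m m] N0[OF mn(1)] by simp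
        then show "0 \<le> Cr * (F1 * real m * a m)" using Cr(1) F1(1) by simp
      qed (use Cr(1) in \<open>auto intro: sum_nonneg\<close>)
      also have "\<dots> = (Cr * F1 * F2) * (real m * a m * real n * a n * \<rho> n)" by simp
      finally have f1: "\<bar>expectation (\<lambda>\<omega>. U m \<omega> * (U n \<omega> - U (2 * m) \<omega>))\<bar> \<le> (Cr * F1 * F2) * (real m * a m * real n * a n * \<rho> n)" .
      \<comment> \<open>The left-hand side is \<open>sqrt (B m) * sqrt (B n)\<close> times
        \<open>sqrt (\<rho> n / \<rho> m)\<close>. Potter's bound with \<epsilon> = \<alpha> / 2
        gives that quotient the decay exponent \<alpha> / 2, and the root gives \<alpha> /
        4.\<close>
      have f2: "real m * a m * real n * a n * \<rho> n \<le> sqrt E * ?q powr (\<alpha> / 4) * (sqrt (B m) * sqrt (B n))"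
      proof -
        have am: "0 < a m" "0 < a n" using Ca(3)[of m m] Ca(3)[of n n] N0[OF mn(1)] N0[OF n1(2)] by auto
        have rm: "0 < \<rho> m" "0 < \<rho> n" using Cr(3)[of m m] Cr(3)[of n n] N0[OF mn(1)] N0[OF n1(2)] by auto
        have sB: "sqrt (B i) = real i * a i * sqrt (\<rho> i)" if "0 < a i" for i
        proof -
          have "B i = (real i * a i)\<^sup>2 * \<rho> i" by (simp add: B_eq power2_eq_square)
          then show ?thesis using that by (simp add: real_sqrt_mult)
        qed
        have "\<rho> n \<le> E * (real n / real m) powr (- \<alpha> + \<alpha> / 2) * \<rho> m" using E(3)[of m n] N0[OF mn(1)] n1 by simp
        also have "(real n / real m) powr (- \<alpha> + \<alpha> / 2) = (?q powr (\<alpha> / 4))\<^sup>2"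
        proof -
          have "(real n / real m) powr (- (\<alpha> / 2)) = ?q powr (\<alpha> / 2)"
            using m1 n1 by (simp add: powr_minus_divide powr_divide)
          moreover have "(?q powr (\<alpha> / 4))\<^sup>2 = ?q powr (\<alpha> / 2)" by (simp add: power2_eq_square powr_add[symmetric])
          moreover have "- \<alpha> + \<alpha> / 2 = - (\<alpha> / 2)" by simp
          ultimately show ?thesis by simp
        qed
        finally have "sqrt (\<rho> n) \<le> sqrt (E * (?q powr (\<alpha> / 4))\<^sup>2 * \<rho> m)" by simp
        also have "\<dots> = sqrt E * ?q powr (\<alpha> / 4) * sqrt (\<rho> m)" by (simp add: real_sqrt_mult)
        finally have "sqrt (\<rho> n) * sqrt (\<rho> n) \<le> (sqrt E * ?q powr (\<alpha> / 4) * sqrt (\<rho> m)) * sqrt (\<rho> n)"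
          using rm by (intro mult_right_mono) auto
        then have "\<rho> n \<le> sqrt E * ?q powr (\<alpha> / 4) * sqrt (\<rho> m) * sqrt (\<rho> n)" using rm by simp
        then have "(real m * a m * real n * a n) * \<rho> n \<le> (real m * a m * real n * a n) * (sqrt E * ?q powr (\<alpha> / 4) * sqrt (\<rho> m) * sqrt (\<rho> n))"
          using am by (intro mult_left_mono) auto
        then show ?thesis by (simp add: sB am mult_ac)
      qed
      have f3: "sqrt (B m) * sqrt (B n) \<le> (\<sigma> m * \<sigma> n) / cl"
      proof -
        have "(sqrt cl * sqrt (B m)) * (sqrt cl * sqrt (B n)) \<le> \<sigma> m * \<sigma> n"
          using sl[OF mn(1)] sl[OF n1(2)] s0 cl(1) Bp[OF mn(1)] Bp[OF n1(2)] by (intro mult_mono) auto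
        moreover have "(sqrt cl * sqrt (B m)) * (sqrt cl * sqrt (B n)) = cl * (sqrt (B m) * sqrt (B n))"
        proof -
          have "(sqrt cl * sqrt (B m)) * (sqrt cl * sqrt (B n)) = (sqrt cl * sqrt cl) * (sqrt (B m) * sqrt (B n))" by (simp only: mult_ac)
          also have "sqrt cl * sqrt cl = cl" using cl(1) by simp
          finally show ?thesis .
        qed
        ultimately have "cl * (sqrt (B m) * sqrt (B n)) \<le> \<sigma> m * \<sigma> n" by linarith
        then show ?thesis using cl(1) by (simp add: field_simps)
      qed
      have "sqrt E * ?q powr (\<alpha> / 4) * (sqrt (B m) * sqrt (B n)) \<le> sqrt E * ?q powr (\<alpha> / 4) * ((\<sigma> m * \<sigma> n) / cl)"
        using f3 E(1) by (intro mult_left_mono) auto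
      with f2 have "real m * a m * real n * a n * \<rho> n \<le> sqrt E * ?q powr (\<alpha> / 4) * ((\<sigma> m * \<sigma> n) / cl)" by linarith
      then have "(Cr * F1 * F2) * (real m * a m * real n * a n * \<rho> n) \<le> (Cr * F1 * F2) * (sqrt E * ?q powr (\<alpha> / 4) * ((\<sigma> m * \<sigma> n) / cl))"
        using Cr(1) F1(1) F2(1) by (intro mult_left_mono) auto
      also have "\<dots> = (Cr * F1 * F2 * sqrt E / cl) * ?q powr (\<alpha> / 4) * \<sigma> m * \<sigma> n" by (simp add: mult_ac)
      finally show ?thesis using f1 by linarith
    qed
    have "\<bar>expectation (\<lambda>\<omega>. U m \<omega> * U n \<omega>)\<bar> \<le> K * sqrt (Cu * D / cl) * ?q powr (\<alpha> / 4) * \<sigma> m * \<sigma> n + (Cr * F1 * F2 * sqrt E / cl) * ?q powr (\<alpha> / 4) * \<sigma> m * \<sigma> n"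
      unfolding split using p1 p2 by linarith
    also have "\<dots> = Cc * ?q powr (\<alpha> / 4) * \<sigma> m * \<sigma> n" by (simp add: Cc_def algebra_simps)
    finally show ?thesis .
  qed
  have "gaussian_lil M U \<sigma> (max 1 N0) (Ci + Cc) K (\<alpha> / 4)"
  proof (unfold_locales, goal_cases)
    case (1 n) show ?case by (simp add: \<sigma>_def)
  next
    case (2 m n) show ?case by (rule U_pair)
  next
    case 3 show ?case using Ci Cc by simp
  next
    case 4 show ?case by (simp add: K_def)
  next
    case 5 show ?case using alpha by simp
  next
    case 6 show ?case by simp
  next
    case (7 n) then show ?case using sp[of n] by (simp add: \<sigma>_def)
  next
    case (8 m n) then show ?case using dbl[of m n] by (simp add: \<sigma>_def)
  next
    case (9 m n)
    then have "(l2norm M (\<lambda>\<omega>. U n \<omega> - U m \<omega>))\<^sup>2 \<le> Ci * (real (n - m) / real m) * (\<sigma> m)\<^sup>2" using inc[of m n] by simp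
    also have "\<dots> \<le> (Ci + Cc) * (real (n - m) / real m) * (\<sigma> m)\<^sup>2" using Cc by (intro mult_right_mono) auto
    finally show ?case by (simp add: \<sigma>_def)
  next
    case (10 m n)
    then have "\<bar>expectation (\<lambda>\<omega>. U m \<omega> * U n \<omega>)\<bar> \<le> Cc * (real m / real n) powr (\<alpha> / 4) * \<sigma> m * \<sigma> n" using covb[of m n] by simp
    also have "\<dots> \<le> (Ci + Cc) * (real m / real n) powr (\<alpha> / 4) * \<sigma> m * \<sigma> n" using Ci s0 by (intro mult_right_mono) auto
    finally show ?case by (simp add: \<sigma>_def)
  qed
  then show thesis by (rule that)
qed

end

section \<open>The remainder of Hermite rank two\<close>

text \<open>Markov's inequality and Borel-Cantelli at each threshold \<open>1 / (m + 1)\<close>;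
  restricting to countably many thresholds keeps the exceptional set null.\<close>

lemma (in prob_space) AE_tendsto_zero:
  fixes Y :: "nat \<Rightarrow> 'a \<Rightarrow> real"
  assumes nonneg: "\<And>k \<omega>. 0 \<le> Y k \<omega>" and int: "\<And>k. integrable M (Y k)"
    and ev: "\<forall>\<^sub>F k in sequentially. expectation (Y k) \<le> b k" and b: "summable b"
  shows "AE \<omega> in M. (\<lambda>k. Y k \<omega>) \<longlonglongrightarrow> 0"
proof -
  have [measurable]: "Y k \<in> borel_measurable M" for k using int by auto
  have "AE \<omega> in M. \<forall>\<^sub>F k in sequentially. Y k \<omega> < 1 / real (Suc m)" for m
  proof -
    define A where "A k = {\<omega> \<in> space M. 1 / real (Suc m) \<le> Y k \<omega>}" for k
    have Am: "A k \<in> sets M" for k unfolding A_def by measurable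
    have "\<forall>\<^sub>F k in sequentially. norm (prob (A k)) \<le> real (Suc m) * b k"
      using ev
    proof eventually_elim
      case (elim k)
      have "prob (A k) \<le> expectation (Y k) / (1 / real (Suc m))"
        unfolding A_def by (rule integral_Markov_inequality_measure[where A = "{}"]) (use nonneg int in auto)
      also have "\<dots> \<le> b k / (1 / real (Suc m))" using elim by (intro divide_right_mono) auto
      finally show ?case by (simp add: mult.commute)
    qed
    then have "summable (\<lambda>k. prob (A k))" by (rule summable_comparison_test_ev) (rule summable_mult[OF b])
    then have "AE \<omega> in M. \<forall>\<^sub>F k in sequentially. \<omega> \<in> space M - A k"
      by (intro borel_cantelli_AE1 Am) (auto simp: emeasure_eq_measure)
    then show ?thesis
    proof eventually_elim
      case (elim \<omega>)
      then show ?case by eventually_elim (auto simp: A_def not_le)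
    qed
  qed
  then have "AE \<omega> in M. \<forall>m. \<forall>\<^sub>F k in sequentially. Y k \<omega> < 1 / real (Suc m)" by (simp add: AE_all_countable)
  then show ?thesis
  proof eventually_elim
    case (elim \<omega>)
    show ?case
    proof (rule order_tendstoI)
      fix y :: real assume "y < 0"
      then have "y < Y k \<omega>" for k using nonneg[of k \<omega>] by linarith
      then show "\<forall>\<^sub>F k in sequentially. y < Y k \<omega>" by simp
    next
      fix y :: real assume "0 < y"
      then obtain m where "1 / real (Suc m) < y" using reals_Archimedean by (auto simp: inverse_eq_divide)
      with elim[rule_format, of m] show "\<forall>\<^sub>F k in sequentially. Y k \<omega> < y"
        by (auto elim: eventually_mono)
    qed
  qed
qed

lemma sum_blocks:
  fixes f :: "nat \<Rightarrow> real"
  shows "(\<Sum>l<m. \<Sum>t\<in>{l * c<..Suc l * c}. f t) = (\<Sum>t=1..m * c. f t)"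
proof (induction m)
  case (Suc m)
  have "(\<Sum>t=1..Suc m * c. f t) - (\<Sum>t=1..m * c. f t) = (\<Sum>t\<in>{m * c<..Suc m * c}. f t)"
    by (rule sum_diff_greaterThanAtMost) simp
  then show ?case using Suc by simp
qed simp

section \<open>Maximal inequality for the remainder\<close>

locale regvar_remainder = regvar_sums +
  fixes R :: "real \<Rightarrow> real" and \<kappa> :: real
  assumes R_L2: "\<And>t. 1 \<le> t \<Longrightarrow> L2_function M (\<lambda>\<omega>. R (X t \<omega>))"
    and R_cov: "\<And>s t. 1 \<le> s \<Longrightarrow> 1 \<le> t \<Longrightarrow> \<bar>expectation (\<lambda>\<omega>. R (X s \<omega>) * R (X t \<omega>))\<bar> \<le> (\<rho> (lag s t))\<^sup>2 * \<kappa>"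
    and kappa: "0 \<le> \<kappa>"
begin

definition V :: "nat \<Rightarrow> 'a \<Rightarrow> real" where
  "V n \<omega> = (\<Sum>t=1..n. a t * R (X t \<omega>))"

definition G2 :: "nat \<Rightarrow> real" where
  "G2 n = 2 * \<kappa> * (\<Sum>t=1..n. (a t)\<^sup>2) * (\<Sum>h<n. (\<rho> h)\<^sup>2)"

lemma remainder_lincomb_L2: "I \<subseteq> {1..} \<Longrightarrow> L2_function M (\<lambda>\<omega>. \<Sum>t\<in>I. a t * R (X t \<omega>))"
  by (intro L2_function_sum L2_function_cmult R_L2) auto

lemma V_L2: "L2_function M (V n)"
  unfolding V_def[abs_def] by (rule remainder_lincomb_L2) auto

lemma remainder_norm_le:
  assumes "I \<subseteq> {1..n}"
  shows "(l2norm M (\<lambda>\<omega>. \<Sum>t\<in>I. a t * R (X t \<omega>)))\<^sup>2 \<le> 2 * \<kappa> * (\<Sum>t\<in>I. (a t)\<^sup>2) * (\<Sum>h<n. (\<rho> h)\<^sup>2)"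
proof -
  have I1: "1 \<le> t" if "t \<in> I" for t using assms that by auto
  have "(l2norm M (\<lambda>\<omega>. \<Sum>t\<in>I. a t * R (X t \<omega>)))\<^sup>2 = (\<Sum>s\<in>I. \<Sum>t\<in>I. a s * a t * expectation (\<lambda>\<omega>. R (X s \<omega>) * R (X t \<omega>)))"
  proof -
    have "expectation (\<lambda>\<omega>. (\<Sum>s\<in>I. a s * R (X s \<omega>)) * (\<Sum>t\<in>I. a t * R (X t \<omega>))) = (\<Sum>s\<in>I. \<Sum>t\<in>I. a s * a t * expectation (\<lambda>\<omega>. R (X s \<omega>) * R (X t \<omega>)))"
    proof (rule L2_lincomb_inner)
      fix t assume "t \<in> I \<union> I"
      then show "L2_function M (\<lambda>\<omega>. R (X t \<omega>))" using I1 by (intro R_L2) auto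
    qed
    then show ?thesis unfolding l2norm_power2 by (simp only: power2_eq_square)
  qed
  also have "\<dots> \<le> (\<Sum>s\<in>I. \<Sum>t\<in>I. \<bar>a s\<bar> * \<bar>a t\<bar> * (\<kappa> * (\<rho> (lag s t))\<^sup>2))"
  proof (intro sum_mono)
    fix s t assume "s \<in> I" "t \<in> I"
    then have "\<bar>expectation (\<lambda>\<omega>. R (X s \<omega>) * R (X t \<omega>))\<bar> \<le> \<kappa> * (\<rho> (lag s t))\<^sup>2" using R_cov[of s t] I1 by (simp add: mult.commute)
    then have "\<bar>a s * a t * expectation (\<lambda>\<omega>. R (X s \<omega>) * R (X t \<omega>))\<bar> \<le> \<bar>a s\<bar> * \<bar>a t\<bar> * (\<kappa> * (\<rho> (lag s t))\<^sup>2)"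
      unfolding abs_mult by (rule mult_left_mono) simp
    then show "a s * a t * expectation (\<lambda>\<omega>. R (X s \<omega>) * R (X t \<omega>)) \<le> \<bar>a s\<bar> * \<bar>a t\<bar> * (\<kappa> * (\<rho> (lag s t))\<^sup>2)" by linarith
  qed
  also have "\<dots> \<le> 2 * (\<Sum>t\<in>I. (a t)\<^sup>2) * (\<Sum>h<n. \<kappa> * (\<rho> h)\<^sup>2)"
    by (rule quadratic_form_lag_le) (use assms kappa in auto)
  also have "\<dots> = 2 * \<kappa> * (\<Sum>t\<in>I. (a t)\<^sup>2) * (\<Sum>h<n. (\<rho> h)\<^sup>2)" by (simp add: sum_distrib_left[symmetric])
  finally show ?thesis .
qed

lemma V_norm_le: "(l2norm M (V n))\<^sup>2 \<le> G2 n"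
  unfolding V_def[abs_def] G2_def by (rule remainder_norm_le) simp

lemma V_diff: "m \<le> n \<Longrightarrow> V n \<omega> - V m \<omega> = (\<Sum>t\<in>{m<..n}. a t * R (X t \<omega>))"
  unfolding V_def by (rule sum_diff_greaterThanAtMost)

lemma G2_bound: obtains C \<delta> where "0 < C" "0 < \<delta>" "\<forall>\<^sub>F n in sequentially. G2 n \<le> C * real n powr (- \<delta>) * B n"
proof -
  obtain C1 where C1: "0 < C1" "\<forall>\<^sub>F n in sequentially. (\<Sum>t=1..n. (a t)\<^sup>2) \<le> C1 * real n * (a n)\<^sup>2" by (rule sum_a2_le)
  obtain C2 \<delta> where C2: "0 < C2" "0 < \<delta>" "\<forall>\<^sub>F n in sequentially. (\<Sum>h<n. (\<rho> h)\<^sup>2) \<le> C2 * (real n powr (1 - \<delta>) * \<rho> n)" by (rule sum_rho2_le)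
  from C1(2) C2(3) regvar_pos[OF regvar_B] eventually_ge_at_top[of 1]
  \<comment> \<open>The added 1 keeps the constant positive when \<kappa> = 0.\<close>
  have "\<forall>\<^sub>F n in sequentially. G2 n \<le> (2 * \<kappa> * C1 * C2 + 1) * real n powr (- \<delta>) * B n"
  proof eventually_elim
    case (elim n)
    have "G2 n \<le> 2 * \<kappa> * (C1 * real n * (a n)\<^sup>2) * (C2 * (real n powr (1 - \<delta>) * \<rho> n))"
      unfolding G2_def using elim kappa C1(1) by (intro mult_mono mult_left_mono) (auto intro!: sum_nonneg mult_nonneg_nonneg)
    also have "real n powr (1 - \<delta>) = real n * real n powr (- \<delta>)" using elim by (simp add: powr_diff powr_minus divide_inverse)
    also have "2 * \<kappa> * (C1 * real n * (a n)\<^sup>2) * (C2 * (real n * real n powr (- \<delta>) * \<rho> n)) = (2 * \<kappa> * C1 * C2) * real n powr (- \<delta>) * B n"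
      by (simp add: B_eq mult_ac)
    also have "\<dots> \<le> (2 * \<kappa> * C1 * C2 + 1) * real n powr (- \<delta>) * B n"
      using elim by (intro mult_right_mono) auto
    finally show ?case .
  qed
  then show thesis using C1 C2 kappa by (intro that[of "2 * \<kappa> * C1 * C2 + 1" \<delta>]) (auto intro!: add_nonneg_pos mult_nonneg_nonneg)
qed

text \<open>A Rademacher--Menshov majorant of the squared partial sums up to \<open>2 ^ k\<close>.\<close>

definition D :: "nat \<Rightarrow> 'a \<Rightarrow> real" where
  "D k \<omega> = real k * (\<Sum>j<k. \<Sum>l<2 ^ (k - j). (V (Suc l * 2 ^ j) \<omega> - V (l * 2 ^ j) \<omega>)\<^sup>2)"

lemma D_nonneg: "0 \<le> D k \<omega>"
  unfolding D_def by (intro mult_nonneg_nonneg sum_nonneg) auto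

lemma D_integrable: "integrable M (D k)"
  unfolding D_def[abs_def]
  by (intro integrable_mult_right Bochner_Integration.integrable_sum L2_functionD(2) L2_function_diff V_L2)

text \<open>On each dyadic level the blocks are disjoint, so their bounds, linear in the sums of
  \<open>(a t)\<^sup>2\<close>, add up to at most \<open>G2 (2 ^ k)\<close>. There are
  \<open>k\<close> levels, and the definition of \<open>D\<close> carries another factor
  \<open>k\<close>.\<close>

lemma D_expectation: "expectation (D k) \<le> (real k)\<^sup>2 * G2 (2 ^ k)"
proof -
  have i: "integrable M (\<lambda>\<omega>. (V m \<omega> - V n \<omega>)\<^sup>2)" for m n by (intro L2_functionD(2) L2_function_diff V_L2)
  have "expectation (D k) = real k * (\<Sum>j<k. \<Sum>l<2 ^ (k - j). (l2norm M (\<lambda>\<omega>. V (Suc l * 2 ^ j) \<omega> - V (l * 2 ^ j) \<omega>))\<^sup>2)"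
    unfolding D_def[abs_def] l2norm_power2 using i by (simp add: Bochner_Integration.integral_sum Bochner_Integration.integrable_sum del: mult_Suc)
  also have "\<dots> \<le> real k * (\<Sum>j<k. G2 (2 ^ k))"
  proof (intro mult_left_mono sum_mono)
    fix j assume j: "j \<in> {..<k}"
    then have p: "(2::nat) ^ k = 2 ^ (k - j) * 2 ^ j" by (simp add: power_add[symmetric])
    have "(\<Sum>l<2 ^ (k - j). (l2norm M (\<lambda>\<omega>. V (Suc l * 2 ^ j) \<omega> - V (l * 2 ^ j) \<omega>))\<^sup>2)
       \<le> (\<Sum>l<2 ^ (k - j). 2 * \<kappa> * (\<Sum>t\<in>{l * 2 ^ j<..Suc l * 2 ^ j}. (a t)\<^sup>2) * (\<Sum>h<2 ^ k. (\<rho> h)\<^sup>2))"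
    proof (rule sum_mono)
      fix l :: nat assume "l \<in> {..<2 ^ (k - j)}"
      then have "Suc l * 2 ^ j \<le> 2 ^ k" unfolding p by (intro mult_right_mono) auto
      moreover have "V (Suc l * 2 ^ j) \<omega> - V (l * 2 ^ j) \<omega> = (\<Sum>t\<in>{l * 2 ^ j<..Suc l * 2 ^ j}. a t * R (X t \<omega>))" for \<omega>
        by (rule V_diff) simp
      ultimately show "(l2norm M (\<lambda>\<omega>. V (Suc l * 2 ^ j) \<omega> - V (l * 2 ^ j) \<omega>))\<^sup>2 \<le> 2 * \<kappa> * (\<Sum>t\<in>{l * 2 ^ j<..Suc l * 2 ^ j}. (a t)\<^sup>2) * (\<Sum>h<2 ^ k. (\<rho> h)\<^sup>2)"
        by (simp only:) (rule remainder_norm_le, auto)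
    qed
    also have "\<dots> = 2 * \<kappa> * (\<Sum>l<2 ^ (k - j). \<Sum>t\<in>{l * 2 ^ j<..Suc l * 2 ^ j}. (a t)\<^sup>2) * (\<Sum>h<2 ^ k. (\<rho> h)\<^sup>2)"
      by (simp only: sum_distrib_left[symmetric] sum_distrib_right[symmetric])
    also have "\<dots> = G2 (2 ^ k)" unfolding sum_blocks G2_def p ..
    finally show "(\<Sum>l<2 ^ (k - j). (l2norm M (\<lambda>\<omega>. V (Suc l * 2 ^ j) \<omega> - V (l * 2 ^ j) \<omega>))\<^sup>2) \<le> G2 (2 ^ k)" .
  qed simp
  finally show ?thesis by (simp add: power2_eq_square mult.assoc)
qed

text \<open>Clearing the binary digits of \<open>n\<close> leads to 0 in \<open>k\<close> steps, at
  most one increment per level; Cauchy-Schwarz over the levels produces the factor \<open>k\<close>.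
  The majorant no longer depends on \<open>n\<close>, so one expectation controls all partial sums
  of the block.\<close>

lemma V_le_D:
  assumes "n < 2 ^ k"
  shows "(V n \<omega>)\<^sup>2 \<le> D k \<omega>"
proof -
  let ?x = "\<lambda>i. V ((n div 2 ^ i) * 2 ^ i) \<omega> - V ((n div 2 ^ Suc i) * 2 ^ Suc i) \<omega>"
  have "n div 2 ^ k = 0" using assms by simp
  then have "\<bar>V n \<omega>\<bar> \<le> (\<Sum>i<k. \<bar>?x i\<bar>)"
    using dyadic_chain[of "\<lambda>m. V m \<omega>" n k] by (simp add: V_def[of 0])
  then have "\<bar>V n \<omega>\<bar>\<^sup>2 \<le> (\<Sum>i<k. \<bar>?x i\<bar>)\<^sup>2" by (rule power_mono) simp
  also have "\<dots> \<le> (\<Sum>i<k. \<bar>?x i\<bar>\<^sup>2) * real k"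
    using sum_squared_le_sum_of_squares[of "\<lambda>i. \<bar>?x i\<bar>" "{..<k}"] by simp
  also have "\<dots> \<le> (\<Sum>j<k. \<Sum>l<2 ^ (k - j). (V (Suc l * 2 ^ j) \<omega> - V (l * 2 ^ j) \<omega>)\<^sup>2) * real k"
  proof (intro mult_right_mono sum_mono)
    fix i assume i: "i \<in> {..<k}"
    define q where "q = n div 2 ^ i"
    show "\<bar>?x i\<bar>\<^sup>2 \<le> (\<Sum>l<2 ^ (k - i). (V (Suc l * 2 ^ i) \<omega> - V (l * 2 ^ i) \<omega>)\<^sup>2)"
    proof (cases "even q")
      case True
      then show ?thesis unfolding dyadic_step by (auto simp: q_def intro!: sum_nonneg)
    next
      case False
      have p: "(2::nat) ^ k = 2 ^ (k - i) * 2 ^ i" using i by (simp add: power_add[symmetric])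
      have q2: "q < 2 ^ (k - i)" unfolding q_def using assms p by (simp add: div_less_iff_less_mult)
      have sq: "Suc (q - 1) = q" using False by (auto elim: oddE)
      have "\<bar>?x i\<bar>\<^sup>2 = (V (Suc (q - 1) * 2 ^ i) \<omega> - V ((q - 1) * 2 ^ i) \<omega>)\<^sup>2"
        using False unfolding dyadic_step sq by (simp add: q_def)
      also have "\<dots> \<le> (\<Sum>l<2 ^ (k - i). (V (Suc l * 2 ^ i) \<omega> - V (l * 2 ^ i) \<omega>)\<^sup>2)"
        by (rule member_le_sum) (use q2 in auto)
      finally show ?thesis .
    qed
  qed simp
  finally show ?thesis by (simp add: D_def mult.commute)
qed

lemma V_norm_negligible: "(\<lambda>n. l2norm M (V n) / \<sigma> n) \<longlonglongrightarrow> 0"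
proof -
  obtain C \<delta> where C: "0 < C" "0 < \<delta>" "\<forall>\<^sub>F n in sequentially. G2 n \<le> C * real n powr (- \<delta>) * B n" by (rule G2_bound)
  obtain c where c: "0 < c" "\<forall>\<^sub>F n in sequentially. c * B n \<le> (\<sigma> n)\<^sup>2" by (rule sigma_lower)
  have lim: "(\<lambda>n. sqrt (C / c * real n powr (- \<delta>))) \<longlonglongrightarrow> 0"
  proof -
    have "(\<lambda>n. C / c * real n powr (- \<delta>)) \<longlonglongrightarrow> 0" using C(2) by real_asymp
    from tendsto_real_sqrt[OF this] show ?thesis by simp
  qed
  have "\<forall>\<^sub>F n in sequentially. norm (l2norm M (V n) / \<sigma> n) \<le> sqrt (C / c * real n powr (- \<delta>))"
    using C(3) c(2) regvar_pos[OF regvar_B]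
  proof eventually_elim
    case (elim n)
    have "0 < c * B n" using c elim by simp
    then have s2: "0 < (\<sigma> n)\<^sup>2" using elim by linarith
    have "(l2norm M (V n))\<^sup>2 \<le> C * real n powr (- \<delta>) * B n" using V_norm_le[of n] elim by linarith
    also have "\<dots> \<le> C * real n powr (- \<delta>) * ((\<sigma> n)\<^sup>2 / c)"
      using elim c C by (intro mult_left_mono) (auto simp: field_simps)
    finally have "(l2norm M (V n))\<^sup>2 / (\<sigma> n)\<^sup>2 \<le> C / c * real n powr (- \<delta>)"
      using s2 by (simp add: pos_divide_le_eq mult_ac)
    then have "sqrt ((l2norm M (V n) / \<sigma> n)\<^sup>2) \<le> sqrt (C / c * real n powr (- \<delta>))"
      by (simp add: power_divide)
    then show ?case by simp
  qed
  then show ?thesis by (rule Lim_null_comparison[OF _ lim])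
qed

lemma V_negligible: "AE \<omega> in M. (\<lambda>n. V n \<omega> / \<sigma> n) \<longlonglongrightarrow> 0"
proof -
  obtain C \<delta> where C: "0 < C" "0 < \<delta>" "\<forall>\<^sub>F n in sequentially. G2 n \<le> C * real n powr (- \<delta>) * B n" by (rule G2_bound)
  obtain c where c: "0 < c" "\<forall>\<^sub>F n in sequentially. c * B n \<le> (\<sigma> n)\<^sup>2" by (rule sigma_lower)
  obtain Cb nb where Cb: "0 < Cb" "1 \<le> nb" "\<And>m n. nb \<le> m \<Longrightarrow> m \<le> n \<Longrightarrow> real n \<le> 2 * real m \<Longrightarrow>
    0 < B m \<and> 0 < B n \<and> B n \<le> Cb * B m \<and> B m \<le> Cb * B n"
    using regvar_comparable[OF regvar_B, of 2] by auto
  have pow2: "filterlim (\<lambda>k. 2 ^ k :: nat) at_top sequentially"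
    by (rule filterlim_at_top_mono[OF filterlim_ident]) (simp add: less_imp_le)
  \<comment> \<open>The gain \<open>2 powr (- \<delta> * k)\<close> is split evenly: one factor
    \<open>r ^ k\<close> pays for the \<open>k\<^sup>2\<close> of the maximal inequality, the other
    makes the series converge.\<close>
  define r where "r = 2 powr (- \<delta> / 2)"
  have r: "0 < r" "r < 1" using C(2) powr_less_mono[of "- \<delta> / 2" 0 2] by (auto simp: r_def)
  \<comment> \<open>The absolute value keeps the quotients nonnegative for every \<open>k\<close>;
    \<open>B\<close> is known to be positive only eventually.\<close>
  have "AE \<omega> in M. (\<lambda>k. D k \<omega> / \<bar>B (2 ^ k)\<bar>) \<longlonglongrightarrow> 0"
  proof (rule AE_tendsto_zero)
    show "0 \<le> D k \<omega> / \<bar>B (2 ^ k)\<bar>" for k \<omega> using D_nonneg by simp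
    show "integrable M (\<lambda>\<omega>. D k \<omega> / \<bar>B (2 ^ k)\<bar>)" for k using D_integrable by simp
    show "summable (\<lambda>k. C * r ^ k)" using r by (intro summable_mult summable_geometric) auto
    have e1: "\<forall>\<^sub>F k in sequentially. G2 (2 ^ k) \<le> C * real (2 ^ k) powr (- \<delta>) * B (2 ^ k)"
      using eventually_compose_filterlim[OF C(3) pow2] .
    have e2: "\<forall>\<^sub>F k in sequentially. 0 < B (2 ^ k)"
      using eventually_compose_filterlim[OF regvar_pos[OF regvar_B] pow2] .
    have e3: "\<forall>\<^sub>F k in sequentially. (real k)\<^sup>2 * r ^ k \<le> 1"
      using r by real_asymp
    show "\<forall>\<^sub>F k in sequentially. expectation (\<lambda>\<omega>. D k \<omega> / \<bar>B (2 ^ k)\<bar>) \<le> C * r ^ k"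
      using e1 e2 e3
    proof eventually_elim
      case (elim k)
      have pw: "real (2 ^ k) powr (- \<delta>) = r ^ k * r ^ k"
      proof -
        have "real (2 ^ k) powr (- \<delta>) = (2 powr real k) powr (- \<delta>)" by (simp add: powr_realpow)
        also have "\<dots> = (2 powr (- \<delta> / 2)) powr real k * (2 powr (- \<delta> / 2)) powr real k"
          by (simp add: powr_powr powr_add[symmetric] mult.commute)
        also have "\<dots> = r ^ k * r ^ k" using r unfolding r_def[symmetric] by (simp add: powr_realpow)
        finally show ?thesis .
      qed
      have "expectation (\<lambda>\<omega>. D k \<omega> / \<bar>B (2 ^ k)\<bar>) = expectation (D k) / B (2 ^ k)" using elim by simp
      also have "\<dots> \<le> (real k)\<^sup>2 * (C * real (2 ^ k) powr (- \<delta>) * B (2 ^ k)) / B (2 ^ k)"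
      proof (intro divide_right_mono)
        have "(real k)\<^sup>2 * G2 (2 ^ k) \<le> (real k)\<^sup>2 * (C * real (2 ^ k) powr (- \<delta>) * B (2 ^ k))"
          using elim by (intro mult_left_mono) auto
        then show "expectation (D k) \<le> (real k)\<^sup>2 * (C * real (2 ^ k) powr (- \<delta>) * B (2 ^ k))"
          using D_expectation[of k] by linarith
      qed (use elim in simp)
      also have "\<dots> = C * (((real k)\<^sup>2 * r ^ k) * r ^ k)" unfolding pw using elim by simp
      also have "\<dots> \<le> C * (1 * r ^ k)" using elim C(1) r by (intro mult_left_mono mult_right_mono) auto
      finally show ?case by simp
    qed
  qed
  then show ?thesis
  proof eventually_elim
    case (elim \<omega>)
    show ?case
    proof (rule LIMSEQ_I)
      fix e :: real assume e: "0 < e"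
      \<comment> \<open>Chosen so that \<open>e' * B (2 ^ Suc k)\<close>, through doubling of
        \<open>B\<close> and the lower bound on the variance, is at most
        \<open>(e / 2 * \<sigma> n)\<^sup>2\<close>.\<close>
      define e' where "e' = (e / 2)\<^sup>2 * c / Cb"
      have e': "0 < e'" using e c Cb by (simp add: e'_def)
      obtain n1 where n1: "\<And>n. n1 \<le> n \<Longrightarrow> c * B n \<le> (\<sigma> n)\<^sup>2" using c(2) unfolding eventually_sequentially by blast
      \<comment> \<open>For \<open>n\<close> in the block starting at \<open>2 ^ k\<close> the
        majorant must reach up to \<open>2 ^ Suc k\<close>.\<close>
      have "(\<lambda>k. D (Suc k) \<omega> / \<bar>B (2 ^ Suc k)\<bar>) \<longlonglongrightarrow> 0" using LIMSEQ_Suc[OF elim] .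
      then have "\<forall>\<^sub>F k in sequentially. D (Suc k) \<omega> / \<bar>B (2 ^ Suc k)\<bar> < e'" using e' by (rule order_tendstoD)
      moreover have "\<forall>\<^sub>F k in sequentially. n1 \<le> k \<and> nb \<le> k" by (intro eventually_conj eventually_ge_at_top)
      ultimately have "\<forall>\<^sub>F k in sequentially. \<forall>n. 2 ^ k \<le> n \<longrightarrow> n < 2 ^ Suc k \<longrightarrow> norm (V n \<omega> / \<sigma> n - 0) < e"
      proof eventually_elim
        case (elim k)
        show ?case
        proof (intro allI impI)
          fix n :: nat assume n: "2 ^ k \<le> n" "n < 2 ^ Suc k"
          have kn: "n1 \<le> n" "nb \<le> n" using elim n(1) less_exp[of k] by linarith+
          have "real (2 ^ Suc k) \<le> real (2 * n)" using n(1) by (simp only: of_nat_le_iff) simp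
          then have b: "0 < B n" "0 < B (2 ^ Suc k)" "B (2 ^ Suc k) \<le> Cb * B n"
            using Cb(3)[of n "2 ^ Suc k"] kn n by auto
          have "0 < c * B n" using b c by simp
          then have s2: "0 < (\<sigma> n)\<^sup>2" using n1[OF kn(1)] by linarith
          have "0 \<le> \<sigma> n" by (simp add: \<sigma>_def)
          then have sp: "0 < \<sigma> n" using s2 by (cases "\<sigma> n = 0") auto
          have "(V n \<omega>)\<^sup>2 \<le> D (Suc k) \<omega>" using n by (intro V_le_D)
          also have "\<dots> \<le> e' * B (2 ^ Suc k)" using elim b(2) by (simp add: pos_divide_less_eq less_imp_le)
          also have "\<dots> \<le> e' * (Cb * B n)" using b e' by (intro mult_left_mono) auto
          also have "\<dots> = (e / 2)\<^sup>2 * (c * B n)" using Cb(1) by (simp add: e'_def)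
          also have "\<dots> \<le> (e / 2)\<^sup>2 * (\<sigma> n)\<^sup>2" using n1[OF kn(1)] by (intro mult_left_mono) auto
          finally have "\<bar>V n \<omega>\<bar>\<^sup>2 \<le> (e / 2 * \<sigma> n)\<^sup>2" by (simp only: power_mult_distrib power2_abs)
          then have "\<bar>V n \<omega>\<bar> \<le> e / 2 * \<sigma> n" by (rule power2_le_imp_le) (use e sp in simp)
          then have "\<bar>V n \<omega>\<bar> / \<sigma> n \<le> e / 2" using sp by (simp only: pos_divide_le_eq)
          then have "\<bar>V n \<omega>\<bar> / \<sigma> n < e" using e by linarith
          then show "norm (V n \<omega> / \<sigma> n - 0) < e" using sp by (simp add: abs_divide)
        qed
      qed
      then have "\<forall>\<^sub>F n in sequentially. norm (V n \<omega> / \<sigma> n - 0) < e" by (rule eventually_dyadic)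
      then show "\<exists>no. \<forall>n\<ge>no. norm (V n \<omega> / \<sigma> n - 0) < e" unfolding eventually_sequentially .
    qed
  qed
qed

end

section \<open>The law of the iterated logarithm\<close>

lemma limsup_eq_one:
  fixes x :: "nat \<Rightarrow> real"
  assumes up: "\<And>\<epsilon>. 0 < \<epsilon> \<Longrightarrow> \<forall>\<^sub>F n in sequentially. x n \<le> 1 + \<epsilon>"
    and low: "\<And>\<epsilon>. 0 < \<epsilon> \<Longrightarrow> \<exists>\<^sub>F n in sequentially. 1 - \<epsilon> \<le> x n"
  shows "limsup (\<lambda>n. ereal (x n)) = 1"
proof (rule antisym)
  show "limsup (\<lambda>n. ereal (x n)) \<le> 1"
  proof (rule ereal_le_epsilon2)
    fix e :: real assume "0 < e"
    then have "limsup (\<lambda>n. ereal (x n)) \<le> ereal (1 + e)"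
      by (intro Limsup_bounded) (use up[of e] in \<open>auto elim: eventually_mono\<close>)
    then show "limsup (\<lambda>n. ereal (x n)) \<le> 1 + ereal e" by (simp only: one_ereal_def plus_ereal.simps)
  qed
  show "1 \<le> limsup (\<lambda>n. ereal (x n))"
  proof (rule ccontr)
    assume "\<not> 1 \<le> limsup (\<lambda>n. ereal (x n))"
    then have "limsup (\<lambda>n. ereal (x n)) < 1" by simp
    then obtain z where z: "limsup (\<lambda>n. ereal (x n)) < ereal z" "ereal z < 1"
      using ereal_dense2 by blast
    then have "\<forall>\<^sub>F n in sequentially. ereal (x n) < ereal z" by (intro Limsup_lessD)
    then have "\<forall>\<^sub>F n in sequentially. \<not> (1 - (1 - z) \<le> x n)" by eventually_elim simp
    moreover have "0 < 1 - z" using z(2) by simp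
    ultimately show False using low[of "1 - z"] by (simp add: frequently_def)
  qed
qed

text \<open>Here \<open>u\<close> will be the normalised Gaussian part, \<open>v\<close> the
  negligible remainder and \<open>q\<close> the ratio of the two normalisations. The lower bounds
  are stated as frequent events, which persist under perturbations that are eventually
  small.\<close>

lemma limsup_perturb:
  fixes x u v q :: "nat \<Rightarrow> real"
  assumes x: "\<forall>\<^sub>F n in sequentially. x n = (u n + v n) / q n"
    and v: "v \<longlonglongrightarrow> 0" and q: "q \<longlonglongrightarrow> 1"
    and up: "\<And>\<epsilon>. 0 < \<epsilon> \<Longrightarrow> \<forall>\<^sub>F n in sequentially. \<bar>u n\<bar> \<le> 1 + \<epsilon>"
    and low: "\<And>\<epsilon>. 0 < \<epsilon> \<Longrightarrow> \<epsilon> < 1 \<Longrightarrow> \<exists>\<^sub>F n in sequentially. 1 - \<epsilon> \<le> u n"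
    and low': "\<And>\<epsilon>. 0 < \<epsilon> \<Longrightarrow> \<epsilon> < 1 \<Longrightarrow> \<exists>\<^sub>F n in sequentially. 1 - \<epsilon> \<le> - u n"
  shows "limsup (\<lambda>n. ereal (x n)) = 1 \<and> liminf (\<lambda>n. ereal (x n)) = - 1 \<and> limsup (\<lambda>n. ereal \<bar>x n\<bar>) = 1"
proof -
  have qpos: "\<forall>\<^sub>F n in sequentially. 0 < q n" using q by (rule order_tendstoD) simp
  have xup: "\<forall>\<^sub>F n in sequentially. \<bar>x n\<bar> \<le> 1 + \<epsilon>" if "0 < \<epsilon>" for \<epsilon>
  proof -
    have "(\<lambda>n. (1 + \<epsilon> / 2 + \<bar>v n\<bar>) / q n) \<longlonglongrightarrow> (1 + \<epsilon> / 2 + \<bar>0\<bar>) / 1" by (intro tendsto_intros v q) simp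
    then have "\<forall>\<^sub>F n in sequentially. (1 + \<epsilon> / 2 + \<bar>v n\<bar>) / q n < 1 + \<epsilon>" by (rule order_tendstoD) (use that in simp)
    moreover have "\<forall>\<^sub>F n in sequentially. \<bar>u n\<bar> \<le> 1 + \<epsilon> / 2" using that by (intro up) simp
    ultimately show ?thesis using qpos x
    proof eventually_elim
      case (elim n)
      have "\<bar>x n\<bar> = \<bar>u n + v n\<bar> / q n" using elim by (simp add: abs_divide)
      also have "\<dots> \<le> (1 + \<epsilon> / 2 + \<bar>v n\<bar>) / q n" using elim by (intro divide_right_mono) auto
      finally show ?case using elim by linarith
    qed
  qed
  have xlow: "\<exists>\<^sub>F n in sequentially. 1 - \<epsilon> \<le> s * x n"
    if e: "0 < \<epsilon>" and s: "\<bar>s\<bar> = 1" and sl: "\<And>\<epsilon>. 0 < \<epsilon> \<Longrightarrow> \<epsilon> < 1 \<Longrightarrow> \<exists>\<^sub>F n in sequentially. 1 - \<epsilon> \<le> s * u n" for \<epsilon> s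
  proof -
    define \<delta> where "\<delta> = min \<epsilon> 1 / 2"
    have d: "0 < \<delta>" "\<delta> < 1" "\<delta> < \<epsilon>" using e by (auto simp: \<delta>_def)
    have "(\<lambda>n. (1 - \<delta> - \<bar>v n\<bar>) / q n) \<longlonglongrightarrow> (1 - \<delta> - \<bar>0\<bar>) / 1" by (intro tendsto_intros v q) simp
    then have "\<forall>\<^sub>F n in sequentially. 1 - \<epsilon> < (1 - \<delta> - \<bar>v n\<bar>) / q n" by (rule order_tendstoD) (use d in simp)
    then have "\<forall>\<^sub>F n in sequentially. 1 - \<delta> \<le> s * u n \<longrightarrow> 1 - \<epsilon> \<le> s * x n" using qpos x
    proof eventually_elim
      case (elim n)
      show ?case
      proof
        assume h: "1 - \<delta> \<le> s * u n"
        have "\<bar>s * v n\<bar> = \<bar>v n\<bar>" using s by (simp add: abs_mult)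
        then have "(1 - \<delta> - \<bar>v n\<bar>) / q n \<le> (s * u n + s * v n) / q n" using h elim by (intro divide_right_mono) linarith+
        also have "\<dots> = s * x n" using elim by (simp add: distrib_left)
        finally show "1 - \<epsilon> \<le> s * x n" using elim by linarith
      qed
    qed
    with sl[OF d(1,2)] show ?thesis by (rule frequently_rev_mp)
  qed
  have l1: "\<exists>\<^sub>F n in sequentially. 1 - \<epsilon> \<le> x n" if "0 < \<epsilon>" for \<epsilon>
    using xlow[of \<epsilon> 1] that low by simp
  have l2: "\<exists>\<^sub>F n in sequentially. 1 - \<epsilon> \<le> - x n" if "0 < \<epsilon>" for \<epsilon>
    using xlow[of \<epsilon> "-1"] that low' by simp
  have u1: "\<forall>\<^sub>F n in sequentially. x n \<le> 1 + \<epsilon>" "\<forall>\<^sub>F n in sequentially. - x n \<le> 1 + \<epsilon>" if "0 < \<epsilon>" for \<epsilon>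
    using xup[OF that] by (eventually_elim, linarith)+
  have l3: "\<exists>\<^sub>F n in sequentially. 1 - \<epsilon> \<le> \<bar>x n\<bar>" if "0 < \<epsilon>" for \<epsilon>
    using l1[OF that] by (rule frequently_elim1) linarith
  have 1: "limsup (\<lambda>n. ereal (x n)) = 1" by (rule limsup_eq_one[OF u1(1) l1])
  have 2: "limsup (\<lambda>n. ereal (- x n)) = 1" by (rule limsup_eq_one[OF u1(2) l2])
  have 3: "limsup (\<lambda>n. ereal \<bar>x n\<bar>) = 1" by (rule limsup_eq_one[OF xup l3])
  have "limsup (\<lambda>n. - ereal (x n)) = - liminf (\<lambda>n. ereal (x n))" by (rule ereal_Limsup_uminus)
  then have "liminf (\<lambda>n. ereal (x n)) = - 1" using 2 by (simp add: ereal_uminus_eq_reorder)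
  with 1 3 show ?thesis by blast
qed

theorem theorem3p3:
  fixes M :: "'w measure"
    and X :: "nat \<Rightarrow> 'w \<Rightarrow> real"
    and \<rho> :: "nat \<Rightarrow> real"
    and c \<alpha> d :: real
    and L\<^sub>0 l\<^sub>a G :: "real \<Rightarrow> real"
    and a :: "nat \<Rightarrow> real"
    and S :: "nat \<Rightarrow> 'w \<Rightarrow> real"
    and A :: "nat \<Rightarrow> real"
  assumes "prob_space M"
    and "gaussian_sequence M X"
    and "stationary_sequence M X"
    and "\<forall>t\<ge>1. prob_space.expectation M (X t) = 0"
    and "\<forall>t\<ge>1. prob_space.expectation M (\<lambda>\<omega>. (X t \<omega>)\<^sup>2) = 1"
    and "\<forall>t\<ge>1. \<forall>h. \<rho> h = prob_space.expectation M (\<lambda>\<omega>. X t \<omega> * X (t + h) \<omega>)"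
    and "\<rho> \<sim>[sequentially] (\<lambda>h. c * real h powr (- \<alpha>) * L\<^sub>0 (real h))"
    and "0 < c" and "0 < \<alpha>" and "\<alpha> < 1"
    and "slowly_varying L\<^sub>0"
    and "square_integrable_gaussian G"
    and "has_hermite_rank G 1"
    and "\<forall>n\<ge>1. a n = real n powr (- d) * l\<^sub>a (real n)"
    and "slowly_varying l\<^sub>a"
    and "2 * d + \<alpha> < 1"
    and "\<forall>n \<omega>. S n \<omega> = (\<Sum>t=1..n. a t * G (X t \<omega>))"
    and "\<forall>n. A n = sqrt (prob_space.variance M (S n))"
  shows "(AE \<omega> in M.
            limsup (\<lambda>n. ereal (S n \<omega> / (A n * sqrt (2 * ln (ln (real n)))))) = 1 \<and>
            liminf (\<lambda>n. ereal (S n \<omega> / (A n * sqrt (2 * ln (ln (real n)))))) = -1)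
         \<and> (AE \<omega> in M.
            limsup (\<lambda>n. ereal (\<bar>S n \<omega>\<bar> / (A n * sqrt (2 * ln (ln (real n)))))) = 1)"
proof -
  interpret prob_space M by fact
  define J where "J = hermite_coeff G 1"
  define R where "R x = G x - J * x" for x
  have J0: "J \<noteq> 0" using assms(13) by (simp add: has_hermite_rank_def J_def)
  have R: "L2_function std_normal_distribution R"
    "(\<lambda>N. l2norm std_normal_distribution (\<lambda>x. R x - (\<Sum>q=2..N. hermite_coeff G q / fact q * hermite q x))) \<longlonglongrightarrow> 0"
    using hermite_rank_one_decomposition[OF assms(12,13)] unfolding R_def[abs_def] J_def by auto
  have rv_a: "regvar a (- d)"
  proof (rule regvar_cong_bounds[OF regvar_slowly_varying[OF assms(15), of "- d"], of 1 _ 1])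
    show "\<forall>\<^sub>F n in sequentially. 1 * (real n powr (- d) * l\<^sub>a (real n)) \<le> a n \<and> a n \<le> 1 * (real n powr (- d) * l\<^sub>a (real n))"
      using eventually_ge_at_top[of "1::nat"] by eventually_elim (simp add: assms(14))
  qed simp
  have rv_\<rho>: "regvar \<rho> (- \<alpha>)"
  proof (rule regvar_cong_bounds[OF regvar_slowly_varying[OF assms(11), of "- \<alpha>"], of "c / 2" _ "2 * c"])
    define b where "b h = c * real h powr (- \<alpha>) * L\<^sub>0 (real h)" for h
    have "(\<lambda>h. if \<rho> h = 0 \<and> b h = 0 then 1 else \<rho> h / b h) \<longlonglongrightarrow> 1"
      using assms(7) unfolding asymp_equiv_def b_def .
    then have "\<forall>\<^sub>F h in sequentially. 1 / 2 < (if \<rho> h = 0 \<and> b h = 0 then 1 else \<rho> h / b h)"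
      "\<forall>\<^sub>F h in sequentially. (if \<rho> h = 0 \<and> b h = 0 then 1 else \<rho> h / b h) < 2"
      by (rule order_tendstoD, simp)+
    moreover have "\<forall>\<^sub>F h in sequentially. 0 < real h powr (- \<alpha>) * L\<^sub>0 (real h)"
      by (rule regvar_pos[OF regvar_slowly_varying[OF assms(11)]])
    ultimately show "\<forall>\<^sub>F n in sequentially. c / 2 * (real n powr (- \<alpha>) * L\<^sub>0 (real n)) \<le> \<rho> n \<and> \<rho> n \<le> 2 * c * (real n powr (- \<alpha>) * L\<^sub>0 (real n))"
    proof eventually_elim
      case (elim h)
      \<comment> \<open>Positivity of the comparison sequence removes the convention that a quotient
        of two zeros counts as 1.\<close>
      have b: "0 < b h" using elim assms(8) by (simp add: b_def mult.assoc)
      then have "1 / 2 < \<rho> h / b h" "\<rho> h / b h < 2" using elim by auto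
      then have "b h / 2 \<le> \<rho> h" "\<rho> h \<le> 2 * b h" using b by (auto simp: field_simps)
      then show ?case by (simp add: b_def mult.assoc)
    qed
  qed (use assms(8) in simp)
  interpret regvar_sums M X \<rho> a \<alpha> d
  proof (unfold_locales, goal_cases)
    case (1 I b) then show ?case using assms(2) by (simp add: gaussian_sequence_def)
  qed (use assms rv_a rv_\<rho> in auto)
  have GX: "L2_function M (\<lambda>\<omega>. R (X t \<omega>))" if "1 \<le> t" for t
  proof -
    have [measurable]: "R \<in> borel_measurable borel" "X t \<in> borel_measurable M"
      using R(1) X_props(2)[OF that] by (auto simp: L2_function_def)
    show ?thesis
      using gaussian_rv_integral(2)[OF X_props(1)[OF that] mean0[OF that], of "\<lambda>x. (R x)\<^sup>2"] R(1) X_props(3)[OF that]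
      by (simp add: L2_function_def)
  qed
  interpret regvar_remainder M X \<rho> a \<alpha> d R "(l2norm std_normal_distribution R)\<^sup>2"
  proof (unfold_locales, goal_cases)
    case (1 t) then show ?case by (rule GX)
  next
    case (2 s t)
    show ?case
      using hermite_tail_covariance_bound[OF X_pair[OF 2] X_props(3)[OF 2(1)] X_props(3)[OF 2(2)] R] cov_lag[OF 2] by simp
  next
    case 3 show ?case by simp
  qed
  have S_eq: "S n \<omega> = J * U n \<omega> + V n \<omega>" for n \<omega>
    using assms(17) by (simp add: U_def V_def R_def sum_distrib_left sum.distrib[symmetric] algebra_simps)
  obtain C K \<eta> N0 where "gaussian_lil M U \<sigma> N0 C K \<eta>" by (rule gaussian_lil_U)
  then interpret L: gaussian_lil M U \<sigma> N0 C K \<eta> .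
  have sig: "l2norm M (U n) = \<sigma> n" for n by (simp add: \<sigma>_def)
  have spos: "\<forall>\<^sub>F n in sequentially. 0 < \<sigma> n"
    using L.sigma_pos unfolding eventually_sequentially by blast
  have Jp: "0 < \<bar>J\<bar>" using J0 by simp
  \<comment> \<open>The Gaussian part has norm \<open>\<bar>J\<bar> * \<sigma> n\<close> and mean 0.
    The remainder is of smaller order in norm, so it affects neither the norm of \<open>S n\<close>
    to leading order nor, through its mean, the variance.\<close>
  have A_lim: "(\<lambda>n. A n / (\<bar>J\<bar> * \<sigma> n)) \<longlonglongrightarrow> 1"
  proof -
    define w where "w n = l2norm M (V n) / (\<bar>J\<bar> * \<sigma> n)" for n
    have w0: "w \<longlonglongrightarrow> 0"
    proof -
      have "(\<lambda>n. l2norm M (V n) / \<sigma> n * (1 / \<bar>J\<bar>)) \<longlonglongrightarrow> 0 * (1 / \<bar>J\<bar>)" by (intro tendsto_intros V_norm_negligible)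
      then show ?thesis by (simp add: w_def[abs_def] mult.commute)
    qed
    have SL: "L2_function M (S n)" for n
      unfolding S_eq[abs_def] by (intro L2_function_add L2_function_cmult U_L2 V_L2)
    have ES: "expectation (S n) = expectation (V n)" for n
      unfolding S_eq[abs_def] using L2_integrable[OF U_L2[of n]] L2_integrable[OF V_L2[of n]] gaussian_pairD(3)[OF U_pair[of n n]] by simp
    have n1: "(\<lambda>n. l2norm M (S n) / (\<bar>J\<bar> * \<sigma> n)) \<longlonglongrightarrow> 1"
    proof (rule LIM_zero_cancel, rule Lim_null_comparison[OF _ w0])
      show "\<forall>\<^sub>F n in sequentially. norm (l2norm M (S n) / (\<bar>J\<bar> * \<sigma> n) - 1) \<le> w n"
        using spos
      proof eventually_elim
        case (elim n)
        have "\<bar>l2norm M (S n) - l2norm M (\<lambda>\<omega>. J * U n \<omega>)\<bar> \<le> l2norm M (\<lambda>\<omega>. S n \<omega> - J * U n \<omega>)"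
          by (intro l2norm_triangle_diff SL L2_function_cmult U_L2)
        then have "\<bar>l2norm M (S n) - \<bar>J\<bar> * \<sigma> n\<bar> \<le> l2norm M (V n)" by (simp add: l2norm_cmult sig S_eq)
        then have "\<bar>l2norm M (S n) - \<bar>J\<bar> * \<sigma> n\<bar> / (\<bar>J\<bar> * \<sigma> n) \<le> w n"
          unfolding w_def using elim Jp by (intro divide_right_mono) auto
        moreover have "l2norm M (S n) / (\<bar>J\<bar> * \<sigma> n) - 1 = (l2norm M (S n) - \<bar>J\<bar> * \<sigma> n) / (\<bar>J\<bar> * \<sigma> n)"
          using elim Jp by (simp add: diff_divide_distrib)
        ultimately show ?case using elim Jp by (simp add: abs_divide abs_mult)
      qed
    qed
    have n2: "(\<lambda>n. expectation (S n) / (\<bar>J\<bar> * \<sigma> n)) \<longlonglongrightarrow> 0"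
    proof (rule Lim_null_comparison[OF _ w0])
      show "\<forall>\<^sub>F n in sequentially. norm (expectation (S n) / (\<bar>J\<bar> * \<sigma> n)) \<le> w n"
        using spos
      proof eventually_elim
        case (elim n)
        have "\<bar>expectation (S n)\<bar> / (\<bar>J\<bar> * \<sigma> n) \<le> w n"
          unfolding w_def ES using elim Jp abs_expectation_le_l2norm[OF V_L2[of n]] by (intro divide_right_mono) auto
        then show ?case using elim Jp by (simp add: abs_divide abs_mult)
      qed
    qed
    have "(\<lambda>n. sqrt ((l2norm M (S n) / (\<bar>J\<bar> * \<sigma> n))\<^sup>2 - (expectation (S n) / (\<bar>J\<bar> * \<sigma> n))\<^sup>2)) \<longlonglongrightarrow> sqrt (1\<^sup>2 - 0\<^sup>2)"
      by (intro tendsto_intros n1 n2)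
    moreover have "\<forall>\<^sub>F n in sequentially. sqrt ((l2norm M (S n) / (\<bar>J\<bar> * \<sigma> n))\<^sup>2 - (expectation (S n) / (\<bar>J\<bar> * \<sigma> n))\<^sup>2) = A n / (\<bar>J\<bar> * \<sigma> n)"
      using spos
    proof eventually_elim
      case (elim n)
      have "variance (S n) = (l2norm M (S n))\<^sup>2 - (expectation (S n))\<^sup>2"
        unfolding l2norm_power2 using L2_integrable[OF SL[of n]] SL[of n] by (intro variance_eq) auto
      then have An: "A n = sqrt ((l2norm M (S n))\<^sup>2 - (expectation (S n))\<^sup>2)" using assms(18) by simp
      have p: "0 < \<bar>J\<bar> * \<sigma> n" using elim Jp by simp
      have "(l2norm M (S n) / (\<bar>J\<bar> * \<sigma> n))\<^sup>2 - (expectation (S n) / (\<bar>J\<bar> * \<sigma> n))\<^sup>2 = ((l2norm M (S n))\<^sup>2 - (expectation (S n))\<^sup>2) / (\<bar>J\<bar> * \<sigma> n)\<^sup>2"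
        by (simp only: power_divide diff_divide_distrib)
      then have "sqrt ((l2norm M (S n) / (\<bar>J\<bar> * \<sigma> n))\<^sup>2 - (expectation (S n) / (\<bar>J\<bar> * \<sigma> n))\<^sup>2) = A n / sqrt ((\<bar>J\<bar> * \<sigma> n)\<^sup>2)"
        by (simp only: real_sqrt_divide An)
      also have "sqrt ((\<bar>J\<bar> * \<sigma> n)\<^sup>2) = \<bar>J\<bar> * \<sigma> n" using p by (intro real_sqrt_unique) auto
      finally show ?case .
    qed
    ultimately show ?thesis by (simp add: tendsto_cong)
  qed
  define \<Lambda> where "\<Lambda> n = sqrt (2 * ln (ln (real n)))" for n :: nat
  have Lpos: "\<forall>\<^sub>F n in sequentially. 1 \<le> \<Lambda> n" unfolding \<Lambda>_def by real_asymp
  have Linv: "(\<lambda>n. 1 / \<Lambda> n) \<longlonglongrightarrow> 0" unfolding \<Lambda>_def by real_asymp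
  have upAE: "AE \<omega> in M. \<forall>m. \<forall>\<^sub>F n in sequentially. \<bar>U n \<omega>\<bar> \<le> (1 + 1 / real (Suc m)) * (\<sigma> n * \<Lambda> n)"
    unfolding AE_all_countable \<Lambda>_def by (intro allI L.LIL_upper) simp
  \<comment> \<open>Tolerances are \<open>1 / (m + 2)\<close>, since the lower bound requires them
    to be strictly below 1; a countable family makes one exceptional null set enough.\<close>
  have lowAE: "AE \<omega> in M. \<forall>m. \<exists>\<^sub>F n in sequentially. (1 - 1 / real (Suc (Suc m))) * (\<sigma> n * \<Lambda> n) \<le> s * U n \<omega>" if "\<bar>s\<bar> = 1" for s
    unfolding AE_all_countable \<Lambda>_def using that by (intro allI L.LIL_lower) auto
  have main: "AE \<omega> in M. limsup (\<lambda>n. ereal (S n \<omega> / (A n * \<Lambda> n))) = 1 \<and> liminf (\<lambda>n. ereal (S n \<omega> / (A n * \<Lambda> n))) = - 1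
     \<and> limsup (\<lambda>n. ereal \<bar>S n \<omega> / (A n * \<Lambda> n)\<bar>) = 1"
    using upAE lowAE[of 1, simplified] lowAE[of "-1", simplified] V_negligible
  proof eventually_elim
    case (elim \<omega>)
    \<comment> \<open>A negative first coefficient merely exchanges the roles of the two one-sided
      lower bounds, as both signs of \<open>U\<close> are covered.\<close>
    define s where "s = sgn J"
    have s: "s = 1 \<or> s = - 1" using J0 by (auto simp: s_def sgn_if)
    have Js: "J = s * \<bar>J\<bar>" by (simp add: s_def sgn_if)
    define u where "u n = s * U n \<omega> / (\<sigma> n * \<Lambda> n)" for n
    define v where "v n = V n \<omega> / \<sigma> n * (1 / \<bar>J\<bar>) * (1 / \<Lambda> n)" for n
    have good: "\<forall>\<^sub>F n in sequentially. 0 < \<sigma> n * \<Lambda> n"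
      using spos Lpos by eventually_elim simp
    have fup: "\<forall>\<^sub>F n in sequentially. \<bar>u n\<bar> \<le> 1 + \<epsilon>" if "0 < \<epsilon>" for \<epsilon>
    proof -
      obtain m where m: "1 / real (Suc m) < \<epsilon>" using reals_Archimedean[OF \<open>0 < \<epsilon>\<close>] by (auto simp: inverse_eq_divide)
      from elim(1)[rule_format, of m] good show ?thesis
      proof eventually_elim
        case (elim n)
        have "\<bar>u n\<bar> = \<bar>U n \<omega>\<bar> / (\<sigma> n * \<Lambda> n)" using elim(2) s by (auto simp: u_def abs_divide)
        also have "\<dots> \<le> 1 + 1 / real (Suc m)" using elim by (simp only: pos_divide_le_eq)
        finally show ?case using m by linarith
      qed
    qed
    have flow: "\<exists>\<^sub>F n in sequentially. 1 - \<epsilon> \<le> r * (U n \<omega> / (\<sigma> n * \<Lambda> n))"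
      if e: "0 < \<epsilon>" and fr: "\<forall>m. \<exists>\<^sub>F n in sequentially. (1 - 1 / real (Suc (Suc m))) * (\<sigma> n * \<Lambda> n) \<le> r * U n \<omega>" for \<epsilon> r
    proof -
      obtain m where "1 / real (Suc m) < \<epsilon>" using reals_Archimedean[OF e] by (auto simp: inverse_eq_divide)
      moreover have "1 / real (Suc (Suc m)) \<le> 1 / real (Suc m)" by (intro divide_left_mono) auto
      ultimately have m: "1 / real (Suc (Suc m)) < \<epsilon>" by linarith
      from good have "\<forall>\<^sub>F n in sequentially. (1 - 1 / real (Suc (Suc m))) * (\<sigma> n * \<Lambda> n) \<le> r * U n \<omega> \<longrightarrow> 1 - \<epsilon> \<le> r * (U n \<omega> / (\<sigma> n * \<Lambda> n))"
      proof eventually_elim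
        case (elim n)
        show ?case
        proof
          assume "(1 - 1 / real (Suc (Suc m))) * (\<sigma> n * \<Lambda> n) \<le> r * U n \<omega>"
          then have "1 - 1 / real (Suc (Suc m)) \<le> (r * U n \<omega>) / (\<sigma> n * \<Lambda> n)" using elim by (simp only: pos_le_divide_eq)
          then show "1 - \<epsilon> \<le> r * (U n \<omega> / (\<sigma> n * \<Lambda> n))" using m by simp
        qed
      qed
      with fr[rule_format, of m] show ?thesis by (rule frequently_rev_mp)
    qed
    have fp: "\<exists>\<^sub>F n in sequentially. 1 - \<epsilon> \<le> U n \<omega> / (\<sigma> n * \<Lambda> n)" if "0 < \<epsilon>" for \<epsilon>
      using flow[OF that, of 1] elim(2) by simp
    have fm: "\<exists>\<^sub>F n in sequentially. 1 - \<epsilon> \<le> - (U n \<omega> / (\<sigma> n * \<Lambda> n))" if "0 < \<epsilon>" for \<epsilon>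
      using flow[OF that, of "-1"] elim(3) by simp
    show ?case
    proof (rule limsup_perturb)
      show "\<forall>\<^sub>F n in sequentially. S n \<omega> / (A n * \<Lambda> n) = (u n + v n) / (A n / (\<bar>J\<bar> * \<sigma> n))"
        using spos Lpos
      proof eventually_elim
        case (elim n)
        have nz: "\<bar>J\<bar> \<noteq> 0" "\<sigma> n \<noteq> 0" "\<Lambda> n \<noteq> 0" using elim Jp by auto
        have "u n + v n = S n \<omega> / (\<bar>J\<bar> * \<sigma> n * \<Lambda> n)"
        proof -
          have "s * U n \<omega> / (\<sigma> n * \<Lambda> n) = (s * \<bar>J\<bar>) * U n \<omega> / (\<bar>J\<bar> * \<sigma> n * \<Lambda> n)" using nz by simp
          then show ?thesis unfolding u_def v_def S_eq Js[symmetric] by (simp add: add_divide_distrib mult_ac)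
        qed
        then show ?case using nz by simp
      qed
      have "v \<longlonglongrightarrow> 0 * (1 / \<bar>J\<bar>) * 0" unfolding v_def by (intro tendsto_intros elim(4) Linv)
      then show "v \<longlonglongrightarrow> 0" by simp
      show "(\<lambda>n. A n / (\<bar>J\<bar> * \<sigma> n)) \<longlonglongrightarrow> 1" by (rule A_lim)
      show "\<exists>\<^sub>F n in sequentially. 1 - \<epsilon> \<le> u n" "\<exists>\<^sub>F n in sequentially. 1 - \<epsilon> \<le> - u n" if "0 < \<epsilon>" "\<epsilon> < 1" for \<epsilon>
        using s fp[OF that(1)] fm[OF that(1)] by (auto simp: u_def)
    qed (rule fup)
  qed
  have Anonneg: "0 \<le> A n" for n using assms(18) by simp
  \<comment> \<open>The equality is only eventual: for small \<open>n\<close> the iterated logarithm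
    can be negative, and then so is its \<open>sqrt\<close>.\<close>
  have abs_eq: "\<forall>\<^sub>F n in sequentially. ereal \<bar>S n \<omega> / (A n * \<Lambda> n)\<bar> = ereal (\<bar>S n \<omega>\<bar> / (A n * \<Lambda> n))" for \<omega>
    using Lpos by eventually_elim (use Anonneg in \<open>simp add: abs_divide abs_mult\<close>)
  have "AE \<omega> in M. limsup (\<lambda>n. ereal (\<bar>S n \<omega>\<bar> / (A n * \<Lambda> n))) = 1"
    using main by eventually_elim (use Limsup_eq[OF abs_eq] in simp)
  moreover have "AE \<omega> in M. limsup (\<lambda>n. ereal (S n \<omega> / (A n * \<Lambda> n))) = 1 \<and> liminf (\<lambda>n. ereal (S n \<omega> / (A n * \<Lambda> n))) = - 1"
    using main by eventually_elim simp
  ultimately show ?thesis unfolding \<Lambda>_def by blast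
qed

end
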